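(* Let $k$ be an algebraically closed field of characteristic $p\geqslant0$, $n\ge1$ an integer invertible in $k$, $\Lambda=\mathbb{Z}/n\mathbb{Z}$. Let $f\colon Y\to X$ be a finite generically Galois morphism of integral smooth curves over $k$ with group $G$, $y$ a closed point of $Y$, and assume that the ramification index of $f$ at $y$ is divisible by $n$. Let $I_y\subseteq G$ be the inertia group at $y$, $P_y\subseteq I_y$ the wild inertia subgroup, and $M$ a $\Lambda[G]$-module. Then the canonical (inflation) morphism $$C^{12}(I_y/P_y,M^{P_y})\longrightarrow C^{12}(I_y,M)$$ admits a left inverse (a homomorphism $C^{12}(I_y,M)\to C^{12}(I_y/P_y,M^{P_y})$ whose composite with the inflation morphism is the identity of $C^{12}(I_y/P_y,M^{P_y})$).
   Context: A finite morphism of integral curves is generically Galois if the corresponding extension of function fields is Galois. For a group $H$ acting on a module $N$, $C^{12}(H,N)$ denotes the group of crossed homomorphisms $H\to N$. Since $k$ is algebraically closed, $I_y$ is the stabiliser of $y$ in $G$; $P_y$ is the kernel of the canonical surjection $I_y\to\mu_e(k)$, where $e$ is the ramification index; it is a $p$-group (trivial if $p=0$). The inflation morphism sends $c\colon I_y/P_y\to M^{P_y}$ to the composite $I_y\to I_y/P_y\xrightarrow{c}M^{P_y}\subseteq M$. *)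

theory Defs
  imports
    "HOL-Analysis.Abstract_Topology"
    "HOL-Algebra.Algebra"
    "HOL-Algebra.Ideal_Product"
begin

section \<open>Commutative algebra\<close>

definition max_ideal :: "('a, 'm) ring_scheme \<Rightarrow> 'a set" where
  "max_ideal R = carrier R - Units R"

definition local_ring :: "('a, 'm) ring_scheme \<Rightarrow> bool" where
  "local_ring R \<longleftrightarrow> cring R \<and> maximalideal (max_ideal R) R"

definition strict_chain :: "'a set set \<Rightarrow> nat \<Rightarrow> (nat \<Rightarrow> 'a set) \<Rightarrow> bool" where
  "strict_chain \<P> d Z \<longleftrightarrow> (\<forall>i\<le>d. Z i \<in> \<P>) \<and> (\<forall>i<d. Z i \<subset> Z (Suc i))"

definition chain_dim :: "'a set set \<Rightarrow> nat \<Rightarrow> bool" where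
  "chain_dim \<P> d \<longleftrightarrow> (\<exists>Z. strict_chain \<P> d Z) \<and> (\<nexists>Z. strict_chain \<P> (Suc d) Z)"

definition prime_spectrum :: "('a, 'm) ring_scheme \<Rightarrow> 'a set set" where
  "prime_spectrum R = {P. primeideal P R}"

definition zariski_topology :: "('a, 'm) ring_scheme \<Rightarrow> 'a set topology" where
  "zariski_topology R =
     topology_generated_by ((\<lambda>a. {P \<in> prime_spectrum R. a \<notin> P}) ` carrier R)"

definition regular_local_ring :: "('a, 'm) ring_scheme \<Rightarrow> bool" where
  "regular_local_ring R \<longleftrightarrow>
     local_ring R \<and> noetherian_ring R \<and>
     (\<exists>d. chain_dim (prime_spectrum R) d \<and>
          (\<exists>S. S \<subseteq> carrier R \<and> finite S \<and> card S = d \<and> genideal R S = max_ideal R))"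

definition is_localization_at ::
    "('a, 'm) ring_scheme \<Rightarrow> 'a \<Rightarrow> ('b, 'n) ring_scheme \<Rightarrow> ('a \<Rightarrow> 'b) \<Rightarrow> bool" where
  "is_localization_at R a S h \<longleftrightarrow>
     h \<in> ring_hom R S \<and>
     h a \<in> Units S \<and>
     (\<forall>b\<in>carrier S. \<exists>r\<in>carrier R. \<exists>m::nat. b \<otimes>\<^bsub>S\<^esub> (h a [^]\<^bsub>S\<^esub> m) = h r) \<and>
     (\<forall>r\<in>carrier R. h r = \<zero>\<^bsub>S\<^esub> \<longrightarrow> (\<exists>m::nat. (a [^]\<^bsub>R\<^esub> m) \<otimes>\<^bsub>R\<^esub> r = \<zero>\<^bsub>R\<^esub>))"

fun ideal_power :: "('a, 'm) ring_scheme \<Rightarrow> 'a set \<Rightarrow> nat \<Rightarrow> 'a set" where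
  "ideal_power R I 0 = carrier R"
| "ideal_power R I (Suc m) = ideal_prod R I (ideal_power R I m)"


section \<open>Galois theory\<close>

definition galois_group :: "'a ring \<Rightarrow> 'a set \<Rightarrow> ('a \<Rightarrow> 'a) monoid" where
  "galois_group L K =
     (BijGroup (carrier L))
       \<lparr>carrier := {\<sigma> \<in> Bij (carrier L). \<sigma> \<in> ring_hom L L \<and> (\<forall>a\<in>K. \<sigma> a = a)}\<rparr>"

definition finite_galois_extension :: "'a ring \<Rightarrow> 'a set \<Rightarrow> bool" where
  "finite_galois_extension L K \<longleftrightarrow>
     field L \<and> subfield K L \<and> ring.finite_dimension L K (carrier L) \<and>
     {a \<in> carrier L. \<forall>\<sigma> \<in> carrier (galois_group L K). \<sigma> a = a} = K"


section \<open>Ringed spaces, germs and schemes\<close>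

record ('x, 's) ringed_space =
  space_top :: "'x topology"
  sections :: "'x set \<Rightarrow> 's ring"
  restr :: "'x set \<Rightarrow> 'x set \<Rightarrow> 's \<Rightarrow> 's"

abbreviation points :: "('x, 's, 'z) ringed_space_scheme \<Rightarrow> 'x set" where
  "points Z \<equiv> topspace (space_top Z)"

abbreviation open_in :: "('x, 's, 'z) ringed_space_scheme \<Rightarrow> 'x set \<Rightarrow> bool" where
  "open_in Z U \<equiv> openin (space_top Z) U"

definition ringed_space :: "('x, 's, 'z) ringed_space_scheme \<Rightarrow> bool" where
  "ringed_space Z \<longleftrightarrow>
     (\<forall>U. open_in Z U \<longrightarrow> cring (sections Z U)) \<and>
     (\<forall>U V. open_in Z U \<longrightarrow> open_in Z V \<longrightarrow> V \<subseteq> U \<longrightarrow>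
        restr Z U V \<in> ring_hom (sections Z U) (sections Z V)) \<and>
     (\<forall>U. open_in Z U \<longrightarrow> (\<forall>a\<in>carrier (sections Z U). restr Z U U a = a)) \<and>
     (\<forall>U V W. open_in Z U \<longrightarrow> open_in Z V \<longrightarrow> open_in Z W \<longrightarrow> W \<subseteq> V \<longrightarrow> V \<subseteq> U \<longrightarrow>
        (\<forall>a\<in>carrier (sections Z U). restr Z V W (restr Z U V a) = restr Z U W a)) \<and>
     (\<forall>\<U>. (\<forall>U\<in>\<U>. open_in Z U) \<longrightarrow>
        (\<forall>a\<in>carrier (sections Z (\<Union>\<U>)). \<forall>b\<in>carrier (sections Z (\<Union>\<U>)).
           (\<forall>U\<in>\<U>. restr Z (\<Union>\<U>) U a = restr Z (\<Union>\<U>) U b) \<longrightarrow> a = b)) \<and>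
     (\<forall>\<U> a. (\<forall>U\<in>\<U>. open_in Z U) \<longrightarrow> (\<forall>U\<in>\<U>. a U \<in> carrier (sections Z U)) \<longrightarrow>
        (\<forall>U\<in>\<U>. \<forall>V\<in>\<U>. restr Z U (U \<inter> V) (a U) = restr Z V (U \<inter> V) (a V)) \<longrightarrow>
        (\<exists>b\<in>carrier (sections Z (\<Union>\<U>)). \<forall>U\<in>\<U>. restr Z (\<Union>\<U>) U b = a U))"

text \<open>
  The colimit of \<^term>\<open>sections Z U\<close> over a family \<open>\<N>\<close> of opens that is closed under binary
  intersection. The open neighbourhoods of a point give its stalk; on an integral scheme
  the nonempty opens (the neighbourhoods of the generic point) give the function field.
\<close>

definition germ_rel ::
    "('x, 's, 'z) ringed_space_scheme \<Rightarrow> 'x set set \<Rightarrow> (('x set \<times> 's) \<times> ('x set \<times> 's)) set" where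
  "germ_rel Z \<N> = {((U, a), (V, b)).
     U \<in> \<N> \<and> V \<in> \<N> \<and> a \<in> carrier (sections Z U) \<and> b \<in> carrier (sections Z V) \<and>
     (\<exists>W\<in>\<N>. W \<subseteq> U \<inter> V \<and> restr Z U W a = restr Z V W b)}"

type_synonym ('x, 's) germ = "('x set \<times> 's) set"

definition germ ::
    "('x, 's, 'z) ringed_space_scheme \<Rightarrow> 'x set set \<Rightarrow> 'x set \<Rightarrow> 's \<Rightarrow> ('x, 's) germ" where
  "germ Z \<N> U a = germ_rel Z \<N> `` {(U, a)}"

definition germ_ring ::
    "('x, 's, 'z) ringed_space_scheme \<Rightarrow> 'x set set \<Rightarrow> ('x, 's) germ ring" where
  "germ_ring Z \<N> =
     \<lparr>carrier = {germ Z \<N> U a | U a. U \<in> \<N> \<and> a \<in> carrier (sections Z U)},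
      monoid.mult = (\<lambda>A B. \<Union>(U, a)\<in>A. \<Union>(V, b)\<in>B. germ Z \<N> (U \<inter> V)
                (restr Z U (U \<inter> V) a \<otimes>\<^bsub>sections Z (U \<inter> V)\<^esub> restr Z V (U \<inter> V) b)),
      one = germ Z \<N> (points Z) \<one>\<^bsub>sections Z (points Z)\<^esub>,
      ring.zero = germ Z \<N> (points Z) \<zero>\<^bsub>sections Z (points Z)\<^esub>,
      ring.add = (\<lambda>A B. \<Union>(U, a)\<in>A. \<Union>(V, b)\<in>B. germ Z \<N> (U \<inter> V)
                (restr Z U (U \<inter> V) a \<oplus>\<^bsub>sections Z (U \<inter> V)\<^esub> restr Z V (U \<inter> V) b))\<rparr>"

definition nbhds :: "('x, 's, 'z) ringed_space_scheme \<Rightarrow> 'x \<Rightarrow> 'x set set" where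
  "nbhds Z x = {U. open_in Z U \<and> x \<in> U}"

definition nonempty_opens :: "('x, 's, 'z) ringed_space_scheme \<Rightarrow> 'x set set" where
  "nonempty_opens Z = {U. open_in Z U \<and> U \<noteq> {}}"

abbreviation stalk :: "('x, 's, 'z) ringed_space_scheme \<Rightarrow> 'x \<Rightarrow> ('x, 's) germ ring" where
  "stalk Z x \<equiv> germ_ring Z (nbhds Z x)"

abbreviation function_field :: "('x, 's, 'z) ringed_space_scheme \<Rightarrow> ('x, 's) germ ring" where
  "function_field Z \<equiv> germ_ring Z (nonempty_opens Z)"

definition germ_incl ::
    "('x, 's, 'z) ringed_space_scheme \<Rightarrow> ('x, 's) germ \<Rightarrow> ('x, 's) germ" where
  "germ_incl Z A = (\<Union>(U, a)\<in>A. germ Z (nonempty_opens Z) U a)"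

definition locally_ringed_space :: "('x, 's, 'z) ringed_space_scheme \<Rightarrow> bool" where
  "locally_ringed_space Z \<longleftrightarrow> ringed_space Z \<and> (\<forall>x\<in>points Z. local_ring (stalk Z x))"

definition vanishing_prime :: "('x, 's, 'z) ringed_space_scheme \<Rightarrow> 'x set \<Rightarrow> 'x \<Rightarrow> 's set" where
  "vanishing_prime Z U x =
     {a \<in> carrier (sections Z U). germ Z (nbhds Z x) U a \<in> max_ideal (stalk Z x)}"

definition nonvanishing_locus ::
    "('x, 's, 'z) ringed_space_scheme \<Rightarrow> 'x set \<Rightarrow> 's \<Rightarrow> 'x set" where
  "nonvanishing_locus Z U a = {x \<in> U. a \<notin> vanishing_prime Z U x}"

text \<open>
  \<open>U\<close> is isomorphic to \<open>Spec R\<close> for \<open>R = sections Z U\<close>: the canonical map to \<open>Spec R\<close> is a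
  homeomorphism under which the sheaf has the values \<open>R\<^sub>a\<close> on the basic opens \<open>D(a)\<close>
  (Eisenbud--Harris, The Geometry of Schemes, I.2.1).
\<close>

definition affine_open :: "('x, 's, 'z) ringed_space_scheme \<Rightarrow> 'x set \<Rightarrow> bool" where
  "affine_open Z U \<longleftrightarrow>
     open_in Z U \<and>
     homeomorphic_map (subtopology (space_top Z) U) (zariski_topology (sections Z U))
       (vanishing_prime Z U) \<and>
     (\<forall>a\<in>carrier (sections Z U).
        is_localization_at (sections Z U) a (sections Z (nonvanishing_locus Z U a))
          (restr Z U (nonvanishing_locus Z U a)))"

definition scheme :: "('x, 's, 'z) ringed_space_scheme \<Rightarrow> bool" where
  "scheme Z \<longleftrightarrow> locally_ringed_space Z \<and> (\<forall>x\<in>points Z. \<exists>U. x \<in> U \<and> affine_open Z U)"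

definition integral_scheme :: "('x, 's, 'z) ringed_space_scheme \<Rightarrow> bool" where
  "integral_scheme Z \<longleftrightarrow>
     scheme Z \<and> points Z \<noteq> {} \<and> (\<forall>U\<in>nonempty_opens Z. domain (sections Z U))"

definition irreducible_closed_sets :: "'x topology \<Rightarrow> 'x set set" where
  "irreducible_closed_sets T =
     {Z. closedin T Z \<and> Z \<noteq> {} \<and>
         (\<forall>A B. closedin T A \<longrightarrow> closedin T B \<longrightarrow> Z \<subseteq> A \<union> B \<longrightarrow> Z \<subseteq> A \<or> Z \<subseteq> B)}"


section \<open>Schemes and curves over a field\<close>

text \<open>
  A morphism \<open>Z \<rightarrow> Spec k\<close> is recorded by the corresponding ring homomorphism from \<open>k\<close> to the
  global sections.
\<close>

record ('k, 'x, 's) space_over = "('x, 's) ringed_space" +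
  scalar :: "'k \<Rightarrow> 's"

definition scheme_over :: "'k ring \<Rightarrow> ('k, 'x, 's) space_over \<Rightarrow> bool" where
  "scheme_over k Z \<longleftrightarrow> scheme Z \<and> scalar Z \<in> ring_hom k (sections Z (points Z))"

definition finite_type_over :: "'k ring \<Rightarrow> ('k, 'x, 's) space_over \<Rightarrow> bool" where
  "finite_type_over k Z \<longleftrightarrow>
     (\<exists>\<U>. finite \<U> \<and> \<Union>\<U> = points Z \<and>
        (\<forall>U\<in>\<U>. affine_open Z U \<and>
           (\<exists>S. finite S \<and> S \<subseteq> carrier (sections Z U) \<and>
              generate_ring (sections Z U)
                ((\<lambda>c. restr Z (points Z) U (scalar Z c)) ` carrier k \<union> S)
              = carrier (sections Z U))))"

text \<open>
  Separatedness over an affine base, expressed on affine opens: the diagonal is a closed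
  immersion iff each \<open>U \<inter> V\<close> is affine and \<open>\<O>(U) \<otimes> \<O>(V) \<rightarrow> \<O>(U \<inter> V)\<close> is surjective.
\<close>

definition separated :: "('x, 's, 'z) ringed_space_scheme \<Rightarrow> bool" where
  "separated Z \<longleftrightarrow>
     (\<forall>U V. affine_open Z U \<longrightarrow> affine_open Z V \<longrightarrow>
        affine_open Z (U \<inter> V) \<and>
        generate_ring (sections Z (U \<inter> V))
          (restr Z U (U \<inter> V) ` carrier (sections Z U) \<union>
           restr Z V (U \<inter> V) ` carrier (sections Z V))
        = carrier (sections Z (U \<inter> V)))"

definition integral_curve :: "'k ring \<Rightarrow> ('k, 'x, 's) space_over \<Rightarrow> bool" where
  "integral_curve k Z \<longleftrightarrow>
     scheme_over k Z \<and> integral_scheme Z \<and> separated Z \<and> finite_type_over k Z \<and>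
     chain_dim (irreducible_closed_sets (space_top Z)) 1"

text \<open>
  Smooth over a field means locally of finite type with geometrically regular local rings
  (EGA IV, 6.8.1). An algebraically closed field has no nontrivial finite extension, so over
  such a field, the only case in which this is used, geometrically regular means regular.
\<close>

definition smooth_curve :: "'k ring \<Rightarrow> ('k, 'x, 's) space_over \<Rightarrow> bool" where
  "smooth_curve k Z \<longleftrightarrow>
     integral_curve k Z \<and> (\<forall>x\<in>points Z. regular_local_ring (stalk Z x))"


section \<open>Morphisms\<close>

text \<open>A morphism \<open>Y \<rightarrow> Z\<close> is given by a map \<open>f\<close> on points and maps
  \<open>F U : \<O>\<^sub>Z(U) \<rightarrow> \<O>\<^sub>Y(f\<inverse> U)\<close>.\<close>

definition preim ::
    "('y, 's, 'z) ringed_space_scheme \<Rightarrow> ('y \<Rightarrow> 'x) \<Rightarrow> 'x set \<Rightarrow> 'y set" where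
  "preim Y f U = {y \<in> points Y. f y \<in> U}"

definition scheme_morphism ::
    "('y, 's, 'z) ringed_space_scheme \<Rightarrow> ('x, 'r, 'w) ringed_space_scheme \<Rightarrow>
     ('y \<Rightarrow> 'x) \<Rightarrow> ('x set \<Rightarrow> 'r \<Rightarrow> 's) \<Rightarrow> bool" where
  "scheme_morphism Y Z f F \<longleftrightarrow>
     continuous_map (space_top Y) (space_top Z) f \<and>
     (\<forall>U. open_in Z U \<longrightarrow> F U \<in> ring_hom (sections Z U) (sections Y (preim Y f U))) \<and>
     (\<forall>U V. open_in Z U \<longrightarrow> open_in Z V \<longrightarrow> V \<subseteq> U \<longrightarrow>
        (\<forall>a\<in>carrier (sections Z U).
           F V (restr Z U V a) = restr Y (preim Y f U) (preim Y f V) (F U a))) \<and>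
     (\<forall>U. open_in Z U \<longrightarrow> (\<forall>a\<in>carrier (sections Z U). \<forall>y\<in>preim Y f U.
        a \<in> vanishing_prime Z U (f y) \<longrightarrow> F U a \<in> vanishing_prime Y (preim Y f U) y))"

definition morphism_over ::
    "'k ring \<Rightarrow> ('k, 'y, 's) space_over \<Rightarrow> ('k, 'x, 'r) space_over \<Rightarrow>
     ('y \<Rightarrow> 'x) \<Rightarrow> ('x set \<Rightarrow> 'r \<Rightarrow> 's) \<Rightarrow> bool" where
  "morphism_over k Y Z f F \<longleftrightarrow>
     scheme_morphism Y Z f F \<and> (\<forall>c\<in>carrier k. F (points Z) (scalar Z c) = scalar Y c)"

definition finite_morphism ::
    "('y, 's, 'z) ringed_space_scheme \<Rightarrow> ('x, 'r, 'w) ringed_space_scheme \<Rightarrow>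
     ('y \<Rightarrow> 'x) \<Rightarrow> ('x set \<Rightarrow> 'r \<Rightarrow> 's) \<Rightarrow> bool" where
  "finite_morphism Y Z f F \<longleftrightarrow>
     scheme_morphism Y Z f F \<and>
     (\<forall>x\<in>points Z. \<exists>U. x \<in> U \<and> affine_open Z U \<and> affine_open Y (preim Y f U) \<and>
        (\<exists>S. finite S \<and> S \<subseteq> carrier (sections Y (preim Y f U)) \<and>
           (\<forall>b\<in>carrier (sections Y (preim Y f U)). \<exists>g\<in>S \<rightarrow> carrier (sections Z U).
              b = (\<Oplus>\<^bsub>sections Y (preim Y f U)\<^esub>s\<in>S.
                     F U (g s) \<otimes>\<^bsub>sections Y (preim Y f U)\<^esub> s))))"

definition germ_pullback ::
    "('y, 's, 'z) ringed_space_scheme \<Rightarrow> 'y set set \<Rightarrow> ('y \<Rightarrow> 'x) \<Rightarrow>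
     ('x set \<Rightarrow> 'r \<Rightarrow> 's) \<Rightarrow> ('x, 'r) germ \<Rightarrow> ('y, 's) germ" where
  "germ_pullback Y \<N> f F A = (\<Union>(U, a)\<in>A. germ Y \<N> (preim Y f U) (F U a))"

definition dominant ::
    "('y, 's, 'z) ringed_space_scheme \<Rightarrow> ('x, 'r, 'w) ringed_space_scheme \<Rightarrow> ('y \<Rightarrow> 'x) \<Rightarrow> bool" where
  "dominant Y Z f \<longleftrightarrow> (\<forall>U\<in>nonempty_opens Z. preim Y f U \<noteq> {})"

definition base_function_field ::
    "('y, 's, 'z) ringed_space_scheme \<Rightarrow> ('x, 'r, 'w) ringed_space_scheme \<Rightarrow>
     ('y \<Rightarrow> 'x) \<Rightarrow> ('x set \<Rightarrow> 'r \<Rightarrow> 's) \<Rightarrow> ('y, 's) germ set" where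
  "base_function_field Y Z f F =
     germ_pullback Y (nonempty_opens Y) f F ` carrier (function_field Z)"

definition generically_galois ::
    "('y, 's, 'z) ringed_space_scheme \<Rightarrow> ('x, 'r, 'w) ringed_space_scheme \<Rightarrow>
     ('y \<Rightarrow> 'x) \<Rightarrow> ('x set \<Rightarrow> 'r \<Rightarrow> 's) \<Rightarrow> bool" where
  "generically_galois Y Z f F \<longleftrightarrow>
     dominant Y Z f \<and>
     finite_galois_extension (function_field Y) (base_function_field Y Z f F)"

definition cover_group ::
    "('y, 's, 'z) ringed_space_scheme \<Rightarrow> ('x, 'r, 'w) ringed_space_scheme \<Rightarrow>
     ('y \<Rightarrow> 'x) \<Rightarrow> ('x set \<Rightarrow> 'r \<Rightarrow> 's) \<Rightarrow> (('y, 's) germ \<Rightarrow> ('y, 's) germ) monoid" where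
  "cover_group Y Z f F = galois_group (function_field Y) (base_function_field Y Z f F)"

definition automorphism_over ::
    "('y, 's, 'z) ringed_space_scheme \<Rightarrow> ('x, 'r, 'w) ringed_space_scheme \<Rightarrow>
     ('y \<Rightarrow> 'x) \<Rightarrow> ('x set \<Rightarrow> 'r \<Rightarrow> 's) \<Rightarrow> ('y \<Rightarrow> 'y) \<Rightarrow> ('y set \<Rightarrow> 's \<Rightarrow> 's) \<Rightarrow> bool" where
  "automorphism_over Y Z f F h H \<longleftrightarrow>
     scheme_morphism Y Y h H \<and>
     homeomorphic_map (space_top Y) (space_top Y) h \<and>
     (\<forall>V. open_in Y V \<longrightarrow> H V \<in> ring_iso (sections Y V) (sections Y (preim Y h V))) \<and>
     (\<forall>y\<in>points Y. f (h y) = f y) \<and>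
     (\<forall>U. open_in Z U \<longrightarrow> (\<forall>a\<in>carrier (sections Z U). H (preim Y f U) (F U a) = F U a))"


section \<open>Ramification\<close>

definition is_ramification_index ::
    "('y, 's, 'z) ringed_space_scheme \<Rightarrow> ('x, 'r, 'w) ringed_space_scheme \<Rightarrow>
     ('y \<Rightarrow> 'x) \<Rightarrow> ('x set \<Rightarrow> 'r \<Rightarrow> 's) \<Rightarrow> 'y \<Rightarrow> nat \<Rightarrow> bool" where
  "is_ramification_index Y Z f F y e \<longleftrightarrow>
     genideal (stalk Y y) (germ_pullback Y (nbhds Y y) f F ` max_ideal (stalk Z (f y)))
     = ideal_power (stalk Y y) (max_ideal (stalk Y y)) e"

definition ramification_index ::
    "('y, 's, 'z) ringed_space_scheme \<Rightarrow> ('x, 'r, 'w) ringed_space_scheme \<Rightarrow>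
     ('y \<Rightarrow> 'x) \<Rightarrow> ('x set \<Rightarrow> 'r \<Rightarrow> 's) \<Rightarrow> 'y \<Rightarrow> nat" where
  "ramification_index Y Z f F y = (THE e. is_ramification_index Y Z f F y e)"

text \<open>
  \<open>\<sigma>\<close> in the Galois group acts (on the left) on \<open>Y\<close> by the automorphism \<open>h\<close> over \<open>Z\<close> that
  induces \<open>\<sigma>\<inverse>\<close> on the function field. The residue field of a closed point is \<open>k\<close>, so the
  inertia group is the stabiliser.
\<close>

definition inertia_group ::
    "('y, 's, 'z) ringed_space_scheme \<Rightarrow> ('x, 'r, 'w) ringed_space_scheme \<Rightarrow>
     ('y \<Rightarrow> 'x) \<Rightarrow> ('x set \<Rightarrow> 'r \<Rightarrow> 's) \<Rightarrow> 'y \<Rightarrow> (('y, 's) germ \<Rightarrow> ('y, 's) germ) set" where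
  "inertia_group Y Z f F y =
     {\<sigma> \<in> carrier (cover_group Y Z f F).
        \<exists>h H. automorphism_over Y Z f F h H \<and>
              (\<forall>A\<in>carrier (function_field Y).
                 germ_pullback Y (nonempty_opens Y) h H A
                 = (inv\<^bsub>cover_group Y Z f F\<^esub> \<sigma>) A) \<and>
              h y = y}"

text \<open>
  The class of \<open>\<sigma>(t) / t\<close> in the residue field \<open>k\<close> at \<open>y\<close>, for any uniformiser \<open>t\<close>.
\<close>

definition tame_character ::
    "'k ring \<Rightarrow> ('k, 'y, 's) space_over \<Rightarrow> 'y \<Rightarrow> (('y, 's) germ \<Rightarrow> ('y, 's) germ) \<Rightarrow> 'k" where
  "tame_character k Y y \<sigma> =
     (THE c. c \<in> carrier k \<and>
        (\<forall>t\<in>carrier (stalk Y y). cgenideal (stalk Y y) t = max_ideal (stalk Y y) \<longrightarrow>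
           (\<exists>v\<in>carrier (stalk Y y).
              \<sigma> (germ_incl Y t) = germ_incl Y v \<otimes>\<^bsub>function_field Y\<^esub> germ_incl Y t \<and>
              v \<ominus>\<^bsub>stalk Y y\<^esub> germ Y (nbhds Y y) (points Y) (scalar Y c)
                \<in> max_ideal (stalk Y y))))"

definition roots_of_unity :: "'k ring \<Rightarrow> nat \<Rightarrow> 'k monoid" where
  "roots_of_unity k e =
     \<lparr>carrier = {c \<in> carrier k. c [^]\<^bsub>k\<^esub> e = \<one>\<^bsub>k\<^esub>}, monoid.mult = monoid.mult k, one = one k\<rparr>"

definition wild_inertia_group ::
    "'k ring \<Rightarrow> ('k, 'y, 's) space_over \<Rightarrow> ('k, 'x, 'r) space_over \<Rightarrow>
     ('y \<Rightarrow> 'x) \<Rightarrow> ('x set \<Rightarrow> 'r \<Rightarrow> 's) \<Rightarrow> 'y \<Rightarrow> (('y, 's) germ \<Rightarrow> ('y, 's) germ) set" where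
  "wild_inertia_group k Y Z f F y =
     kernel ((cover_group Y Z f F)\<lparr>carrier := inertia_group Y Z f F y\<rparr>)
       (roots_of_unity k (ramification_index Y Z f F y)) (tame_character k Y y)"


section \<open>Group modules and crossed homomorphisms\<close>

text \<open>An \<open>R[G]\<close>-module is an \<open>R\<close>-module with an \<open>R\<close>-linear left action of \<open>G\<close>.\<close>

definition group_module ::
    "('l, 'n) ring_scheme \<Rightarrow> 'g monoid \<Rightarrow> ('l, 'm) module \<Rightarrow> ('g \<Rightarrow> 'm \<Rightarrow> 'm) \<Rightarrow> bool" where
  "group_module R G M act \<longleftrightarrow>
     module R M \<and> group G \<and>
     (\<forall>g\<in>carrier G. \<forall>m\<in>carrier M. act g m \<in> carrier M) \<and>
     (\<forall>g\<in>carrier G. \<forall>m\<in>carrier M. \<forall>m'\<in>carrier M.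
        act g (m \<oplus>\<^bsub>M\<^esub> m') = act g m \<oplus>\<^bsub>M\<^esub> act g m') \<and>
     (\<forall>g\<in>carrier G. \<forall>r\<in>carrier R. \<forall>m\<in>carrier M.
        act g (r \<odot>\<^bsub>M\<^esub> m) = r \<odot>\<^bsub>M\<^esub> act g m) \<and>
     (\<forall>m\<in>carrier M. act \<one>\<^bsub>G\<^esub> m = m) \<and>
     (\<forall>g\<in>carrier G. \<forall>h\<in>carrier G. \<forall>m\<in>carrier M.
        act (g \<otimes>\<^bsub>G\<^esub> h) m = act g (act h m))"

definition invariant_module ::
    "'g set \<Rightarrow> ('l, 'm) module \<Rightarrow> ('g \<Rightarrow> 'm \<Rightarrow> 'm) \<Rightarrow> ('l, 'm) module" where
  "invariant_module P M act = M\<lparr>carrier := {m \<in> carrier M. \<forall>g\<in>P. act g m = m}\<rparr>"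

text \<open>A coset acts on the invariants through any of its elements.\<close>

definition coset_action :: "('g \<Rightarrow> 'm \<Rightarrow> 'm) \<Rightarrow> 'g set \<Rightarrow> 'm \<Rightarrow> 'm" where
  "coset_action act A m = the_elem ((\<lambda>g. act g m) ` A)"

definition crossed_homs ::
    "'g monoid \<Rightarrow> ('l, 'm) module \<Rightarrow> ('g \<Rightarrow> 'm \<Rightarrow> 'm) \<Rightarrow> ('g \<Rightarrow> 'm) monoid" where
  "crossed_homs H N act =
     \<lparr>carrier = {c \<in> carrier H \<rightarrow>\<^sub>E carrier N.
                  \<forall>g\<in>carrier H. \<forall>h\<in>carrier H. c (g \<otimes>\<^bsub>H\<^esub> h) = c g \<oplus>\<^bsub>N\<^esub> act g (c h)},
      monoid.mult = (\<lambda>c d. \<lambda>g\<in>carrier H. c g \<oplus>\<^bsub>N\<^esub> d g),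
      one = (\<lambda>g\<in>carrier H. \<zero>\<^bsub>N\<^esub>)\<rparr>"

definition inflation :: "'g monoid \<Rightarrow> 'g set \<Rightarrow> ('g set \<Rightarrow> 'm) \<Rightarrow> ('g \<Rightarrow> 'm)" where
  "inflation H P c = (\<lambda>g\<in>carrier H. c (P #>\<^bsub>H\<^esub> g))"

end

(* Averaging a crossed homomorphism c over P gives m0 in M, and g |-> c g + g m0 - m0 is a cohomologous
   crossed homomorphism that vanishes on P, hence descends to I/P with values in M^P; nothing changes
   if c was already inflated. This is linear in c and only requires that P is normal in I, finite, and
   of order prime to n.

   Normality and order are read off the action on the local ring at y, which is a discrete valuation
   ring with residue field k (weak Nullstellensatz). The wild elements are those that act trivially on
   all quotients m^i / m^(i+1); if such an element s satisfies s^l = 1 with l invertible in k, then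
   expanding s^l a - a modulo m^(i+1) shows inductively that s a - a lies in every m^i, hence s = 1. *)

theory Submission
  imports Defs "HOL-Number_Theory.Cong"
begin

section \<open>Averaging crossed homomorphisms\<close>

text \<open>\<open>wild_inertia_group\<close> is the kernel, as a bare set, of a map given by a
  definite description, so neither its subgroup structure nor its order comes for free. The
  filtration criterion \<open>wild_iff\<close> gives both: it is visibly stable under products and
  conjugation, and by Cauchy's theorem a prime dividing both \<open>card P\<close> and
  \<open>n\<close> would yield a nontrivial wild element killed by an integer that is invertible in
  \<open>k\<close>. That the residue field at \<open>y\<close> is \<open>k\<close> enters twice.
  Elements of the stabiliser act trivially on residues, because they fix the constants; and the
  class of \<sigma>(t)/t is an element of \<open>k\<close>, which is the value of the tame
  character. The curves are given by sheaves, while the Galois group acts only on the function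
  field. The stalk is therefore embedded there by \<open>germ_incl\<close>, and the group-theoretic
  argument runs inside the function field. Dimension one and regularity supply the uniformiser;
  noetherianity supplies the Krull intersection. Inverses in the inertia group come from its
  finiteness rather than from inverting automorphisms of \<open>Y\<close>.\<close>

locale crossed_hom_averaging = normal P I + M?: abelian_group M
  for P and I :: "'a monoid" (structure) and M :: "('l, 'm) module" +
  fixes act :: "'a \<Rightarrow> 'm \<Rightarrow> 'm" and n :: nat
  assumes finite_P: "finite P" and coprime_card: "coprime (card P) n"
    and annihilated: "m \<in> carrier M \<Longrightarrow> add_pow M n m = \<zero>\<^bsub>M\<^esub>"
    and act_closed: "g \<in> carrier I \<Longrightarrow> m \<in> carrier M \<Longrightarrow> act g m \<in> carrier M"
    and act_add: "g \<in> carrier I \<Longrightarrow> m \<in> carrier M \<Longrightarrow> m' \<in> carrier M \<Longrightarrow>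
                    act g (m \<oplus>\<^bsub>M\<^esub> m') = act g m \<oplus>\<^bsub>M\<^esub> act g m'"
    and act_one: "m \<in> carrier M \<Longrightarrow> act \<one> m = m"
    and act_mult: "g \<in> carrier I \<Longrightarrow> h \<in> carrier I \<Longrightarrow> m \<in> carrier M \<Longrightarrow>
                    act (g \<otimes> h) m = act g (act h m)"
begin

lemma P_carrier [intro]: "h \<in> P \<Longrightarrow> h \<in> carrier I"
  using subset by blast

abbreviation invariants :: "('l, 'm) module" where
  "invariants \<equiv> invariant_module P M act"

lemma invariants_carrier: "carrier invariants = {m \<in> carrier M. \<forall>g\<in>P. act g m = m}"
  and invariants_add: "ring.add invariants = ring.add M"
  by (simp_all add: invariant_module_def)

lemma crossed_homs_carrier:
  "c \<in> carrier (crossed_homs I M act) \<longleftrightarrow>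
     c \<in> carrier I \<rightarrow>\<^sub>E carrier M \<and>
     (\<forall>g\<in>carrier I. \<forall>h\<in>carrier I. c (g \<otimes> h) = c g \<oplus>\<^bsub>M\<^esub> act g (c h))"
  by (simp add: crossed_homs_def)

lemma act_zero: "g \<in> carrier I \<Longrightarrow> act g \<zero>\<^bsub>M\<^esub> = \<zero>\<^bsub>M\<^esub>"
  by (metis M.l_zero M.zero_closed M.add.r_cancel_one' act_add act_closed)

lemma act_uminus:
  assumes "g \<in> carrier I" "m \<in> carrier M" shows "act g (\<ominus>\<^bsub>M\<^esub> m) = \<ominus>\<^bsub>M\<^esub> act g m"
  by (metis M.a_inv_closed M.l_neg M.minus_equality act_add act_closed act_zero assms)

lemma act_minus:
  assumes "g \<in> carrier I" "m \<in> carrier M" "m' \<in> carrier M"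
  shows "act g (m \<ominus>\<^bsub>M\<^esub> m') = act g m \<ominus>\<^bsub>M\<^esub> act g m'"
  using assms by (simp add: a_minus_def act_add act_uminus)

lemma act_add_pow:
  assumes "g \<in> carrier I" "m \<in> carrier M"
  shows "act g (add_pow M (j::nat) m) = add_pow M j (act g m)"
  by (induction j) (simp_all add: assms act_zero act_add act_closed)

lemma act_finsum:
  assumes "g \<in> carrier I" "c \<in> A \<rightarrow> carrier M"
  shows "act g (finsum M c A) = finsum M (\<lambda>h. act g (c h)) A"
  using assms(2)
proof (induction A rule: infinite_finite_induct)
  case (insert a A)
  then show ?case
    by (subst M.finsum_insert; (subst M.finsum_insert)?)
      (auto simp: assms(1) act_add act_closed Pi_def)
qed (auto simp: assms(1) act_zero)

text \<open>Division by the order of P: since M is killed by \<open>n\<close>, a number inverse to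
  \<open>card P\<close> modulo \<open>n\<close> inverts multiplication by \<open>card P\<close> on
  M. A natural number serves here because the locale only knows M as an abelian group.\<close>

definition card_inverse :: nat where
  "card_inverse = (SOME u. [card P * u = 1] (mod n))"

lemma card_inverse: "[card P * card_inverse = 1] (mod n)"
  unfolding card_inverse_def
  by (rule someI_ex) (use cong_solve_coprime_nat[OF coprime_card] in auto)

text \<open>As \<open>n\<close> kills \<open>m\<close>, the summand \<open>n * (i div n)\<close> of
  \<open>i\<close> contributes nothing.\<close>

lemma add_pow_cong:
  assumes "[i = j] (mod n)" "m \<in> carrier M" shows "add_pow M i m = add_pow M j m"
proof -
  have *: "add_pow M i m = add_pow M (i mod n) m" for i
  proof -
    have "add_pow M i m = add_pow M (n * (i div n) + i mod n) m" by simp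
    also have "\<dots> = add_pow M (n * (i div n)) m \<oplus>\<^bsub>M\<^esub> add_pow M (i mod n) m"
      using assms(2) by (metis M.add.nat_pow_mult)
    also have "add_pow M (n * (i div n)) m = add_pow M (i div n) (add_pow M n m)"
      using assms(2) by (metis M.add.nat_pow_pow)
    also have "\<dots> = \<zero>\<^bsub>M\<^esub>" using annihilated[OF assms(2)] by simp
    finally show ?thesis using assms(2) by simp
  qed
  show ?thesis using assms(1) *[of i] *[of j] by (simp add: cong_def)
qed

definition mean :: "('a \<Rightarrow> 'm) \<Rightarrow> 'm" where
  "mean c = add_pow M card_inverse (finsum M c P)"

lemma mean_closed: "c \<in> P \<rightarrow> carrier M \<Longrightarrow> mean c \<in> carrier M"
  by (simp add: mean_def)

lemma mean_add:
  assumes "c \<in> P \<rightarrow> carrier M" "d \<in> P \<rightarrow> carrier M"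
  shows "mean (\<lambda>h. c h \<oplus>\<^bsub>M\<^esub> d h) = mean c \<oplus>\<^bsub>M\<^esub> mean d"
  using assms by (simp add: mean_def M.finsum_addf M.add.nat_pow_distrib)

lemma mean_const:
  assumes "m \<in> carrier M" shows "mean (\<lambda>h. m) = m"
proof -
  have "mean (\<lambda>h. m) = add_pow M card_inverse (add_pow M (card P) m)"
    using assms by (simp add: mean_def M.add.finprod_const)
  also have "\<dots> = add_pow M (card P * card_inverse) m"
    using assms M.add.nat_pow_pow by blast
  also have "\<dots> = add_pow M (1::nat) m" by (rule add_pow_cong[OF card_inverse assms])
  finally show ?thesis using assms by simp
qed

lemma mean_cong: "(\<And>h. h \<in> P \<Longrightarrow> c h = d h) \<Longrightarrow> d \<in> P \<rightarrow> carrier M \<Longrightarrow> mean c = mean d"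
  by (simp add: mean_def cong: M.finsum_cong')

lemma mean_act:
  "g \<in> carrier I \<Longrightarrow> c \<in> P \<rightarrow> carrier M \<Longrightarrow> act g (mean c) = mean (\<lambda>h. act g (c h))"
  by (simp add: mean_def act_finsum act_add_pow)

lemma mean_translate:
  assumes "h \<in> P" "c \<in> P \<rightarrow> carrier M" shows "mean (\<lambda>h'. c (h \<otimes> h')) = mean c"
proof -
  have bij: "bij_betw (\<lambda>h'. h \<otimes> h') P P"
    by (rule bij_betw_byWitness[where f' = "\<lambda>h'. inv h \<otimes> h'"])
      (use assms P_carrier in \<open>auto simp: m_assoc[symmetric]\<close>)
  then have "finsum M (\<lambda>h'. c (h \<otimes> h')) P = finsum M c P"
    using M.finsum_reindex[of c "\<lambda>h'. h \<otimes> h'" P] assms(2)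
    by (simp add: bij_betw_def)
  then show ?thesis by (simp add: mean_def)
qed

context
  fixes c assumes c: "c \<in> carrier (crossed_homs I M act)"
begin

lemma cocycle_closed: "g \<in> carrier I \<Longrightarrow> c g \<in> carrier M"
  and cocycle: "g \<in> carrier I \<Longrightarrow> h \<in> carrier I \<Longrightarrow> c (g \<otimes> h) = c g \<oplus>\<^bsub>M\<^esub> act g (c h)"
  using c by (auto simp: crossed_homs_carrier)

lemma cocycle_P: "c \<in> P \<rightarrow> carrier M"
  using cocycle_closed by auto

text \<open>Average \<open>c (h \<otimes> h') = c h + act h (c h')\<close> over \<open>h'\<close> in
  P: translation by \<open>h\<close> permutes P, and the mean of a constant is that constant. So on
  P the cocycle is a coboundary, \<open>c h = mean c - act h (mean c)\<close>.\<close>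

lemma mean_cocycle:
  assumes "h \<in> P" shows "c h \<oplus>\<^bsub>M\<^esub> act h (mean c) = mean c"
proof -
  have hI: "h \<in> carrier I" using assms by auto
  have "mean c = mean (\<lambda>h'. c (h \<otimes> h'))" using mean_translate[OF assms cocycle_P] by simp
  also have "\<dots> = mean (\<lambda>h'. c h \<oplus>\<^bsub>M\<^esub> act h (c h'))"
    by (rule mean_cong) (use hI in \<open>auto simp: cocycle intro!: act_closed cocycle_closed\<close>)
  also have "\<dots> = mean (\<lambda>h'. c h) \<oplus>\<^bsub>M\<^esub> mean (\<lambda>h'. act h (c h'))"
    by (rule mean_add) (use hI in \<open>auto intro!: act_closed cocycle_closed\<close>)
  also have "\<dots> = c h \<oplus>\<^bsub>M\<^esub> act h (mean c)"
    using hI by (simp add: mean_const cocycle_closed mean_act cocycle_P)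
  finally show ?thesis by simp
qed

end

text \<open>Adding to a cocycle the coboundary of its mean over \<open>P\<close> makes it vanish on \<open>P\<close>, so that it
  descends to \<open>I/P\<close>; a cocycle inflated from \<open>I/P\<close> has mean zero and is not changed.\<close>

definition normalise :: "('a \<Rightarrow> 'm) \<Rightarrow> 'a \<Rightarrow> 'm" where
  "normalise c g = c g \<oplus>\<^bsub>M\<^esub> (act g (mean c) \<ominus>\<^bsub>M\<^esub> mean c)"

context
  fixes c assumes c: "c \<in> carrier (crossed_homs I M act)"
begin

lemma mean_c_closed: "mean c \<in> carrier M"
  by (intro mean_closed cocycle_P c)

lemma normalise_closed: "g \<in> carrier I \<Longrightarrow> normalise c g \<in> carrier M"
  by (simp add: normalise_def cocycle_closed[OF c] act_closed mean_c_closed)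

lemma normalise_cocycle:
  assumes "g \<in> carrier I" "h \<in> carrier I"
  shows "normalise c (g \<otimes> h) = normalise c g \<oplus>\<^bsub>M\<^esub> act g (normalise c h)"
proof -
  note [simp] = cocycle_closed[OF c] act_closed mean_c_closed assms
  show ?thesis
    by (simp add: normalise_def cocycle[OF c] act_mult act_add act_minus)
      (simp add: a_minus_def M.a_ac M.r_neg1 M.r_neg2)
qed

lemma normalise_P:
  assumes "h \<in> P" shows "normalise c h = \<zero>\<^bsub>M\<^esub>"
proof -
  have hI: "h \<in> carrier I" using assms by auto
  note [simp] = cocycle_closed[OF c] act_closed mean_c_closed hI
  have "normalise c h = (c h \<oplus>\<^bsub>M\<^esub> act h (mean c)) \<ominus>\<^bsub>M\<^esub> mean c"
    by (simp add: normalise_def a_minus_def M.a_assoc)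
  also have "\<dots> = \<zero>\<^bsub>M\<^esub>"
    by (simp add: mean_cocycle[OF c assms] a_minus_def M.r_neg)
  finally show ?thesis .
qed

lemma normalise_mult_P:
  assumes "h \<in> P" "g \<in> carrier I" shows "normalise c (h \<otimes> g) = act h (normalise c g)"
    and "normalise c (g \<otimes> h) = normalise c g"
  using assms by (auto simp: normalise_cocycle normalise_P normalise_closed act_closed act_zero)

text \<open>By normality \<open>h \<otimes> g\<close> can also be written with a factor of P on the
  right of \<open>g\<close>. A left factor in P acts on the value and a right factor is absorbed;
  comparing the two gives invariance.\<close>

lemma normalise_invariant:
  assumes "g \<in> carrier I" "h \<in> P" shows "act h (normalise c g) = normalise c g"
proof -
  have *: "inv g \<otimes> h \<otimes> g \<in> P" using assms by (simp add: inv_op_closed1)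
  have "h \<otimes> g = g \<otimes> (inv g \<otimes> h \<otimes> g)"
    using assms P_carrier by (simp add: m_assoc[symmetric])
  then show ?thesis
    using normalise_mult_P[OF assms(2,1)] normalise_mult_P(2)[OF * assms(1)] by simp
qed

lemma normalise_coset:
  assumes "g \<in> carrier I" shows "normalise c ` (P #> g) = {normalise c g}"
proof -
  have "normalise c h = normalise c g" if "h \<in> P #> g" for h
    using that assms by (auto simp: r_coset_def normalise_mult_P normalise_invariant)
  moreover have "g \<in> P #> g" using assms subset one_closed by (auto simp: r_coset_def intro!: bexI[of _ \<one>])
  ultimately show ?thesis by blast
qed

end

text \<open>For a crossed homomorphism \<open>c\<close> the image of a coset is a singleton
  (\<open>normalise_coset\<close>), whose member \<open>the_elem\<close> returns. Off the quotient
  group the value is \<open>undefined\<close>, as the extensional carrier of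
  \<open>crossed_homs\<close> requires.\<close>

definition deflation :: "('a \<Rightarrow> 'm) \<Rightarrow> 'a set \<Rightarrow> 'm" where
  "deflation c = (\<lambda>A\<in>carrier (I Mod P). the_elem (normalise c ` A))"

lemma deflation_coset:
  "c \<in> carrier (crossed_homs I M act) \<Longrightarrow> g \<in> carrier I \<Longrightarrow> deflation c (P #> g) = normalise c g"
  by (auto simp: deflation_def normalise_coset FactGroup_def RCOSETS_def)

text \<open>Normality of P: \<open>h \<otimes> g\<close> equals \<open>g\<close> times an element of
  P, and the latter fixes \<open>m\<close>.\<close>

lemma act_coset_closed:
  assumes "g \<in> carrier I" "m \<in> carrier invariants"
  shows "act g m \<in> carrier invariants"
proof -
  have m: "m \<in> carrier M" using assms(2) by (simp add: invariants_carrier)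
  have "act h (act g m) = act g m" if "h \<in> P" for h
  proof -
    have *: "inv g \<otimes> h \<otimes> g \<in> P" using assms that by (simp add: inv_op_closed1)
    have "act h (act g m) = act (h \<otimes> g) m" using assms that m by (simp add: act_mult P_carrier)
    also have "h \<otimes> g = g \<otimes> (inv g \<otimes> h \<otimes> g)"
      using assms that P_carrier by (simp add: m_assoc[symmetric])
    also have "act \<dots> m = act g m" using assms * m by (simp add: act_mult P_carrier invariants_carrier)
    finally show ?thesis .
  qed
  then show ?thesis using assms m by (simp add: invariants_carrier act_closed)
qed

text \<open>Elements of \<open>P #> g\<close> differ from \<open>g\<close> by a left factor in P,
  which fixes the invariant \<open>act g m\<close>; hence the image in the definition is a
  singleton.\<close>

lemma coset_action:
  assumes "g \<in> carrier I" "m \<in> carrier invariants"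
  shows "coset_action act (P #> g) m = act g m"
proof -
  have m: "m \<in> carrier M" using assms(2) by (simp add: invariants_carrier)
  have "act h m = act g m" if "h \<in> P #> g" for h
    using that assms m act_coset_closed[OF assms]
    by (auto simp: r_coset_def act_mult P_carrier invariants_carrier)
  moreover have "g \<in> P #> g" using assms subset one_closed by (auto simp: r_coset_def intro!: bexI[of _ \<one>])
  ultimately have "(\<lambda>g. act g m) ` (P #> g) = {act g m}" by blast
  then show ?thesis by (simp add: coset_action_def)
qed

section \<open>Inflation, deflation and their composite\<close>

abbreviation quotient_crossed_homs :: "('a set \<Rightarrow> 'm) monoid" where
  "quotient_crossed_homs \<equiv> crossed_homs (I Mod P) invariants (coset_action act)"

lemma Mod_carrier: "carrier (I Mod P) = (\<lambda>g. P #> g) ` carrier I"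
  by (auto simp: FactGroup_def RCOSETS_def)

text \<open>Membership rewritten through representatives, so that the later proofs meet neither
  products of cosets nor \<open>coset_action\<close>.\<close>

lemma quotient_crossed_homs_carrier:
  "c \<in> carrier quotient_crossed_homs \<longleftrightarrow>
     c \<in> extensional (carrier (I Mod P)) \<and>
     (\<forall>g\<in>carrier I. c (P #> g) \<in> carrier invariants) \<and>
     (\<forall>g\<in>carrier I. \<forall>h\<in>carrier I.
        c (P #> (g \<otimes> h)) = c (P #> g) \<oplus>\<^bsub>M\<^esub> act g (c (P #> h)))"
  by (auto simp: crossed_homs_def PiE_def Mod_carrier rcos_sum invariants_add coset_action Pi_def)

lemma invariantsD: "m \<in> carrier invariants \<Longrightarrow> m \<in> carrier M"
  by (simp add: invariants_carrier)

lemma inflation_closed: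
  "c \<in> carrier quotient_crossed_homs \<Longrightarrow> inflation I P c \<in> carrier (crossed_homs I M act)"
  by (auto simp: quotient_crossed_homs_carrier crossed_homs_carrier inflation_def invariantsD)

lemma inflation_hom: "inflation I P \<in> hom quotient_crossed_homs (crossed_homs I M act)"
proof (rule homI)
  fix c d assume "c \<in> carrier quotient_crossed_homs" "d \<in> carrier quotient_crossed_homs"
  then show "inflation I P (c \<otimes>\<^bsub>quotient_crossed_homs\<^esub> d) =
      inflation I P c \<otimes>\<^bsub>crossed_homs I M act\<^esub> inflation I P d"
    by (auto simp: inflation_def crossed_homs_def Mod_carrier invariants_add fun_eq_iff)
qed (rule inflation_closed)

lemma deflation_closed:
  assumes c: "c \<in> carrier (crossed_homs I M act)"
  shows "deflation c \<in> carrier quotient_crossed_homs"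
  unfolding quotient_crossed_homs_carrier
  using c by (auto simp: deflation_coset normalise_cocycle invariants_carrier normalise_closed normalise_invariant)
    (simp add: deflation_def)

lemma normalise_add:
  assumes c: "c \<in> carrier (crossed_homs I M act)" and d: "d \<in> carrier (crossed_homs I M act)"
    and g: "g \<in> carrier I"
  shows "normalise (c \<otimes>\<^bsub>crossed_homs I M act\<^esub> d) g = normalise c g \<oplus>\<^bsub>M\<^esub> normalise d g"
proof -
  have mult: "(c \<otimes>\<^bsub>crossed_homs I M act\<^esub> d) h = c h \<oplus>\<^bsub>M\<^esub> d h" if "h \<in> carrier I" for h
    using that by (simp add: crossed_homs_def)
  have "mean (c \<otimes>\<^bsub>crossed_homs I M act\<^esub> d) = mean (\<lambda>h. c h \<oplus>\<^bsub>M\<^esub> d h)"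
    by (rule mean_cong) (auto simp: mult P_carrier cocycle_closed[OF c] cocycle_closed[OF d])
  also have "\<dots> = mean c \<oplus>\<^bsub>M\<^esub> mean d"
    by (rule mean_add) (auto simp: P_carrier cocycle_closed[OF c] cocycle_closed[OF d])
  finally have *: "mean (c \<otimes>\<^bsub>crossed_homs I M act\<^esub> d) = mean c \<oplus>\<^bsub>M\<^esub> mean d" .
  note [simp] = mean_c_closed[OF c] mean_c_closed[OF d] cocycle_closed[OF c g] cocycle_closed[OF d g]
    act_closed[OF g]
  show ?thesis
    by (simp add: normalise_def mult[OF g] * act_add[OF g] a_minus_def M.minus_add M.a_ac)
qed

lemma deflation_hom: "deflation \<in> hom (crossed_homs I M act) quotient_crossed_homs"
proof (rule homI)
  fix c d assume c: "c \<in> carrier (crossed_homs I M act)" and d: "d \<in> carrier (crossed_homs I M act)"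
  have "c \<otimes>\<^bsub>crossed_homs I M act\<^esub> d \<in> carrier (crossed_homs I M act)"
    using cocycle_closed[OF c] cocycle_closed[OF d] cocycle[OF c] cocycle[OF d]
    unfolding crossed_homs_carrier
    by (auto simp: crossed_homs_def act_closed act_add M.a_ac)
  then have "deflation (c \<otimes>\<^bsub>crossed_homs I M act\<^esub> d) A =
     (deflation c \<otimes>\<^bsub>quotient_crossed_homs\<^esub> deflation d) A" if "A \<in> carrier (I Mod P)" for A
    using that c d
    by (auto simp: Mod_carrier deflation_coset normalise_add)
      (auto simp: crossed_homs_def Mod_carrier invariants_add deflation_coset c d)
  then show "deflation (c \<otimes>\<^bsub>crossed_homs I M act\<^esub> d) =
     deflation c \<otimes>\<^bsub>quotient_crossed_homs\<^esub> deflation d"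
    by (intro extensionalityI[of _ "carrier (I Mod P)"])
      (auto simp: deflation_def, auto simp: crossed_homs_def)
qed (rule deflation_closed)

lemma deflation_inflation:
  assumes c: "c \<in> carrier quotient_crossed_homs"
  shows "deflation (inflation I P c) = c"
proof (rule extensionalityI[of _ "carrier (I Mod P)"])
  show "deflation (inflation I P c) \<in> extensional (carrier (I Mod P))"
    by (simp add: deflation_def)
  show "c \<in> extensional (carrier (I Mod P))" using c by (simp add: quotient_crossed_homs_carrier)
  fix A assume "A \<in> carrier (I Mod P)"
  then obtain g where g: "g \<in> carrier I" "A = P #> g" by (auto simp: Mod_carrier)
  have closed: "c (P #> g) \<in> carrier M" if "g \<in> carrier I" for g
    using c that by (simp add: quotient_crossed_homs_carrier invariantsD)
  \<comment> \<open>The cocycle identity at the unit forces the value zero there. Hence the inflated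
    cocycle vanishes on P, has mean zero, and is left unchanged by \<open>normalise\<close>.\<close>
  have "c (P #> \<one>) = c (P #> \<one>) \<oplus>\<^bsub>M\<^esub> act \<one> (c (P #> \<one>))"
    using c by (metis quotient_crossed_homs_carrier one_closed r_one)
  then have one: "c (P #> \<one>) = \<zero>\<^bsub>M\<^esub>"
    using closed[OF one_closed] by (simp add: act_one)
  have "inflation I P c h = \<zero>\<^bsub>M\<^esub>" if "h \<in> P" for h
    using that one P_carrier coset_join2[OF _ subgroup_axioms that] coset_join2[OF one_closed subgroup_axioms]
    by (simp add: inflation_def)
  then have "mean (inflation I P c) = mean (\<lambda>h. \<zero>\<^bsub>M\<^esub>)"
    by (intro mean_cong) auto
  then have "mean (inflation I P c) = \<zero>\<^bsub>M\<^esub>" by (simp add: mean_const)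
  then show "deflation (inflation I P c) A = c A"
    using g closed[OF g(1)]
    by (simp add: deflation_coset inflation_closed[OF c] normalise_def act_zero a_minus_def)
      (simp add: inflation_def)
qed

end


section \<open>Extension of homomorphisms into an algebraically closed field, one generator at a
  time\<close>

section \<open>The weak Nullstellensatz\<close>

text \<open>Bridge between list polynomials, which store the leading coefficient first (hence
  \<open>rev\<close>), and the sums over coefficients that the universal polynomial ring uses for
  evaluation.\<close>

lemma (in ring) eval_as_finsum:
  assumes "c \<in> {..d} \<rightarrow> carrier R" "x \<in> carrier R"
  shows "eval (map c (rev [0..<Suc d])) x = (\<Oplus>i\<in>{..d}. c i \<otimes> x [^] i)"
  using assms(1)
proof (induction d)
  case (Suc d)
  have "finsum R (\<lambda>i. c i \<otimes> x [^] i) {..Suc d} =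
      c (Suc d) \<otimes> x [^] Suc d \<oplus> finsum R (\<lambda>i. c i \<otimes> x [^] i) {..d}"
    by (rule finsum_Suc) (use Suc.prems assms(2) in \<open>auto simp: Pi_def\<close>)
  then show ?case using Suc by (simp add: Pi_def)
qed (use assms in auto)

text \<open>Subtract \<open>v\<close> from the constant coefficient. As \<open>d > 0\<close>, the
  leading coefficient is untouched, so the new polynomial has \<open>d\<close> roots counted with
  multiplicity, in particular one.\<close>

lemma (in algebraically_closed) polynomial_attains_value:
  fixes d :: nat
  assumes c: "c \<in> {..d} \<rightarrow> carrier L" and d: "d > 0" "c d \<noteq> \<zero>" and v: "v \<in> carrier L"
  shows "\<exists>x\<in>carrier L. (\<Oplus>i\<in>{..d}. c i \<otimes> x [^] i) = v"
proof -
  define c' where "c' = c(0 := c 0 \<ominus> v)"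
  define p where "p = map c' (rev [0..<Suc d])"
  have c': "c' \<in> {..d} \<rightarrow> carrier L" using c v by (auto simp: c'_def Pi_def a_minus_def)
  have "polynomial\<^bsub>L\<^esub> (carrier L) p"
    using c' d by (auto simp: polynomial_def p_def) (auto simp: c'_def)
  then have p: "p \<in> carrier (poly_ring L)" by (simp add: univ_poly_carrier)
  have "size (roots p) = d"
    using roots_over_carrier[OF p] by (simp add: splitted_def p_def)
  then obtain x where "x \<in># roots p" using d(1) by fastforce
  then have x: "x \<in> carrier L" "eval p x = \<zero>"
    using roots_mem_iff_is_root[OF p] by (auto simp: is_root_def)
  obtain e where e: "d = Suc e" using d(1) by (cases d) auto
  have "\<zero> = (\<Oplus>i\<in>{..Suc e}. c' i \<otimes> x [^] i)"
    using eval_as_finsum[OF c' x(1)] x(2) by (simp add: p_def e)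
  also have "\<dots> = (\<Oplus>i\<in>{..e}. c' (Suc i) \<otimes> x [^] Suc i) \<oplus> c' 0 \<otimes> x [^] (0::nat)"
    using c' x e by (intro finsum_Suc2) (auto simp: Pi_def)
  also have "\<dots> = ((\<Oplus>i\<in>{..e}. c (Suc i) \<otimes> x [^] Suc i) \<oplus> c 0) \<ominus> v"
    using c v x e by (simp add: c'_def a_minus_def Pi_def a_assoc)
  also have "(\<Oplus>i\<in>{..e}. c (Suc i) \<otimes> x [^] Suc i) \<oplus> c 0 =
      (\<Oplus>i\<in>{..e}. c (Suc i) \<otimes> x [^] Suc i) \<oplus> c 0 \<otimes> x [^] (0::nat)"
    using c by (simp add: Pi_def)
  also have "\<dots> = (\<Oplus>i\<in>{..d}. c i \<otimes> x [^] i)"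
    unfolding e using c x e by (intro finsum_Suc2[symmetric]) (auto simp: Pi_def)
  finally have "(\<Oplus>i\<in>{..d}. c i \<otimes> x [^] i) \<ominus> v = \<zero>" by simp
  moreover have "(\<Oplus>i\<in>{..d}. c i \<otimes> x [^] i) \<in> carrier L"
    using c x by (auto intro!: finsum_closed)
  ultimately show ?thesis using v x by (auto simp: r_right_minus_eq)
qed

lemma (in domain) nonzero_power:
  "a \<in> carrier R \<Longrightarrow> a \<noteq> \<zero> \<Longrightarrow> a [^] (n::nat) \<noteq> \<zero>"
  by (induction n) (auto simp: integral_iff)

text \<open>Used to define homomorphisms on a ring with one more generator by giving them on the
  polynomial ring. Any choice of preimages works, since two of them differ by an element of the
  kernel of \<open>h\<close>.\<close>

lemma (in ring_hom_ring) hom_factors_through_image: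
  assumes T: "ring T" "\<phi> \<in> ring_hom R T"
    and ker: "\<And>p. p \<in> carrier R \<Longrightarrow> h p = \<zero>\<^bsub>S\<^esub> \<Longrightarrow> \<phi> p = \<zero>\<^bsub>T\<^esub>"
  shows "\<exists>\<psi>\<in>ring_hom (S\<lparr>carrier := h ` carrier R\<rparr>) T. \<forall>p\<in>carrier R. \<psi> (h p) = \<phi> p"
proof -
  interpret T: ring T by fact
  interpret phi: ring_hom_ring R T \<phi>
    using T by (intro ring_hom_ringI2) (auto intro: R.ring_axioms)
  define \<psi> where "\<psi> s = \<phi> (SOME p. p \<in> carrier R \<and> h p = s)" for s
  have eq: "\<psi> (h p) = \<phi> p" if p: "p \<in> carrier R" for p
  proof -
    define q where "q = (SOME q. q \<in> carrier R \<and> h q = h p)"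
    have q: "q \<in> carrier R \<and> h q = h p"
      unfolding q_def by (rule someI_ex) (use p in auto)
    then have "h (q \<ominus> p) = \<zero>\<^bsub>S\<^esub>" using p by (simp add: a_minus_def S.r_neg)
    then have "\<phi> (q \<ominus> p) = \<zero>\<^bsub>T\<^esub>" using p q by (intro ker) auto
    then have "\<phi> q \<ominus>\<^bsub>T\<^esub> \<phi> p = \<zero>\<^bsub>T\<^esub>" using p q by (simp add: a_minus_def)
    then show ?thesis using p q T.r_right_minus_eq by (simp add: \<psi>_def q_def)
  qed
  have "\<psi> \<in> ring_hom (S\<lparr>carrier := h ` carrier R\<rparr>) T"
  proof (rule ring_hom_memI)
    fix x y assume "x \<in> carrier (S\<lparr>carrier := h ` carrier R\<rparr>)" "y \<in> carrier (S\<lparr>carrier := h ` carrier R\<rparr>)"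
    then obtain p q where pq: "p \<in> carrier R" "q \<in> carrier R" "x = h p" "y = h q" by auto
    show "\<psi> (x \<otimes>\<^bsub>S\<lparr>carrier := h ` carrier R\<rparr>\<^esub> y) = \<psi> x \<otimes>\<^bsub>T\<^esub> \<psi> y"
      using pq eq[of "p \<otimes> q"] by (simp add: eq)
    show "\<psi> (x \<oplus>\<^bsub>S\<lparr>carrier := h ` carrier R\<rparr>\<^esub> y) = \<psi> x \<oplus>\<^bsub>T\<^esub> \<psi> y"
      using pq eq[of "p \<oplus> q"] by (simp add: eq)
  qed (use eq eq[OF R.one_closed] in \<open>auto\<close>)
  then show ?thesis using eq by blast
qed

context UP_pre_univ_prop
begin

context
  fixes k :: "('k, 'l) ring_scheme" and x
  assumes k: "algebraically_closed k" and dom: "domain R" "domain S"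
    and inj: "\<And>r. r \<in> carrier R \<Longrightarrow> h r = \<zero>\<^bsub>S\<^esub> \<Longrightarrow> r = \<zero>" and x: "x \<in> carrier S"
begin

text \<open>The form of the Nullstellensatz that survives induction: the image of
  \<open>eval\<close> is R[x] inside S, and each nonzero \<open>b\<close> in it has an obstruction
  \<open>a\<close> in R such that homomorphisms not killing \<open>a\<close> extend without killing
  \<open>b\<close>. The hypothesis for R is then applied to \<open>a\<close>.\<close>

abbreviation homs_extend where
  "homs_extend b \<equiv> \<exists>a\<in>carrier R. a \<noteq> \<zero> \<and> (\<forall>\<phi>\<in>ring_hom R k. \<phi> a \<noteq> \<zero>\<^bsub>k\<^esub> \<longrightarrow>
           (\<exists>\<psi>\<in>ring_hom (S\<lparr>carrier := UnivPoly.eval R S h x ` carrier P\<rparr>) k.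
              (\<forall>r\<in>carrier R. \<psi> (h r) = \<phi> r) \<and> \<psi> b \<noteq> \<zero>\<^bsub>k\<^esub>))"

interpretation k: algebraically_closed k by (rule k)
interpretation R: domain R by (rule dom(1))
interpretation S: domain S by (rule dom(2))
interpretation D: UP_domain R P by unfold_locales
interpretation E: ring_hom_cring P S "UnivPoly.eval R S h x"
  by (intro ring_homD eval_ring_hom x)

text \<open>Because \<phi> does not kill the leading coefficient, the specialised polynomial keeps
  its positive degree.\<close>

lemma exists_eval_eq:
  assumes \<phi>: "\<phi> \<in> ring_hom R k" and p: "p \<in> carrier P" "deg R p > 0" "\<phi> (lcoeff p) \<noteq> \<zero>\<^bsub>k\<^esub>"
    and v: "v \<in> carrier k"
  shows "\<exists>\<xi>\<in>carrier k. UnivPoly.eval R k \<phi> \<xi> p = v"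
  using k.polynomial_attains_value[of "\<lambda>i. \<phi> (up_ring.coeff P p i)" "deg R p" v] p v \<phi>
  by (auto simp: eval_on_carrier ring_hom_closed Pi_def)

text \<open>Sending \<open>x\<close> to \<xi> is consistent as soon as \<xi> satisfies, after
  specialisation by \<phi>, every relation that \<open>x\<close> satisfies. Constant polynomials
  show that the result extends \<phi>.\<close>

lemma hom_extends_to_image:
  assumes \<phi>: "\<phi> \<in> ring_hom R k" and \<xi>: "\<xi> \<in> carrier k"
    and ker: "\<And>p. p \<in> carrier P \<Longrightarrow> UnivPoly.eval R S h x p = \<zero>\<^bsub>S\<^esub> \<Longrightarrow> UnivPoly.eval R k \<phi> \<xi> p = \<zero>\<^bsub>k\<^esub>"
  shows "\<exists>\<psi>\<in>ring_hom (S\<lparr>carrier := UnivPoly.eval R S h x ` carrier P\<rparr>) k.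
           (\<forall>r\<in>carrier R. \<psi> (h r) = \<phi> r) \<and> (\<forall>p\<in>carrier P. \<psi> (UnivPoly.eval R S h x p) = UnivPoly.eval R k \<phi> \<xi> p)"
proof -
  interpret F: UP_pre_univ_prop R k \<phi> P
    using \<phi> by unfold_locales (auto simp: P_def)
  have E': "ring_hom_ring P S (UnivPoly.eval R S h x)"
    by (rule ring_hom_ringI2[OF P.ring_axioms S.ring_axioms eval_ring_hom[OF x]])
  obtain \<psi> where \<psi>: "\<psi> \<in> ring_hom (S\<lparr>carrier := UnivPoly.eval R S h x ` carrier P\<rparr>) k"
    "\<forall>p\<in>carrier P. \<psi> (UnivPoly.eval R S h x p) = UnivPoly.eval R k \<phi> \<xi> p"
    using ring_hom_ring.hom_factors_through_image[OF E' k.ring_axioms F.eval_ring_hom[OF \<xi>] ker] by auto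
  have "\<psi> (h r) = \<phi> r" if "r \<in> carrier R" for r
    using \<psi>(2)[rule_format, of "up_ring.monom P r 0"] that eval_const[OF x that] F.eval_const[OF \<xi> that] by simp
  then show ?thesis using \<psi> by blast
qed

text \<open>Without relations every \<xi> is allowed. For \<open>b = q(x)\<close> the obstruction is
  the leading coefficient of \<open>q\<close>: if \<phi> does not kill it, \<xi> can be chosen so
  that the specialised \<open>q\<close> does not vanish at \<xi>.\<close>

lemma hom_extension_transcendental:
  assumes trans: "\<And>p. p \<in> carrier P \<Longrightarrow> UnivPoly.eval R S h x p = \<zero>\<^bsub>S\<^esub> \<Longrightarrow> p = \<zero>\<^bsub>P\<^esub>"
    and b: "b \<in> UnivPoly.eval R S h x ` carrier P" "b \<noteq> \<zero>\<^bsub>S\<^esub>"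
  shows "homs_extend b"
proof -
  obtain q where q: "q \<in> carrier P" "b = UnivPoly.eval R S h x q" using b(1) by blast
  have q0: "q \<noteq> \<zero>\<^bsub>P\<^esub>" using b(2) q by auto
  show ?thesis
  proof (intro bexI[of _ "lcoeff q"] conjI ballI impI)
    show "lcoeff q \<noteq> \<zero>" using lcoeff_nonzero2[OF q(1) q0] .
    show "lcoeff q \<in> carrier R" using q by simp
    fix \<phi> assume \<phi>: "\<phi> \<in> ring_hom R k" "\<phi> (lcoeff q) \<noteq> \<zero>\<^bsub>k\<^esub>"
    interpret F: UP_pre_univ_prop R k \<phi> P
      using \<phi> by unfold_locales (auto simp: P_def)
    have "\<exists>\<xi>\<in>carrier k. UnivPoly.eval R k \<phi> \<xi> q \<noteq> \<zero>\<^bsub>k\<^esub>"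
    proof (cases "deg R q = 0")
      case True
      then have "q = up_ring.monom P (lcoeff q) 0" using deg_zero_impl_monom[OF q(1)] by simp
      then have "UnivPoly.eval R k \<phi> \<zero>\<^bsub>k\<^esub> q = \<phi> (lcoeff q)"
        using F.eval_const[of "\<zero>\<^bsub>k\<^esub>" "lcoeff q"] q(1) by (metis k.zero_closed lcoeff_closed)
      then show ?thesis using \<phi>(2) by (intro bexI[of _ "\<zero>\<^bsub>k\<^esub>"]) auto
    next
      case False
      then show ?thesis using exists_eval_eq[OF \<phi>(1) q(1) _ \<phi>(2) k.one_closed] k.one_not_zero by force
    qed
    then obtain \<xi> where \<xi>: "\<xi> \<in> carrier k" "UnivPoly.eval R k \<phi> \<xi> q \<noteq> \<zero>\<^bsub>k\<^esub>" by blast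
    have "UnivPoly.eval R k \<phi> \<xi> \<in> ring_hom P k" by (rule F.eval_ring_hom[OF \<xi>(1)])
    then have "UnivPoly.eval R k \<phi> \<xi> \<zero>\<^bsub>P\<^esub> = \<zero>\<^bsub>k\<^esub>"
      using ring_hom_zero P.ring_axioms k.ring_axioms by blast
    then show "\<exists>\<psi>\<in>ring_hom (S\<lparr>carrier := UnivPoly.eval R S h x ` carrier P\<rparr>) k.
              (\<forall>r\<in>carrier R. \<psi> (h r) = \<phi> r) \<and> \<psi> b \<noteq> \<zero>\<^bsub>k\<^esub>"
      using hom_extends_to_image[OF \<phi>(1) \<xi>(1)] trans \<xi>(2) q by metis
  qed
qed

text \<open>Let \<open>f\<close> be a relation of \<open>x\<close> of minimal degree. Its leading
  coefficient must survive \<phi>, so that the specialised \<open>f\<close> has a root \<xi>. In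
  addition \<open>b\<close> divides, in R[x], some nonzero constant of R; if that constant survives,
  then so does \<open>b\<close>. The obstruction is the product of the two. R is not a field, so
  division is always up to a power of a leading coefficient. The constant is found as a polynomial
  \<open>r\<close> of least degree among those whose value is a nonzero multiple of
  \<open>b\<close>.\<close>

lemma hom_extension_algebraic:
  assumes alg: "f0 \<in> carrier P" "UnivPoly.eval R S h x f0 = \<zero>\<^bsub>S\<^esub>" "f0 \<noteq> \<zero>\<^bsub>P\<^esub>"
    and b: "b \<in> UnivPoly.eval R S h x ` carrier P" "b \<noteq> \<zero>\<^bsub>S\<^esub>"
  shows "homs_extend b"
proof -
  let ?E = "UnivPoly.eval R S h x"
  have E_smult: "?E (c \<odot>\<^bsub>P\<^esub> p) = h c \<otimes>\<^bsub>S\<^esub> ?E p" if "c \<in> carrier R" "p \<in> carrier P" for c p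
    using that x by (simp add: monom_mult_is_smult[symmetric] eval_const)
  have h_pow: "h (c [^] (N::nat)) \<noteq> \<zero>\<^bsub>S\<^esub>" if "c \<in> carrier R" "c \<noteq> \<zero>" for c N
    using that inj R.nonzero_power by blast
  define K where "K f \<longleftrightarrow> f \<in> carrier P \<and> ?E f = \<zero>\<^bsub>S\<^esub> \<and> f \<noteq> \<zero>\<^bsub>P\<^esub>" for f
  obtain f where f: "f \<in> carrier P" "?E f = \<zero>\<^bsub>S\<^esub>" "f \<noteq> \<zero>\<^bsub>P\<^esub>"
    and f_min: "\<And>g. K g \<Longrightarrow> deg R f \<le> deg R g"
    using ex_has_least_nat[of K f0 "deg R"] alg by (auto simp: K_def)
  have a0: "lcoeff f \<in> carrier R" "lcoeff f \<noteq> \<zero>" using f lcoeff_nonzero2 by auto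
  have deg_f: "deg R f > 0"
  proof (rule ccontr)
    assume "\<not> deg R f > 0"
    then have "f = up_ring.monom P (lcoeff f) 0" using deg_zero_impl_monom[OF f(1)] by simp
    then have "?E f = h (lcoeff f)" using eval_const[OF x a0(1)] by metis
    then show False using f(2) inj a0 by auto
  qed
  have small: "p = \<zero>\<^bsub>P\<^esub>" if "p \<in> carrier P" "?E p = \<zero>\<^bsub>S\<^esub>" "deg R p < deg R f" for p
    using f_min[of p] that by (auto simp: K_def)
  define J where "J q \<longleftrightarrow> q \<in> carrier P \<and> ?E q \<noteq> \<zero>\<^bsub>S\<^esub> \<and> (\<exists>p\<in>carrier P. ?E q = b \<otimes>\<^bsub>S\<^esub> ?E p)" for q
  obtain q0 where q0: "q0 \<in> carrier P" "b = ?E q0" using b(1) by blast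
  have "J q0" using q0 b(2) unfolding J_def by (auto intro!: bexI[of _ "\<one>\<^bsub>P\<^esub>"])
  then obtain r where r: "J r" and r_min: "\<And>g. J g \<Longrightarrow> deg R r \<le> deg R g"
    using ex_has_least_nat[of J q0 "deg R"] by blast
  obtain s where s: "s \<in> carrier P" "?E r = b \<otimes>\<^bsub>S\<^esub> ?E s" using r by (auto simp: J_def)
  have rP: "r \<in> carrier P" "?E r \<noteq> \<zero>\<^bsub>S\<^esub>" "r \<noteq> \<zero>\<^bsub>P\<^esub>" using r by (auto simp: J_def)
  have bS: "b \<in> carrier S" using q0 by simp
  have J_mult: "J (p)" if p: "p \<in> carrier P" "u \<in> carrier P" "?E p = ?E r \<otimes>\<^bsub>S\<^esub> ?E u" "?E p \<noteq> \<zero>\<^bsub>S\<^esub>" for p u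
    unfolding J_def using p s bS
    by (auto intro!: bexI[of _ "s \<otimes>\<^bsub>P\<^esub> u"] simp: S.m_assoc)
  \<comment> \<open>The remainder of \<open>r\<close> modulo \<open>f\<close> takes the value of
    \<open>r\<close> times a nonzero constant, so it competes with \<open>r\<close> for the least
    degree.\<close>
  have deg_r: "deg R r < deg R f"
  proof -
    obtain g p N where d: "g \<in> carrier P" "p \<in> carrier P"
      "lcoeff f [^] (N::nat) \<odot>\<^bsub>P\<^esub> r = f \<otimes>\<^bsub>P\<^esub> g \<oplus>\<^bsub>P\<^esub> p" "p = \<zero>\<^bsub>P\<^esub> \<or> deg R p < deg R f"
      using long_div_theorem[OF f(1) rP(1) f(3)] by blast
    have "?E p = ?E (f \<otimes>\<^bsub>P\<^esub> g \<oplus>\<^bsub>P\<^esub> p)" using d f by simp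
    also have "\<dots> = h (lcoeff f [^] N) \<otimes>\<^bsub>S\<^esub> ?E r"
      by (subst d(3)[symmetric], rule E_smult) (use rP a0 in auto)
    finally have p: "?E p = h (lcoeff f [^] N) \<otimes>\<^bsub>S\<^esub> ?E r" .
    have p0: "?E p \<noteq> \<zero>\<^bsub>S\<^esub>"
      using p h_pow[OF a0, of N] rP a0 S.integral[of "h (lcoeff f [^] N)" "?E r"] by auto
    have "J p"
      using J_mult[OF d(2), of "up_ring.monom P (lcoeff f [^] N) 0"] p p0 a0 rP x
      by (simp add: eval_const S.m_comm)
    then have "deg R r \<le> deg R p" by (rule r_min)
    moreover have "p \<noteq> \<zero>\<^bsub>P\<^esub>" using p0 by auto
    ultimately show ?thesis using d(4) by simp
  qed
  \<comment> \<open>Now divide \<open>f\<close> by \<open>r\<close>. The remainder has a value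
    divisible by \<open>b\<close> and smaller degree than \<open>r\<close>, so its value is zero;
    minimality of \<open>f\<close> makes it zero itself. Then \<open>r \<otimes> g\<close> is a
    constant times \<open>f\<close>, and if \<open>r\<close> had positive degree, \<open>g\<close>
    would be a nonzero relation of degree below that of \<open>f\<close>.\<close>
  have "deg R r = 0"
  proof (rule ccontr)
    assume "deg R r \<noteq> 0"
    have lr: "lcoeff r \<in> carrier R" "lcoeff r \<noteq> \<zero>" using rP lcoeff_nonzero2 by auto
    obtain g p N where d: "g \<in> carrier P" "p \<in> carrier P"
      "lcoeff r [^] (N::nat) \<odot>\<^bsub>P\<^esub> f = r \<otimes>\<^bsub>P\<^esub> g \<oplus>\<^bsub>P\<^esub> p" "p = \<zero>\<^bsub>P\<^esub> \<or> deg R p < deg R r"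
      using long_div_theorem[OF rP(1) f(1) rP(3)] by blast
    have "?E r \<otimes>\<^bsub>S\<^esub> ?E g \<oplus>\<^bsub>S\<^esub> ?E p = ?E (r \<otimes>\<^bsub>P\<^esub> g \<oplus>\<^bsub>P\<^esub> p)" using d rP by simp
    also have "\<dots> = \<zero>\<^bsub>S\<^esub>" using d(3) E_smult[of "lcoeff r [^] N" f] f lr by (metis R.nat_pow_closed S.r_null hom_closed)
    finally have "?E p = \<ominus>\<^bsub>S\<^esub> (?E r \<otimes>\<^bsub>S\<^esub> ?E g)"
      using d rP by (metis E.hom_closed S.add.inv_closed S.m_closed S.minus_equality S.minus_minus)
    then have p: "?E p = ?E r \<otimes>\<^bsub>S\<^esub> ?E (\<ominus>\<^bsub>P\<^esub> g)" using d rP by (simp add: S.r_minus)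
    have "p = \<zero>\<^bsub>P\<^esub>"
    proof (rule ccontr)
      assume "p \<noteq> \<zero>\<^bsub>P\<^esub>"
      then have lt: "deg R p < deg R r" using d by simp
      then have "\<not> J p" using r_min[of p] by auto
      then have "?E p = \<zero>\<^bsub>S\<^esub>" using J_mult[OF d(2) _ p] d by auto
      then show False using small[of p] lt deg_r d \<open>p \<noteq> \<zero>\<^bsub>P\<^esub>\<close> by simp
    qed
    then have eq: "lcoeff r [^] N \<odot>\<^bsub>P\<^esub> f = r \<otimes>\<^bsub>P\<^esub> g" using d rP by simp
    have lrN: "lcoeff r [^] N \<noteq> \<zero>" using R.nonzero_power lr by blast
    have deg_eq: "deg R (r \<otimes>\<^bsub>P\<^esub> g) = deg R f"
      using D.deg_smult[of "lcoeff r [^] N" f] f lr lrN eq by simp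
    then have g0: "g \<noteq> \<zero>\<^bsub>P\<^esub>" using rP deg_f by auto
    have "?E r \<otimes>\<^bsub>S\<^esub> ?E g = \<zero>\<^bsub>S\<^esub>"
      using \<open>?E r \<otimes>\<^bsub>S\<^esub> ?E g \<oplus>\<^bsub>S\<^esub> ?E p = ?E (r \<otimes>\<^bsub>P\<^esub> g \<oplus>\<^bsub>P\<^esub> p)\<close> \<open>?E (r \<otimes>\<^bsub>P\<^esub> g \<oplus>\<^bsub>P\<^esub> p) = \<zero>\<^bsub>S\<^esub>\<close>
        \<open>p = \<zero>\<^bsub>P\<^esub>\<close> d rP by simp
    then have "?E g = \<zero>\<^bsub>S\<^esub>" using S.integral rP d by auto
    moreover have "deg R g < deg R f"
      using deg_eq D.deg_mult[OF rP(3) g0 rP(1) d(1)] \<open>deg R r \<noteq> 0\<close> by simp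
    ultimately show False using small[OF d(1)] g0 by blast
  qed
  then have r_monom: "r = up_ring.monom P (lcoeff r) 0" using deg_zero_impl_monom[OF rP(1)] by simp
  have Er: "?E r = h (lcoeff r)" using eval_const[OF x, of "lcoeff r"] rP r_monom by (metis lcoeff_closed)
  have lr: "lcoeff r \<in> carrier R" "lcoeff r \<noteq> \<zero>" using rP lcoeff_nonzero2 by auto
  show ?thesis
  proof (intro bexI[of _ "lcoeff f \<otimes> lcoeff r"] conjI ballI impI)
    show "lcoeff f \<otimes> lcoeff r \<in> carrier R" using a0 lr by simp
    show "lcoeff f \<otimes> lcoeff r \<noteq> \<zero>" using a0 lr R.integral by blast
    fix \<phi> assume \<phi>: "\<phi> \<in> ring_hom R k" "\<phi> (lcoeff f \<otimes> lcoeff r) \<noteq> \<zero>\<^bsub>k\<^esub>"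
    interpret F: UP_pre_univ_prop R k \<phi> P
      using \<phi> by unfold_locales (auto simp: P_def)
    have nz: "\<phi> (lcoeff f) \<noteq> \<zero>\<^bsub>k\<^esub>" "\<phi> (lcoeff r) \<noteq> \<zero>\<^bsub>k\<^esub>"
      using \<phi>(2) a0 lr by auto
    obtain \<xi> where \<xi>: "\<xi> \<in> carrier k" "UnivPoly.eval R k \<phi> \<xi> f = \<zero>\<^bsub>k\<^esub>"
      using exists_eval_eq[OF \<phi>(1) f(1) deg_f nz(1) k.zero_closed] by blast
    interpret F': ring_hom_cring P k "UnivPoly.eval R k \<phi> \<xi>"
      by (intro F.ring_homD F.eval_ring_hom \<xi>)
    \<comment> \<open>Any relation \<open>q\<close> is, up to a power of the leading coefficient, a
      multiple of \<open>f\<close>; hence it vanishes at the root \<xi> too.\<close>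
    have ker: "UnivPoly.eval R k \<phi> \<xi> q = \<zero>\<^bsub>k\<^esub>" if q: "q \<in> carrier P" "?E q = \<zero>\<^bsub>S\<^esub>" for q
    proof -
      obtain g p N where d: "g \<in> carrier P" "p \<in> carrier P"
        "lcoeff f [^] (N::nat) \<odot>\<^bsub>P\<^esub> q = f \<otimes>\<^bsub>P\<^esub> g \<oplus>\<^bsub>P\<^esub> p" "p = \<zero>\<^bsub>P\<^esub> \<or> deg R p < deg R f"
        using long_div_theorem[OF f(1) q(1) f(3)] by blast
      have "?E p = ?E (f \<otimes>\<^bsub>P\<^esub> g \<oplus>\<^bsub>P\<^esub> p)" using d f by simp
      also have "\<dots> = \<zero>\<^bsub>S\<^esub>" using d(3) E_smult[of "lcoeff f [^] N" q] q a0 by simp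
      finally have "p = \<zero>\<^bsub>P\<^esub>" using small[OF d(2)] d(4) by auto
      then have "UnivPoly.eval R k \<phi> \<xi> (lcoeff f [^] N \<odot>\<^bsub>P\<^esub> q) = \<zero>\<^bsub>k\<^esub>"
        using d f \<xi> by simp
      moreover have "UnivPoly.eval R k \<phi> \<xi> (lcoeff f [^] N \<odot>\<^bsub>P\<^esub> q) = \<phi> (lcoeff f) [^]\<^bsub>k\<^esub> N \<otimes>\<^bsub>k\<^esub> UnivPoly.eval R k \<phi> \<xi> q"
        using a0 q \<xi> by (simp add: monom_mult_is_smult[symmetric] F.eval_const)
      moreover have "\<phi> (lcoeff f) \<in> carrier k" using a0 by simp
      moreover have "UnivPoly.eval R k \<phi> \<xi> q \<in> carrier k" using q by simp
      ultimately show ?thesis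
        using k.nonzero_power[OF _ nz(1)] by (simp add: k.integral_iff)
    qed
    obtain \<psi> where \<psi>: "\<psi> \<in> ring_hom (S\<lparr>carrier := ?E ` carrier P\<rparr>) k"
      "\<forall>r\<in>carrier R. \<psi> (h r) = \<phi> r"
      using hom_extends_to_image[OF \<phi>(1) \<xi>(1) ker] by blast
    \<comment> \<open>The product of \<open>b\<close> and the value of \<open>s\<close> is the
      constant \<open>lcoeff r\<close>, whose image under \<phi> is nonzero.\<close>
    have "\<psi> b \<otimes>\<^bsub>k\<^esub> \<psi> (?E s) = \<psi> (b \<otimes>\<^bsub>S\<^esub> ?E s)"
      using ring_hom_mult[OF \<psi>(1), of b "?E s"] b s by simp
    also have "\<dots> = \<phi> (lcoeff r)" using s Er \<psi>(2) lr by metis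
    finally have "\<psi> b \<noteq> \<zero>\<^bsub>k\<^esub>"
      using nz(2) ring_hom_closed[OF \<psi>(1), of "?E s"] s by auto
    then show "\<exists>\<psi>\<in>ring_hom (S\<lparr>carrier := ?E ` carrier P\<rparr>) k.
              (\<forall>r\<in>carrier R. \<psi> (h r) = \<phi> r) \<and> \<psi> b \<noteq> \<zero>\<^bsub>k\<^esub>"
      using \<psi> by blast
  qed
qed

lemma hom_extension:
  assumes "b \<in> UnivPoly.eval R S h x ` carrier P" "b \<noteq> \<zero>\<^bsub>S\<^esub>"
  shows "homs_extend b"
  using hom_extension_transcendental[OF _ assms] hom_extension_algebraic[OF _ _ _ assms] by blast

end

end


lemma ring_hom_mono_carrier:
  assumes "A \<subseteq> A'" "\<psi> \<in> ring_hom (B\<lparr>carrier := A'\<rparr>) T"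
  shows "\<psi> \<in> ring_hom (B\<lparr>carrier := A\<rparr>) T"
  using assms by (simp add: ring_hom_def Pi_def) (meson subsetD)

text \<open>Weak Nullstellensatz, by induction on the generators. Adjoining \<open>x\<close> to A
  turns \<open>b\<close> into an obstruction \<open>a\<close> in A; the induction hypothesis for
  \<open>a\<close> gives a homomorphism on A that extends to A[x] without killing \<open>b\<close>.
  With no generators left, the homomorphism is the inverse of \<open>\<iota>\<close>, which is
  injective because L is a field.\<close>

lemma (in algebraically_closed) hom_from_finitely_generated_domain:
  assumes B: "domain B" and \<iota>: "\<iota> \<in> ring_hom L B" and S: "finite S" "S \<subseteq> carrier B"
    and b: "b \<in> generate_ring B (\<iota> ` carrier L \<union> S)" "b \<noteq> \<zero>\<^bsub>B\<^esub>"
  shows "\<exists>\<phi>\<in>ring_hom (B\<lparr>carrier := generate_ring B (\<iota> ` carrier L \<union> S)\<rparr>) L.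
           (\<forall>c\<in>carrier L. \<phi> (\<iota> c) = c) \<and> \<phi> b \<noteq> \<zero>"
  using S b
proof (induction S arbitrary: b)
  interpret B: domain B by fact
  interpret \<iota>: ring_hom_ring L B \<iota>
    by (intro ring_hom_ringI2 \<iota> ring_axioms B.ring_axioms)
  have range: "\<iota> ` carrier L \<subseteq> carrier B" by auto
  {
    case (empty b)
    have inj: "c = \<zero>" if "c \<in> carrier L" "\<iota> c = \<zero>\<^bsub>B\<^esub>" for c
    proof (rule ccontr)
      assume "c \<noteq> \<zero>"
      then have c: "c \<in> Units L" using that field_Units by simp
      then have "\<iota> \<one> = \<iota> c \<otimes>\<^bsub>B\<^esub> \<iota> (inv c)"
        using that c by (metis Units_inv_closed Units_r_inv \<iota>.hom_mult)
      then show False using that c by simp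
    qed
    have gen: "generate_ring B (\<iota> ` carrier L \<union> {}) = \<iota> ` carrier L"
      using B.generate_ring_min_subring1[OF _ \<iota>.img_is_subring[OF carrier_is_subring], of "\<iota> ` carrier L"]
        range by (auto intro: generate_ring.incl)
    obtain \<psi> where "\<psi> \<in> ring_hom (B\<lparr>carrier := \<iota> ` carrier L\<rparr>) L" "\<forall>c\<in>carrier L. \<psi> (\<iota> c) = id c"
      using \<iota>.hom_factors_through_image[OF ring_axioms, of id] inj by (auto simp: ring_hom_def)
    then show ?case using empty gen by auto
  next
    case (insert x S)
    define A where "A = generate_ring B (\<iota> ` carrier L \<union> S)"
    define A' where "A' = generate_ring B (\<iota> ` carrier L \<union> insert x S)"
    define R where "R = B\<lparr>carrier := A\<rparr>"
    have S: "\<iota> ` carrier L \<union> S \<subseteq> carrier B" "\<iota> ` carrier L \<union> insert x S \<subseteq> carrier B" "x \<in> carrier B"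
      using insert.prems range by auto
    have A: "subring A B" unfolding A_def by (rule B.generate_ring_is_subring[OF S(1)])
    have R: "domain R" unfolding R_def by (rule B.subring_is_domain[OF A])
    interpret R: domain R by (rule R)
    have id: "id \<in> ring_hom R B"
      unfolding R_def using subringE(1)[OF A] by (auto simp: ring_hom_def)
    interpret U: UP_pre_univ_prop R B id "UP R"
      by (unfold_locales) (use id in auto)
    let ?E = "UnivPoly.eval R B id x"
    interpret E: ring_hom_ring "UP R" B ?E
      by (intro ring_hom_ringI2 U.P.ring_axioms B.ring_axioms U.eval_ring_hom S)
    have AE: "A \<subseteq> ?E ` carrier (UP R)"
    proof
      fix a assume "a \<in> A"
      then have "a \<in> carrier R" by (simp add: R_def)
      then show "a \<in> ?E ` carrier (UP R)"
        using U.eval_const[OF S(3), of a] by (auto intro!: image_eqI[of _ _ "up_ring.monom (UP R) a 0"])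
    qed
    have "x \<in> ?E ` carrier (UP R)"
      using U.eval_monom1[OF S(3)] by (auto intro!: image_eqI[of _ _ "up_ring.monom (UP R) \<one>\<^bsub>R\<^esub> 1"])
    then have "\<iota> ` carrier L \<union> insert x S \<subseteq> ?E ` carrier (UP R)"
      using AE unfolding A_def by (blast intro: generate_ring.incl)
    then have "A' \<subseteq> ?E ` carrier (UP R)"
      unfolding A'_def
      by (intro B.generate_ring_min_subring1[OF S(2)] E.img_is_subring U.P.carrier_is_subring)
    then have bE: "b \<in> ?E ` carrier (UP R)" using insert.prems by (auto simp: A'_def)
    obtain a where a: "a \<in> A" "a \<noteq> \<zero>\<^bsub>B\<^esub>"
      "\<And>\<phi>. \<phi> \<in> ring_hom R L \<Longrightarrow> \<phi> a \<noteq> \<zero> \<Longrightarrow>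
           (\<exists>\<psi>\<in>ring_hom (B\<lparr>carrier := ?E ` carrier (UP R)\<rparr>) L.
              (\<forall>r\<in>A. \<psi> r = \<phi> r) \<and> \<psi> b \<noteq> \<zero>)"
      using U.hom_extension[OF algebraically_closed_axioms R B _ S(3) bE] insert.prems by (auto simp: R_def)
    obtain \<phi> where \<phi>: "\<phi> \<in> ring_hom R L" "\<forall>c\<in>carrier L. \<phi> (\<iota> c) = c" "\<phi> a \<noteq> \<zero>"
      using insert.IH[of a] insert.prems a(1,2) by (auto simp: A_def R_def)
    obtain \<psi> where \<psi>: "\<psi> \<in> ring_hom (B\<lparr>carrier := ?E ` carrier (UP R)\<rparr>) L"
      "\<forall>r\<in>A. \<psi> r = \<phi> r" "\<psi> b \<noteq> \<zero>"
      using a(3)[OF \<phi>(1,3)] by blast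
    have "\<psi> \<in> ring_hom (B\<lparr>carrier := A'\<rparr>) L"
      using \<open>A' \<subseteq> _\<close> \<psi>(1) by (rule ring_hom_mono_carrier)
    moreover have "\<psi> (\<iota> c) = c" if "c \<in> carrier L" for c
      using \<psi>(2) \<phi>(2) that generate_ring.incl[of "\<iota> c" "\<iota> ` carrier L \<union> S" B] by (auto simp: A_def)
    ultimately show ?case using \<psi>(3) by (auto simp: A'_def)
  }
qed


section \<open>Finiteness of Galois groups, and Cauchy's theorem\<close>

section \<open>Galois groups\<close>

lemma galois_group_mult:
  assumes "\<sigma> \<in> carrier (galois_group L K)" "\<tau> \<in> carrier (galois_group L K)"
  shows "\<sigma> \<otimes>\<^bsub>galois_group L K\<^esub> \<tau> = compose (carrier L) \<sigma> \<tau>"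
  using assms by (simp add: galois_group_def BijGroup_def)

lemma galois_group_one: "\<one>\<^bsub>galois_group L K\<^esub> = (\<lambda>x\<in>carrier L. x)"
  by (simp add: galois_group_def BijGroup_def)

lemma galois_groupD:
  assumes "\<sigma> \<in> carrier (galois_group L K)"
  shows "\<sigma> \<in> ring_hom L L" "\<sigma> \<in> extensional (carrier L)" "\<And>a. a \<in> K \<Longrightarrow> \<sigma> a = a"
  using assms by (auto simp: galois_group_def Bij_def)

text \<open>An element of the group is determined by the images of a finite spanning list, and each
  spanning element can only go to a root of a polynomial over K that annihilates it.\<close>

lemma finite_galois_group:
  assumes "finite_galois_extension L K"
  shows "finite (carrier (galois_group L K))"
proof -
  have L: "field L" and K: "subfield K L" and fin: "ring.finite_dimension L K (carrier L)"
    using assms by (auto simp: finite_galois_extension_def)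
  interpret field L by fact
  have KL: "K \<subseteq> carrier L" using subfieldE(3)[OF K] .
  obtain Us where Us: "set Us \<subseteq> carrier L" "Span K Us = carrier L"
    using fin exists_base[OF K] by (metis finite_dimensionE')
  \<comment> \<open>A finite set containing all conjugates of \<open>u\<close>, later the fibre of a
    finite product in which restrictions to the spanning set live.\<close>
  define Rt where "Rt u = (SOME S. finite S \<and> (\<forall>\<sigma>\<in>carrier (galois_group L K). \<sigma> u \<in> S))" for u
  have Rt: "finite (Rt u) \<and> (\<forall>\<sigma>\<in>carrier (galois_group L K). \<sigma> u \<in> Rt u)" if u: "u \<in> carrier L" for u
    unfolding Rt_def
  proof (rule someI_ex)
    have "(algebraic over K) u"
      using finite_dimension_imp_algebraic[OF K carrier_is_subring fin u] .
    then obtain p where p: "p \<in> carrier (K[X]\<^bsub>L\<^esub>)" "p \<noteq> []" "eval p u = \<zero>\<^bsub>L\<^esub>"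
      using algebraicE[OF subfieldE(1)[OF K] u] by blast
    have "polynomial\<^bsub>L\<^esub> K p" using p(1) by (simp add: univ_poly_carrier)
    then have setp: "set p \<subseteq> K" by (auto simp: polynomial_def)
    have "p \<in> carrier (poly_ring L)"
      using carrier_polynomial[OF subfieldE(1)[OF K] \<open>polynomial\<^bsub>L\<^esub> K p\<close>] by (simp add: univ_poly_carrier)
    then have "finite {x. is_root p x}" by (rule finite_number_of_roots)
    moreover have "is_root p (\<sigma> u)" if \<sigma>: "\<sigma> \<in> carrier (galois_group L K)" for \<sigma>
    proof -
      interpret \<sigma>: ring_hom_ring L L \<sigma>
        by (intro ring_hom_ringI2 ring_axioms galois_groupD(1)[OF \<sigma>])
      have "map \<sigma> p = p" using galois_groupD(3)[OF \<sigma>] setp by (auto intro: map_idI)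
      then have "eval p (\<sigma> u) = \<sigma> (eval p u)"
        using \<sigma>.eval_hom'[OF u] setp KL by auto
      then show ?thesis using p u by (simp add: is_root_def)
    qed
    ultimately show "\<exists>S. finite S \<and> (\<forall>\<sigma>\<in>carrier (galois_group L K). \<sigma> u \<in> S)" by blast
  qed
  have "inj_on (\<lambda>\<sigma>. restrict \<sigma> (set Us)) (carrier (galois_group L K))"
  proof (rule inj_onI)
    fix \<sigma> \<tau>
    assume \<sigma>: "\<sigma> \<in> carrier (galois_group L K)" and \<tau>: "\<tau> \<in> carrier (galois_group L K)"
      and eq: "restrict \<sigma> (set Us) = restrict \<tau> (set Us)"
    have *: "\<rho> (combine Ks Us) = combine Ks (map \<rho> Us)"
      if \<rho>: "\<rho> \<in> carrier (galois_group L K)" and Ks: "set Ks \<subseteq> K" for \<rho> Ks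
    proof -
      interpret \<rho>: ring_hom_ring L L \<rho>
        by (intro ring_hom_ringI2 ring_axioms galois_groupD(1)[OF \<rho>])
      have "map \<rho> Ks = Ks" using galois_groupD(3)[OF \<rho>] Ks by (auto intro: map_idI)
      then show ?thesis using \<rho>.combine_hom[of Ks Us] Ks KL Us by auto
    qed
    show "\<sigma> = \<tau>"
    proof (rule extensionalityI[OF galois_groupD(2)[OF \<sigma>] galois_groupD(2)[OF \<tau>]])
      fix x assume "x \<in> carrier L"
      then obtain Ks where Ks: "x = combine Ks Us" "set Ks \<subseteq> K"
        using Us(2) Span_eq_combine_set[OF K Us(1)] by auto
      have "map \<sigma> Us = map \<tau> Us" using eq by (auto simp: restrict_def fun_eq_iff) metis
      then show "\<sigma> x = \<tau> x" unfolding Ks(1) *[OF \<sigma> Ks(2)] *[OF \<tau> Ks(2)] by (rule arg_cong)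
    qed
  qed
  moreover have "(\<lambda>\<sigma>. restrict \<sigma> (set Us)) ` carrier (galois_group L K) \<subseteq> PiE (set Us) Rt"
    using Rt Us(1) by auto
  moreover have "finite (PiE (set Us) Rt)" using Rt Us(1) by (intro finite_PiE) auto
  ultimately show ?thesis by (meson finite_imageD finite_subset)
qed

text \<open>Left multiplication by \<open>x\<close> is an injective self-map of a finite set, hence
  hits the unit.\<close>

lemma (in group) finite_submonoid_is_subgroup:
  assumes "finite I" "I \<subseteq> carrier G" "\<one> \<in> I" "\<And>x y. x \<in> I \<Longrightarrow> y \<in> I \<Longrightarrow> x \<otimes> y \<in> I"
  shows "subgroup I G"
proof (rule subgroupI)
  fix x assume x: "x \<in> I"
  have "inj_on (\<lambda>y. x \<otimes> y) I" using x assms(2) by (intro inj_onI) (metis l_cancel subsetD)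
  then have "(\<lambda>y. x \<otimes> y) ` I = I"
    using assms x by (intro endo_inj_surj) auto
  then obtain y where "y \<in> I" "x \<otimes> y = \<one>" using assms(3) by (metis imageE)
  then show "inv x \<in> I" using x assms(2) by (metis inv_comm inv_equality subsetD)
qed (use assms in auto)

text \<open>Cauchy's theorem: the Sylow theorem with exponent 1 gives a subgroup of order
  \<open>l\<close>, and any of its nontrivial elements will do.\<close>

lemma (in group) exists_element_of_prime_order:
  assumes "finite (carrier G)" "Factorial_Ring.prime l" "l dvd order G"
  shows "\<exists>x\<in>carrier G. x \<noteq> \<one> \<and> x [^] l = \<one>"
proof -
  obtain m where "order G = l ^ 1 * m" using assms(3) by auto
  then obtain H where H: "subgroup H G" "card H = l ^ 1"
    using sylow_thm[OF assms(2) group_axioms _ assms(1)] by blast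
  interpret H: group "G\<lparr>carrier := H\<rparr>" using subgroup.subgroup_is_group[OF H(1) group_axioms] .
  have "card H > 1" using H(2) prime_gt_1_nat[OF assms(2)] by simp
  then obtain x where x: "x \<in> H" "x \<noteq> \<one>"
    by (metis card_1_singleton_iff card_gt_0_iff ex_in_conv is_singletonI' is_singleton_altdef
        less_irrefl less_trans zero_less_one)
  have "x [^]\<^bsub>G\<lparr>carrier := H\<rparr>\<^esub> order (G\<lparr>carrier := H\<rparr>) = \<one>\<^bsub>G\<lparr>carrier := H\<rparr>\<^esub>"
    using x(1) by (intro H.pow_order_eq_1) simp
  then have "x [^] l = \<one>" using H(2) by (simp add: order_def nat_pow_consistent[symmetric])
  then show ?thesis using x subgroup.subset[OF H(1)] by blast
qed


section \<open>Inertia acting on a discrete valuation ring\<close>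

lemma (in abelian_group) add_minus_cancel:
  assumes "x \<in> carrier G" "y \<in> carrier G"
  shows "(x \<oplus> y) \<ominus> x = y" "x \<oplus> (y \<ominus> x) = y" "z \<in> carrier G \<Longrightarrow> (x \<ominus> y) \<oplus> (y \<ominus> z) = x \<ominus> z"
proof -
  show 1: "(x \<oplus> y) \<ominus> x = y" using assms by (metis a_assoc a_comm a_inv_closed a_minus_def r_neg r_zero)
  show "x \<oplus> (y \<ominus> x) = y" using 1 assms by (metis a_assoc a_inv_closed a_minus_def)
  show "z \<in> carrier G \<Longrightarrow> (x \<ominus> y) \<oplus> (y \<ominus> z) = x \<ominus> z"
    using assms by (simp add: a_minus_def a_assoc r_neg1 r_neg2)
qed

text \<open>A is the local ring at \<open>y\<close>, embedded in the function field L,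
  \<open>t\<close> a uniformiser and F the field of functions of the base. The axioms list what is
  used of a discrete valuation ring: \<open>t\<close> is not invertible, the residue field is
  \<open>k\<close>, the powers of \<open>t\<close> have Krull intersection zero, and L is the
  fraction field. I preserves A and its maximal ideal.\<close>

locale inertia_action = L: field L + k: field k
  for L :: "'a ring" (structure) and k :: "'k ring" +
  fixes \<iota> :: "'k \<Rightarrow> 'a" and A :: "'a set" and t :: 'a and F :: "'a set" and I :: "('a \<Rightarrow> 'a) set"
  assumes group_G: "group (galois_group L F)" and finite_G: "finite (carrier (galois_group L F))"
    and \<iota>_hom: "\<iota> \<in> ring_hom k L" and \<iota>_A: "c \<in> carrier k \<Longrightarrow> \<iota> c \<in> A"
    and \<iota>_F: "c \<in> carrier k \<Longrightarrow> \<iota> c \<in> F"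
    and A: "subring A L" and t: "t \<in> A" "t \<noteq> \<zero>"
    and one_notin: "a \<in> A \<Longrightarrow> a \<otimes> t \<noteq> \<one>"
    and residue: "a \<in> A \<Longrightarrow> \<exists>c\<in>carrier k. \<exists>b\<in>A. a = \<iota> c \<oplus> b \<otimes> t"
    and separated: "(\<And>i::nat. \<exists>b\<in>A. a = b \<otimes> t [^] i) \<Longrightarrow> a = \<zero>"
    and fractions: "x \<in> carrier L \<Longrightarrow> \<exists>a\<in>A. \<exists>b\<in>A. b \<noteq> \<zero> \<and> x \<otimes> b = a"
    and I_G: "I \<subseteq> carrier (galois_group L F)"
    and I_one: "\<one>\<^bsub>galois_group L F\<^esub> \<in> I"
    and I_mult: "\<sigma> \<in> I \<Longrightarrow> \<tau> \<in> I \<Longrightarrow> \<sigma> \<otimes>\<^bsub>galois_group L F\<^esub> \<tau> \<in> I"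
    and I_A: "\<sigma> \<in> I \<Longrightarrow> a \<in> A \<Longrightarrow> \<sigma> a \<in> A"
    and I_t: "\<sigma> \<in> I \<Longrightarrow> \<exists>v\<in>A. \<sigma> t = v \<otimes> t"
begin

abbreviation G where "G \<equiv> galois_group L F"

sublocale G: group G by (rule group_G)

lemma A_subset: "A \<subseteq> carrier L" and A_zero: "\<zero> \<in> A" and A_one: "\<one> \<in> A"
  and A_uminus: "a \<in> A \<Longrightarrow> \<ominus> a \<in> A"
  and A_add: "a \<in> A \<Longrightarrow> b \<in> A \<Longrightarrow> a \<oplus> b \<in> A"
  and A_mult: "a \<in> A \<Longrightarrow> b \<in> A \<Longrightarrow> a \<otimes> b \<in> A"
  using subringE[OF A] by auto

lemma A_carrier [simp]: "a \<in> A \<Longrightarrow> a \<in> carrier L"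
  using A_subset by blast

lemma A_minus: "a \<in> A \<Longrightarrow> b \<in> A \<Longrightarrow> a \<ominus> b \<in> A"
  by (simp add: a_minus_def A_add A_uminus)

lemmas A_closed = A_zero A_one A_uminus A_add A_mult A_minus

lemma t_carrier [simp]: "t \<in> carrier L"
  using t by simp

section \<open>The filtration of A by powers of the maximal ideal\<close>

definition \<mm> :: "nat \<Rightarrow> 'a set" where
  "\<mm> i = {b \<otimes> t [^] i | b. b \<in> A}"

lemma mmI: "b \<in> A \<Longrightarrow> b \<otimes> t [^] i \<in> \<mm> i"
  by (auto simp: \<mm>_def)

lemma mm_carrier [simp]: "a \<in> \<mm> i \<Longrightarrow> a \<in> carrier L"
  by (auto simp: \<mm>_def)

lemma mm_0: "\<mm> 0 = A"
  by (force simp: \<mm>_def)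

lemma mm_add:
  assumes "a \<in> \<mm> i" "b \<in> \<mm> i" shows "a \<oplus> b \<in> \<mm> i"
proof -
  obtain a' b' where "a' \<in> A" "b' \<in> A" "a = a' \<otimes> t [^] i" "b = b' \<otimes> t [^] i"
    using assms by (auto simp: \<mm>_def)
  then show ?thesis using mmI[of "a' \<oplus> b'" i] by (simp add: L.l_distr A_add)
qed

lemma mm_mult:
  assumes "a \<in> A" "b \<in> \<mm> i" shows "a \<otimes> b \<in> \<mm> i"
proof -
  obtain b' where "b' \<in> A" "b = b' \<otimes> t [^] i"
    using assms by (auto simp: \<mm>_def)
  then show ?thesis using mmI[of "a \<otimes> b'" i] assms by (simp add: L.m_assoc A_mult)
qed

lemma mm_uminus: "a \<in> \<mm> i \<Longrightarrow> \<ominus> a \<in> \<mm> i"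
  using mm_mult[of "\<ominus> \<one>" a i] by (simp add: A_closed L.l_minus)

lemma mm_minus: "a \<in> \<mm> i \<Longrightarrow> b \<in> \<mm> i \<Longrightarrow> a \<ominus> b \<in> \<mm> i"
  by (simp add: a_minus_def mm_add mm_uminus)

lemma mm_zero: "\<zero> \<in> \<mm> i"
  using mmI[OF A_zero, of i] by simp

lemma mm_1: "a \<in> \<mm> (Suc 0) \<longleftrightarrow> (\<exists>b\<in>A. a = b \<otimes> t)"
  by (auto simp: \<mm>_def)

lemma one_notin_mm: "\<one> \<notin> \<mm> (Suc 0)"
  using one_notin unfolding mm_1 by metis

lemma mm_mult_1:
  assumes "a \<in> \<mm> (Suc 0)" "b \<in> A" shows "a \<otimes> b \<in> \<mm> (Suc 0)"
  using mm_mult[OF assms(2,1)] assms by (simp add: L.m_comm)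

sublocale \<iota>: ring_hom_ring k L \<iota>
  by (intro ring_hom_ringI2 k.ring_axioms L.ring_axioms \<iota>_hom)

text \<open>A nonzero constant is a unit, and the maximal ideal does not contain 1.\<close>

lemma iota_in_mm:
  assumes "c \<in> carrier k" "\<iota> c \<in> \<mm> (Suc 0)" shows "c = \<zero>\<^bsub>k\<^esub>"
proof (rule ccontr)
  assume "c \<noteq> \<zero>\<^bsub>k\<^esub>"
  then have c: "c \<in> Units k" using assms by (simp add: k.field_Units)
  then have "\<iota> (inv\<^bsub>k\<^esub> c) \<otimes> \<iota> c = \<one>"
    using assms by (metis \<iota>.hom_mult \<iota>.hom_one k.Units_inv_closed k.Units_l_inv)
  moreover have "\<iota> (inv\<^bsub>k\<^esub> c) \<otimes> \<iota> c \<in> \<mm> (Suc 0)"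
    using c by (intro mm_mult \<iota>_A assms) auto
  ultimately show False using one_notin_mm by simp
qed

lemma residue_unique:
  assumes "c \<in> carrier k" "d \<in> carrier k" "v \<in> carrier L"
    and "v \<ominus> \<iota> c \<in> \<mm> (Suc 0)" "v \<ominus> \<iota> d \<in> \<mm> (Suc 0)"
  shows "c = d"
proof -
  have "\<iota> (d \<ominus>\<^bsub>k\<^esub> c) = (v \<ominus> \<iota> c) \<ominus> (v \<ominus> \<iota> d)"
    using assms(1-3) by (simp add: a_minus_def L.minus_add L.a_ac L.r_neg1 L.r_neg2)
  also have "\<dots> \<in> \<mm> (Suc 0)" by (rule mm_minus[OF assms(4,5)])
  finally have "d \<ominus>\<^bsub>k\<^esub> c = \<zero>\<^bsub>k\<^esub>" using assms by (intro iota_in_mm) auto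
  then show ?thesis using assms by (simp add: k.r_right_minus_eq)
qed

section \<open>The action of I on the filtration\<close>

lemma I_hom: "\<sigma> \<in> I \<Longrightarrow> ring_hom_ring L L \<sigma>"
  using galois_groupD(1)[of \<sigma> L F] I_G by (intro ring_hom_ringI2 L.ring_axioms) auto

lemma I_closed [simp]: "\<sigma> \<in> I \<Longrightarrow> a \<in> carrier L \<Longrightarrow> \<sigma> a \<in> carrier L"
  using ring_hom_closed[OF galois_groupD(1)[of \<sigma> L F]] I_G by blast

lemma I_add: "\<sigma> \<in> I \<Longrightarrow> a \<in> carrier L \<Longrightarrow> b \<in> carrier L \<Longrightarrow> \<sigma> (a \<oplus> b) = \<sigma> a \<oplus> \<sigma> b"
  and I_times: "\<sigma> \<in> I \<Longrightarrow> a \<in> carrier L \<Longrightarrow> b \<in> carrier L \<Longrightarrow> \<sigma> (a \<otimes> b) = \<sigma> a \<otimes> \<sigma> b"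
  and I_minus: "\<sigma> \<in> I \<Longrightarrow> a \<in> carrier L \<Longrightarrow> b \<in> carrier L \<Longrightarrow> \<sigma> (a \<ominus> b) = \<sigma> a \<ominus> \<sigma> b"
  and I_pow: "\<sigma> \<in> I \<Longrightarrow> a \<in> carrier L \<Longrightarrow> \<sigma> (a [^] (i::nat)) = \<sigma> a [^] i"
proof -
  assume "\<sigma> \<in> I"
  then interpret \<sigma>: ring_hom_ring L L \<sigma> by (rule I_hom)
  show "a \<in> carrier L \<Longrightarrow> b \<in> carrier L \<Longrightarrow> \<sigma> (a \<oplus> b) = \<sigma> a \<oplus> \<sigma> b"
    and "a \<in> carrier L \<Longrightarrow> b \<in> carrier L \<Longrightarrow> \<sigma> (a \<otimes> b) = \<sigma> a \<otimes> \<sigma> b"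
    and "a \<in> carrier L \<Longrightarrow> b \<in> carrier L \<Longrightarrow> \<sigma> (a \<ominus> b) = \<sigma> a \<ominus> \<sigma> b"
    and "a \<in> carrier L \<Longrightarrow> \<sigma> (a [^] i) = \<sigma> a [^] i"
    by (simp_all add: a_minus_def \<sigma>.hom_nat_pow)
qed

lemma I_zero: "\<sigma> \<in> I \<Longrightarrow> \<sigma> \<zero> = \<zero>"
  using ring_hom_zero[OF galois_groupD(1)[of \<sigma> L F]] I_G L.ring_axioms by blast

lemma I_iota: "\<sigma> \<in> I \<Longrightarrow> c \<in> carrier k \<Longrightarrow> \<sigma> (\<iota> c) = \<iota> c"
  using galois_groupD(3)[of \<sigma> L F] I_G \<iota>_F by auto

lemma G_mult_apply: "\<sigma> \<in> I \<Longrightarrow> \<tau> \<in> I \<Longrightarrow> a \<in> carrier L \<Longrightarrow> (\<sigma> \<otimes>\<^bsub>G\<^esub> \<tau>) a = \<sigma> (\<tau> a)"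
  using I_G by (subst galois_group_mult) (auto simp: compose_def)

lemma G_one_apply: "a \<in> carrier L \<Longrightarrow> \<one>\<^bsub>G\<^esub> a = a"
  by (simp add: galois_group_one)

lemma finite_I: "finite I"
  using I_G finite_G finite_subset by blast

lemma I_subgroup: "subgroup I G"
  by (rule G.finite_submonoid_is_subgroup[OF finite_I I_G I_one I_mult])

lemma I_inv: "\<sigma> \<in> I \<Longrightarrow> inv\<^bsub>G\<^esub> \<sigma> \<in> I"
  using I_subgroup by (rule subgroup.m_inv_closed)

lemma I_mm:
  assumes \<sigma>: "\<sigma> \<in> I" and a: "a \<in> \<mm> i" shows "\<sigma> a \<in> \<mm> i"
proof -
  obtain b where b: "b \<in> A" "a = b \<otimes> t [^] i" using a by (auto simp: \<mm>_def)
  obtain v where v: "v \<in> A" "\<sigma> t = v \<otimes> t" using I_t[OF \<sigma>] by blast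
  have "v [^] i \<in> A" using v by (induction i) (auto simp: A_closed)
  then have *: "\<sigma> b \<otimes> v [^] i \<in> A" using I_A[OF \<sigma> b(1)] by (simp add: A_mult)
  have "\<sigma> a = (\<sigma> b \<otimes> v [^] i) \<otimes> t [^] i"
    using b v \<sigma> by (simp add: I_times I_pow L.nat_pow_distrib L.m_assoc)
  then show ?thesis using mmI[OF *] by simp
qed

text \<open>Modulo the maximal ideal every element is a constant, and constants are fixed since they
  come from the base field F. This is the reason why the stabiliser is already the inertia
  group.\<close>

lemma I_residue:
  assumes \<sigma>: "\<sigma> \<in> I" and a: "a \<in> A" shows "\<sigma> a \<ominus> a \<in> \<mm> (Suc 0)"
proof -
  obtain c b where cb: "c \<in> carrier k" "b \<in> A" "a = \<iota> c \<oplus> b \<otimes> t"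
    using residue[OF a] by blast
  have m: "b \<otimes> t \<in> \<mm> (Suc 0)" using cb by (auto simp: mm_1)
  then have m': "\<sigma> (b \<otimes> t) \<in> \<mm> (Suc 0)" by (rule I_mm[OF \<sigma>])
  have "\<sigma> a = \<iota> c \<oplus> \<sigma> (b \<otimes> t)"
    using cb \<sigma> by (simp add: I_add I_iota)
  then have "\<sigma> a \<ominus> a = \<sigma> (b \<otimes> t) \<ominus> b \<otimes> t"
    using cb(1) mm_carrier[OF m] mm_carrier[OF m'] unfolding cb(3)
    by (simp add: a_minus_def L.minus_add L.a_ac L.r_neg1 L.r_neg2)
  then show ?thesis using mm_minus[OF m' m] by simp
qed

text \<open>The condition inside \<open>tame_character\<close>, transported from the stalk to A;
  \<open>s\<close> runs through all uniformisers, expressed as generators of the maximal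
  ideal.\<close>

definition is_character :: "('a \<Rightarrow> 'a) \<Rightarrow> 'k \<Rightarrow> bool" where
  "is_character \<sigma> c \<longleftrightarrow> c \<in> carrier k \<and>
     (\<forall>s\<in>A. {a \<otimes> s | a. a \<in> A} = \<mm> (Suc 0) \<longrightarrow>
        (\<exists>v\<in>A. \<sigma> s = v \<otimes> s \<and> v \<ominus> \<iota> c \<in> \<mm> (Suc 0)))"

lemma mm_1_eq: "{a \<otimes> t | a. a \<in> A} = \<mm> (Suc 0)"
  by (auto simp: \<mm>_def)

text \<open>One uniformiser suffices: another one is \<open>s = u \<otimes> t\<close> with
  \<open>u\<close> a unit, so \<sigma>(s)/s is \<sigma>(t)/t times \<sigma>(u)/u, and the latter has
  residue 1 because \<sigma> acts trivially on residues.\<close>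

lemma is_characterI:
  assumes \<sigma>: "\<sigma> \<in> I" and c: "c \<in> carrier k" and v: "v \<in> A" "\<sigma> t = v \<otimes> t" "v \<ominus> \<iota> c \<in> \<mm> (Suc 0)"
  shows "is_character \<sigma> c"
  unfolding is_character_def
proof (intro conjI ballI impI c)
  fix s assume s: "s \<in> A" "{a \<otimes> s | a. a \<in> A} = \<mm> (Suc 0)"
  have "s \<in> \<mm> (Suc 0)" using s A_one by (subst s(2)[symmetric]) force
  then obtain u where u: "u \<in> A" "s = u \<otimes> t" by (auto simp: mm_1)
  have "t \<in> \<mm> (Suc 0)" using A_one t by (force simp: mm_1)
  then obtain u' where u': "u' \<in> A" "t = u' \<otimes> s" using s(2) by blast
  have "t = u' \<otimes> (u \<otimes> t)" using u u' by metis
  then have "\<one> \<otimes> t = (u' \<otimes> u) \<otimes> t"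
    using u(1) u'(1) by (simp add: L.m_assoc)
  then have uu: "u' \<otimes> u = \<one>" using u(1) u'(1) t L.m_rcancel[OF t(2), of "u' \<otimes> u" "\<one>"] by simp
  define w where "w = \<sigma> u \<otimes> v \<otimes> u'"
  have w: "w \<in> A" using u(1) u'(1) v I_A[OF \<sigma>] by (simp add: w_def A_mult)
  have \<sigma>u: "\<sigma> u \<in> A" using I_A[OF \<sigma>] u by simp
  have "\<sigma> s = \<sigma> u \<otimes> (v \<otimes> t)" using u \<sigma> v by (simp add: I_times)
  also have "\<dots> = \<sigma> u \<otimes> (v \<otimes> (u' \<otimes> s))" using u'(2) by simp
  also have "\<dots> = w \<otimes> s" using \<sigma>u v(1) u'(1) s(1) by (simp add: w_def L.m_assoc)
  finally have "\<sigma> s = w \<otimes> s" .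
  \<comment> \<open>Here \<open>u'\<close> is the inverse of \<open>u\<close>, so \<open>w\<close>
    is \<sigma>(s)/s. The factor \<open>\<sigma> u - u\<close> puts the difference into the maximal
    ideal.\<close>
  moreover have "w \<ominus> v = (\<sigma> u \<ominus> u) \<otimes> (v \<otimes> u')"
  proof -
    have "u \<otimes> (v \<otimes> u') = v \<otimes> (u' \<otimes> u)"
      using u(1) v(1) u'(1) by (simp add: L.m_ac)
    then have "u \<otimes> (v \<otimes> u') = v" using uu v by simp
    then show ?thesis using \<sigma>u u(1) v(1) u'(1)
      by (simp add: w_def a_minus_def L.l_distr L.l_minus L.m_assoc)
  qed
  then have "w \<ominus> v \<in> \<mm> (Suc 0)"
    using mm_mult_1[OF I_residue[OF \<sigma> u(1)]] v(1) u'(1) by (simp add: A_mult)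
  then have "(w \<ominus> v) \<oplus> (v \<ominus> \<iota> c) \<in> \<mm> (Suc 0)" using v(3) by (rule mm_add)
  moreover have "(w \<ominus> v) \<oplus> (v \<ominus> \<iota> c) = w \<ominus> \<iota> c"
    using w v(1) c by (simp add: a_minus_def L.a_assoc L.r_neg1)
  ultimately show "\<exists>v\<in>A. \<sigma> s = v \<otimes> s \<and> v \<ominus> \<iota> c \<in> \<mm> (Suc 0)" using w by auto
qed

lemma is_characterD:
  assumes "is_character \<sigma> c"
  shows "\<exists>v\<in>A. \<sigma> t = v \<otimes> t \<and> v \<ominus> \<iota> c \<in> \<mm> (Suc 0)"
  using assms t mm_1_eq unfolding is_character_def by blast

text \<open>Cancelling \<open>t\<close> in the domain L determines \<open>v\<close>, and
  \<open>v\<close> has exactly one residue in \<open>k\<close>.\<close>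

lemma ex1_character:
  assumes \<sigma>: "\<sigma> \<in> I" shows "\<exists>!c. is_character \<sigma> c"
proof (rule ex_ex1I)
  obtain v where v: "v \<in> A" "\<sigma> t = v \<otimes> t" using I_t[OF \<sigma>] by blast
  obtain c b where cb: "c \<in> carrier k" "b \<in> A" "v = \<iota> c \<oplus> b \<otimes> t"
    using residue[OF v(1)] by blast
  have "v \<ominus> \<iota> c = b \<otimes> t" using cb by (simp add: L.add_minus_cancel)
  then have "v \<ominus> \<iota> c \<in> \<mm> (Suc 0)" using cb by (auto simp: mm_1)
  then show "\<exists>c. is_character \<sigma> c" using is_characterI[OF \<sigma> cb(1) v] by blast
  fix c d assume c: "is_character \<sigma> c" and d: "is_character \<sigma> d"
  obtain v where v: "v \<in> A" "\<sigma> t = v \<otimes> t" "v \<ominus> \<iota> c \<in> \<mm> (Suc 0)"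
    using is_characterD[OF c] by blast
  obtain w where w: "w \<in> A" "\<sigma> t = w \<otimes> t" "w \<ominus> \<iota> d \<in> \<mm> (Suc 0)"
    using is_characterD[OF d] by blast
  have "v = w" using v w t by (simp add: L.m_rcancel)
  then show "c = d" using residue_unique[of c d v] v w c d by (simp add: is_character_def)
qed

definition wild :: "('a \<Rightarrow> 'a) set" where
  "wild = {\<sigma> \<in> I. is_character \<sigma> \<one>\<^bsub>k\<^esub>}"

text \<open>The right-hand side mentions only the filtration, which all of I preserves; normality
  and the torsion argument are read off from it. Residue 1 for \<sigma>(t)/t propagates from one
  power of \<open>t\<close> to the next, and conversely the case of \<open>t\<close> itself recovers
  the character.\<close>

lemma wild_iff:
  "\<sigma> \<in> wild \<longleftrightarrow> \<sigma> \<in> I \<and> (\<forall>i. \<forall>a\<in>\<mm> i. \<sigma> a \<ominus> a \<in> \<mm> (Suc i))"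
proof (intro iffI conjI allI ballI)
  assume "\<sigma> \<in> wild"
  then have \<sigma>: "\<sigma> \<in> I" and ch: "is_character \<sigma> \<one>\<^bsub>k\<^esub>" by (auto simp: wild_def)
  show "\<sigma> \<in> I" by fact
  obtain v where v: "v \<in> A" "\<sigma> t = v \<otimes> t" "v \<ominus> \<one> \<in> \<mm> (Suc 0)"
    using is_characterD[OF ch] by auto
  fix i a assume "a \<in> \<mm> i"
  then show "\<sigma> a \<ominus> a \<in> \<mm> (Suc i)"
  proof (induction i arbitrary: a)
    case 0
    then show ?case using I_residue[OF \<sigma>] by (simp add: mm_0)
  next
    case (Suc i)
    obtain b where b: "b \<in> A" "a = b \<otimes> t [^] Suc i" using Suc.prems by (auto simp: \<mm>_def)
    define a' where "a' = b \<otimes> t [^] i"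
    have a': "a' \<in> \<mm> i" "a = a' \<otimes> t" using b mmI by (auto simp: a'_def L.m_assoc)
    have mmt: "x \<otimes> t \<in> \<mm> (Suc j)" if "x \<in> \<mm> j" for x j
      using that by (auto simp: \<mm>_def L.m_assoc)
    obtain w where w: "w \<in> A" "v \<ominus> \<one> = w \<otimes> t" using v(3) by (auto simp: mm_1)
    have v_eq: "v = \<one> \<oplus> w \<otimes> t"
      unfolding w(2)[symmetric] using v(1) by (simp add: L.add_minus_cancel)
    have \<sigma>a': "\<sigma> a' \<in> \<mm> i" using I_mm[OF \<sigma> a'(1)] .
    \<comment> \<open>With \<open>\<sigma> t = (1 + w t) t\<close> the change of
      \<open>a = a' t\<close> is \<open>(\<sigma> a' - a') t\<close> plus a multiple of
      \<open>t\<close> by two further steps: the first term gains one power by induction, the second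
      has two more powers of \<open>t\<close> than required of \<open>a'\<close> alone.\<close>
    have "\<sigma> a = \<sigma> a' \<otimes> (v \<otimes> t)" using a' \<sigma> v by (simp add: I_times)
    also have "\<dots> = \<sigma> a' \<otimes> t \<oplus> (w \<otimes> \<sigma> a') \<otimes> t \<otimes> t"
      using w(1) \<sigma>a' unfolding v_eq by (simp add: L.l_distr L.r_distr L.m_ac)
    finally have "\<sigma> a \<ominus> a = (\<sigma> a' \<ominus> a') \<otimes> t \<oplus> (w \<otimes> \<sigma> a') \<otimes> t \<otimes> t"
      using a' w \<sigma>a' by (simp add: a_minus_def L.l_distr L.l_minus L.a_ac)
    also have "\<dots> \<in> \<mm> (Suc (Suc i))"
      by (intro mm_add mmt Suc.IH a' mm_mult w \<sigma>a')
    finally show ?case .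
  qed
next
  assume R: "\<sigma> \<in> I \<and> (\<forall>i. \<forall>a\<in>\<mm> i. \<sigma> a \<ominus> a \<in> \<mm> (Suc i))"
  \<comment> \<open>The criterion is applied to \<open>t\<close> in degree 1; the quotient of
    \<sigma>(t) by \<open>t\<close> is then \<open>1 + w t\<close>.\<close>
  have "t \<in> \<mm> (Suc 0)" using A_one t by (force simp: mm_1)
  then have "\<sigma> t \<ominus> t \<in> \<mm> (Suc (Suc 0))" using R by blast
  then obtain w where w: "w \<in> A" "\<sigma> t \<ominus> t = w \<otimes> t \<otimes> t"
    by (auto simp: \<mm>_def L.m_assoc)
  have \<sigma>t: "\<sigma> t \<in> carrier L" using R by simp
  then have "\<sigma> t = t \<oplus> (\<sigma> t \<ominus> t)" by (simp add: L.add_minus_cancel)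
  also have "\<dots> = (\<one> \<oplus> w \<otimes> t) \<otimes> t" using w by (simp add: L.l_distr)
  finally have "\<sigma> t = (\<one> \<oplus> w \<otimes> t) \<otimes> t" .
  moreover have "(\<one> \<oplus> w \<otimes> t) \<ominus> \<iota> \<one>\<^bsub>k\<^esub> \<in> \<mm> (Suc 0)"
    using w t by (auto simp: mm_1 L.add_minus_cancel)
  ultimately have "is_character \<sigma> \<one>\<^bsub>k\<^esub>"
    using R w t by (intro is_characterI) (auto intro!: A_closed)
  then show "\<sigma> \<in> wild" using R by (simp add: wild_def)
qed

lemma wild_I: "wild \<subseteq> I" by (auto simp: wild_def)

text \<open>For products, \<open>\<sigma> (\<tau> a) - a = \<sigma> (\<tau> a - a) + (\<sigma> a -
  a)\<close>. For conjugates, put \<open>b\<close> for the image of \<open>a\<close> under the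
  inverse of \<sigma>; the difference is then \<open>\<sigma> (\<tau> b - b)\<close>. Both lie one
  step deeper because \<sigma> preserves the filtration.\<close>

lemma wild_normal: "wild \<lhd> G\<lparr>carrier := I\<rparr>"
proof -
  interpret I: group "G\<lparr>carrier := I\<rparr>"
    using subgroup.subgroup_is_group[OF I_subgroup G.group_axioms] .
  have "subgroup wild (G\<lparr>carrier := I\<rparr>)"
  proof (rule I.finite_submonoid_is_subgroup)
    show "finite wild" using finite_I wild_I finite_subset by blast
    show "wild \<subseteq> carrier (G\<lparr>carrier := I\<rparr>)" using wild_I by simp
    show "\<one>\<^bsub>G\<lparr>carrier := I\<rparr>\<^esub> \<in> wild"
      using I_one by (auto simp: wild_iff G_one_apply L.r_neg a_minus_def mm_zero)
    fix \<sigma> \<tau> assume \<sigma>: "\<sigma> \<in> wild" and \<tau>: "\<tau> \<in> wild"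
    have \<sigma>\<tau>: "\<sigma> \<in> I" "\<tau> \<in> I" using \<sigma> \<tau> wild_I by auto
    have "(\<sigma> \<otimes>\<^bsub>G\<^esub> \<tau>) a \<ominus> a \<in> \<mm> (Suc i)" if a: "a \<in> \<mm> i" for a i
    proof -
      have "(\<sigma> \<otimes>\<^bsub>G\<^esub> \<tau>) a \<ominus> a = \<sigma> (\<tau> a \<ominus> a) \<oplus> (\<sigma> a \<ominus> a)"
        using \<sigma>\<tau> mm_carrier[OF a]
        by (simp add: G_mult_apply I_minus L.add_minus_cancel)
      also have "\<dots> \<in> \<mm> (Suc i)"
        using \<sigma> \<tau> a by (intro mm_add I_mm[OF \<sigma>\<tau>(1)]) (auto simp: wild_iff)
      finally show ?thesis .
    qed
    then show "\<sigma> \<otimes>\<^bsub>G\<lparr>carrier := I\<rparr>\<^esub> \<tau> \<in> wild" using I_mult[OF \<sigma>\<tau>] by (simp add: wild_iff)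
  qed
  moreover have "\<sigma> \<otimes>\<^bsub>G\<lparr>carrier := I\<rparr>\<^esub> \<tau> \<otimes>\<^bsub>G\<lparr>carrier := I\<rparr>\<^esub> inv\<^bsub>G\<lparr>carrier := I\<rparr>\<^esub> \<sigma> \<in> wild"
    if \<sigma>: "\<sigma> \<in> carrier (G\<lparr>carrier := I\<rparr>)" and \<tau>: "\<tau> \<in> wild" for \<sigma> \<tau>
  proof -
    have inv: "inv\<^bsub>G\<lparr>carrier := I\<rparr>\<^esub> \<sigma> = inv\<^bsub>G\<^esub> \<sigma>"
      using G.m_inv_consistent[OF I_subgroup] \<sigma> by simp
    have I: "\<sigma> \<in> I" "\<tau> \<in> I" "inv\<^bsub>G\<^esub> \<sigma> \<in> I" "\<sigma> \<otimes>\<^bsub>G\<^esub> \<tau> \<in> I" "\<sigma> \<otimes>\<^bsub>G\<^esub> \<tau> \<otimes>\<^bsub>G\<^esub> inv\<^bsub>G\<^esub> \<sigma> \<in> I"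
      using \<sigma> \<tau> wild_I I_inv I_mult by auto
    have "(\<sigma> \<otimes>\<^bsub>G\<^esub> \<tau> \<otimes>\<^bsub>G\<^esub> inv\<^bsub>G\<^esub> \<sigma>) a \<ominus> a \<in> \<mm> (Suc i)" if a: "a \<in> \<mm> i" for a i
    proof -
      define b where "b = (inv\<^bsub>G\<^esub> \<sigma>) a"
      have b: "b \<in> \<mm> i" using I_mm[OF I(3) a] by (simp add: b_def)
      have "\<sigma> b = (\<sigma> \<otimes>\<^bsub>G\<^esub> inv\<^bsub>G\<^esub> \<sigma>) a" using I a by (simp add: b_def G_mult_apply)
      then have \<sigma>b: "\<sigma> b = a" using I a I_G by (simp add: G_one_apply subset_iff)
      have "(\<sigma> \<otimes>\<^bsub>G\<^esub> \<tau> \<otimes>\<^bsub>G\<^esub> inv\<^bsub>G\<^esub> \<sigma>) a \<ominus> a = \<sigma> (\<tau> b \<ominus> b)"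
        using I a b \<sigma>b mm_carrier[OF b] by (simp add: G_mult_apply I_minus b_def[symmetric])
      also have "\<dots> \<in> \<mm> (Suc i)" using \<tau> b by (intro I_mm[OF I(1)]) (auto simp: wild_iff)
      finally show ?thesis .
    qed
    then show ?thesis using I inv by (simp add: wild_iff)
  qed
  ultimately show ?thesis unfolding I.normal_inv_iff by blast
qed

text \<open>With \<open>b = \<sigma> a - a\<close> of depth \<open>i\<close>, the j-th power of
  \<sigma> sends \<open>a\<close> to \<open>a + j b\<close> modulo depth \<open>i + 1\<close>.
  Passing from \<open>j\<close> to \<open>j + 1\<close> applies \<sigma> to the previous error and
  adds \<open>j (\<sigma> b - b)\<close>, which is one step deeper because \<sigma> is wild.\<close>

lemma wild_pow:
  assumes \<sigma>: "\<sigma> \<in> wild" and a: "a \<in> carrier L" and b: "\<sigma> a \<ominus> a \<in> \<mm> i"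
  shows "\<sigma> [^]\<^bsub>G\<^esub> (j::nat) \<in> I \<and>
         (\<sigma> [^]\<^bsub>G\<^esub> j) a \<ominus> a \<ominus> add_pow L j (\<sigma> a \<ominus> a) \<in> \<mm> (Suc i)"
proof (induction j)
  case 0
  then show ?case using a b I_one by (simp add: G_one_apply a_minus_def L.r_neg mm_zero)
next
  case (Suc j)
  let ?b = "\<sigma> a \<ominus> a" and ?s = "\<sigma> [^]\<^bsub>G\<^esub> j"
  have \<sigma>I: "\<sigma> \<in> I" using \<sigma> wild_I by auto
  have s: "?s \<in> I" using Suc by simp
  have mult: "\<sigma> [^]\<^bsub>G\<^esub> Suc j = \<sigma> \<otimes>\<^bsub>G\<^esub> ?s"
    using \<sigma>I I_G G.nat_pow_Suc2 by blast
  have pow: "\<sigma> (add_pow L j x) = add_pow L j (\<sigma> x)" if "x \<in> carrier L" for x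
    using that \<sigma>I by (induction j) (auto simp: I_add I_zero)
  have powmm: "add_pow L j x \<in> \<mm> (Suc i)" if "x \<in> \<mm> (Suc i)" for x
    using that by (induction j) (auto simp: mm_zero mm_add)
  have bc: "?b \<in> carrier L" "\<sigma> a \<in> carrier L" "?s a \<in> carrier L" "\<sigma> ?b \<in> carrier L" "\<sigma> (?s a) \<in> carrier L"
    using a \<sigma>I s by simp_all
  have eq: "(\<sigma> [^]\<^bsub>G\<^esub> Suc j) a \<ominus> a \<ominus> add_pow L (Suc j) ?b =
     \<sigma> (?s a \<ominus> a \<ominus> add_pow L j ?b) \<oplus> add_pow L j (\<sigma> ?b \<ominus> ?b)"
  proof -
    have 1: "add_pow L j (\<sigma> ?b \<ominus> ?b) = add_pow L j (\<sigma> ?b) \<ominus> add_pow L j ?b"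
      using bc(1,4) L.add.nat_pow_distrib[of "\<sigma> ?b" "\<ominus> ?b" j] L.add.nat_pow_inv[of ?b j]
      by (simp add: a_minus_def)
    have 2: "\<sigma> (?s a \<ominus> a \<ominus> add_pow L j ?b) = \<sigma> (?s a) \<ominus> \<sigma> a \<ominus> add_pow L j (\<sigma> ?b)"
      using bc a \<sigma>I by (simp add: I_minus pow)
    have 3: "(\<sigma> [^]\<^bsub>G\<^esub> Suc j) a = \<sigma> (?s a)" unfolding mult using \<sigma>I s a by (simp add: G_mult_apply)
    define x where "x = add_pow L j ?b"
    define z where "z = add_pow L j (\<sigma> ?b)"
    have xz: "x \<in> carrier L" "z \<in> carrier L" using bc by (simp_all add: x_def z_def)
    have 4: "add_pow L (Suc j) ?b = x \<oplus> (\<sigma> a \<ominus> a)" by (simp add: x_def)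
    show ?thesis unfolding 1 2 3 4 unfolding x_def[symmetric] z_def[symmetric]
      using xz bc(2,5) a
      by (subst L.add_minus_cancel(3)) (simp_all add: a_minus_def L.minus_add L.a_ac L.r_neg1 L.r_neg2 L.l_neg L.r_neg)
  qed
  moreover have "\<sigma> ?b \<ominus> ?b \<in> \<mm> (Suc i)" using \<sigma> b by (auto simp: wild_iff)
  ultimately have "(\<sigma> [^]\<^bsub>G\<^esub> Suc j) a \<ominus> a \<ominus> add_pow L (Suc j) ?b \<in> \<mm> (Suc i)"
    using Suc by (simp only: eq) (intro mm_add I_mm[OF \<sigma>I] powmm, auto)
  then show ?case using I_mult[OF \<sigma>I s] mult by simp
qed

lemma wild_no_torsion:
  assumes \<sigma>: "\<sigma> \<in> wild" and l: "\<sigma> [^]\<^bsub>G\<^esub> (l::nat) = \<one>\<^bsub>G\<^esub>" and unit: "add_pow k l \<one>\<^bsub>k\<^esub> \<in> Units k"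
  shows "\<sigma> = \<one>\<^bsub>G\<^esub>"
proof -
  have \<sigma>I: "\<sigma> \<in> I" using \<sigma> wild_I by auto
  \<comment> \<open>The inverse of the integer \<open>l\<close>, available in A because A contains
    the constants.\<close>
  define u where "u = \<iota> (inv\<^bsub>k\<^esub> (add_pow k l \<one>\<^bsub>k\<^esub>))"
  have uA: "u \<in> A" using unit by (auto simp: u_def intro!: \<iota>_A)
  have pow: "add_pow L l x = \<iota> (add_pow k l \<one>\<^bsub>k\<^esub>) \<otimes> x" if "x \<in> carrier L" for x
    using that by (induction l) (auto simp: L.l_distr)
  have u: "u \<otimes> add_pow L l x = x" if "x \<in> carrier L" for x
  proof -
    have "u \<otimes> \<iota> (add_pow k l \<one>\<^bsub>k\<^esub>) = \<one>"
      using unit by (metis \<iota>.hom_mult \<iota>.hom_one k.Units_inv_closed k.Units_l_inv k.Units_closed u_def)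
    then show ?thesis using that uA by (simp add: pow L.m_assoc[symmetric])
  qed
  have fix_A: "\<sigma> a = a" if a: "a \<in> A" for a
  proof -
    let ?b = "\<sigma> a \<ominus> a"
    have aL: "a \<in> carrier L" and bL: "?b \<in> carrier L" using a \<sigma>I by simp_all
    have "?b \<in> \<mm> i" for i
    proof (induction i)
      case 0
      then show ?case using a I_A[OF \<sigma>I] by (simp add: mm_0 A_minus)
    next
      \<comment> \<open>As the l-th power of \<sigma> is trivial, the estimate of
        \<open>wild_pow\<close> says that \<open>l\<close> times the difference has depth
        \<open>i + 1\<close>; multiplying by \<open>u\<close> removes the factor
        \<open>l\<close>.\<close>
      case (Suc i)
      have "\<one>\<^bsub>G\<^esub> a \<ominus> a \<ominus> add_pow L l ?b \<in> \<mm> (Suc i)"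
        using wild_pow[OF \<sigma> aL Suc, of l] l by simp
      then have "\<ominus> add_pow L l ?b \<in> \<mm> (Suc i)"
        using aL bL by (simp add: G_one_apply a_minus_def L.r_neg)
      then have "add_pow L l ?b \<in> \<mm> (Suc i)"
        using mm_uminus[of "\<ominus> add_pow L l ?b"] bL by simp
      then have "u \<otimes> add_pow L l ?b \<in> \<mm> (Suc i)" by (rule mm_mult[OF uA])
      then show ?case using u[OF bL] by simp
    qed
    then have "?b = \<zero>" by (intro separated) (auto simp: \<mm>_def)
    then show ?thesis using aL \<sigma>I by (simp add: L.r_right_minus_eq)
  qed
  \<comment> \<open>Fixing A pointwise, \<sigma> fixes all fractions, hence L; outside L both maps
    are \<open>undefined\<close>.\<close>
  show ?thesis
  proof (rule extensionalityI[of _ "carrier L"])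
    show "\<sigma> \<in> extensional (carrier L)" using \<sigma>I I_G galois_groupD(2) by blast
    show "\<one>\<^bsub>G\<^esub> \<in> extensional (carrier L)" by (simp add: galois_group_one)
    fix x assume x: "x \<in> carrier L"
    then obtain a b where ab: "a \<in> A" "b \<in> A" "b \<noteq> \<zero>" "x \<otimes> b = a"
      using fractions by blast
    have "\<sigma> x \<otimes> \<sigma> b = \<sigma> a" using I_times[OF \<sigma>I x, of b] ab by simp
    then have "\<sigma> x \<otimes> b = x \<otimes> b" using ab fix_A by simp
    then show "\<sigma> x = \<one>\<^bsub>G\<^esub> x" using L.m_rcancel[OF ab(3), of "\<sigma> x" x] x ab(2) \<sigma>I by (simp add: G_one_apply)
  qed
qed

text \<open>A common prime \<open>l\<close> of \<open>card wild\<close> and \<open>n\<close> would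
  give a nontrivial wild element whose l-th power is 1. But \<open>l\<close> divides
  \<open>n\<close>, so it is invertible in \<open>k\<close>, against
  \<open>wild_no_torsion\<close>.\<close>

lemma card_wild_coprime:
  assumes n: "add_pow k n \<one>\<^bsub>k\<^esub> \<in> Units k"
  shows "coprime (card wild) n"
proof (rule ccontr)
  assume "\<not> coprime (card wild) n"
  then obtain l where l: "Factorial_Ring.prime l" "l dvd card wild" "l dvd n"
    using prime_factor_nat[of "gcd (card wild) n"] by (auto simp: coprime_iff_gcd_eq_1)
  interpret I: group "G\<lparr>carrier := I\<rparr>"
    using subgroup.subgroup_is_group[OF I_subgroup G.group_axioms] .
  have sub: "subgroup wild (G\<lparr>carrier := I\<rparr>)"
    using wild_normal by (simp add: I.normal_inv_iff)
  interpret W: group "G\<lparr>carrier := I, carrier := wild\<rparr>"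
    using subgroup.subgroup_is_group[OF sub I.group_axioms] by simp
  have "finite wild" using finite_I wild_I finite_subset by blast
  then obtain \<sigma> where \<sigma>: "\<sigma> \<in> wild" "\<sigma> \<noteq> \<one>\<^bsub>G\<^esub>" "\<sigma> [^]\<^bsub>G\<lparr>carrier := wild\<rparr>\<^esub> l = \<one>\<^bsub>G\<^esub>"
    using W.exists_element_of_prime_order[OF _ l(1)] l(2) by (auto simp: order_def)
  have "add_pow k l \<one>\<^bsub>k\<^esub> \<in> Units k"
  proof -
    obtain m where m: "n = l * m" using l(3) by auto
    have "add_pow k n \<one>\<^bsub>k\<^esub> = add_pow k m (add_pow k l \<one>\<^bsub>k\<^esub>)"
      by (simp add: m k.add.nat_pow_pow mult.commute)
    then have "add_pow k l \<one>\<^bsub>k\<^esub> \<noteq> \<zero>\<^bsub>k\<^esub>" using n by (auto simp: k.field_Units)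
    then show ?thesis by (simp add: k.field_Units)
  qed
  moreover have "\<sigma> [^]\<^bsub>G\<^esub> l = \<one>\<^bsub>G\<^esub>" using \<sigma>(3) by (simp add: G.nat_pow_consistent[symmetric])
  ultimately show False using wild_no_torsion[OF \<sigma>(1)] \<sigma>(2) by blast
qed

end


section \<open>Rings of germs: well-defined operations and functoriality\<close>

section \<open>Germs\<close>

locale ringed =
  fixes Z :: "('x, 's, 'z) ringed_space_scheme"
  assumes ringed: "ringed_space Z"
begin

lemma sections_cring: "open_in Z U \<Longrightarrow> cring (sections Z U)"
  using ringed by (simp add: ringed_space_def)

lemma restr_hom: "open_in Z U \<Longrightarrow> open_in Z V \<Longrightarrow> V \<subseteq> U \<Longrightarrow>
    restr Z U V \<in> ring_hom (sections Z U) (sections Z V)"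
  using ringed by (simp add: ringed_space_def)

lemma restr_id: "open_in Z U \<Longrightarrow> a \<in> carrier (sections Z U) \<Longrightarrow> restr Z U U a = a"
  using ringed by (simp add: ringed_space_def)

lemma restr_restr: "open_in Z U \<Longrightarrow> open_in Z V \<Longrightarrow> open_in Z W \<Longrightarrow> W \<subseteq> V \<Longrightarrow> V \<subseteq> U \<Longrightarrow>
    a \<in> carrier (sections Z U) \<Longrightarrow> restr Z V W (restr Z U V a) = restr Z U W a"
  by (rule ringed[unfolded ringed_space_def, THEN conjunct2, THEN conjunct2, THEN conjunct2, THEN conjunct1, rule_format])

lemma sections_eqI:
  assumes "\<And>U. U \<in> \<U> \<Longrightarrow> open_in Z U" "a \<in> carrier (sections Z (\<Union>\<U>))" "b \<in> carrier (sections Z (\<Union>\<U>))"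
    and "\<And>U. U \<in> \<U> \<Longrightarrow> restr Z (\<Union>\<U>) U a = restr Z (\<Union>\<U>) U b"
  shows "a = b"
  by (rule ringed[unfolded ringed_space_def, THEN conjunct2, THEN conjunct2, THEN conjunct2, THEN conjunct2, THEN conjunct1, rule_format, of \<U>])
    (use assms in auto)

lemma sections_glue:
  assumes "\<And>U. U \<in> \<U> \<Longrightarrow> open_in Z U" "\<And>U. U \<in> \<U> \<Longrightarrow> a U \<in> carrier (sections Z U)"
    and "\<And>U V. U \<in> \<U> \<Longrightarrow> V \<in> \<U> \<Longrightarrow> restr Z U (U \<inter> V) (a U) = restr Z V (U \<inter> V) (a V)"
  shows "\<exists>b\<in>carrier (sections Z (\<Union>\<U>)). \<forall>U\<in>\<U>. restr Z (\<Union>\<U>) U b = a U"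
  by (rule ringed[unfolded ringed_space_def, THEN conjunct2, THEN conjunct2, THEN conjunct2, THEN conjunct2, THEN conjunct2, rule_format, of \<U> a])
    (use assms in auto)

lemma restr_closed: "open_in Z U \<Longrightarrow> open_in Z V \<Longrightarrow> V \<subseteq> U \<Longrightarrow> a \<in> carrier (sections Z U) \<Longrightarrow>
    restr Z U V a \<in> carrier (sections Z V)"
  using ring_hom_closed[OF restr_hom] .

lemma restr_zero: "open_in Z U \<Longrightarrow> open_in Z V \<Longrightarrow> V \<subseteq> U \<Longrightarrow>
    restr Z U V \<zero>\<^bsub>sections Z U\<^esub> = \<zero>\<^bsub>sections Z V\<^esub>"
  using restr_hom ring_hom_zero cring.axioms(1) sections_cring by metis

lemma open_subset: "open_in Z U \<Longrightarrow> U \<subseteq> points Z"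
  by (rule openin_subset)

end

text \<open>Operations on germs are unions over all representatives; such a union collapses once its
  members are known to agree.\<close>

lemma UN_constant: "T \<noteq> {} \<Longrightarrow> (\<And>x. x \<in> T \<Longrightarrow> f x = c) \<Longrightarrow> \<Union> (f ` T) = c"
  by auto

text \<open>One treatment for stalks and function fields: N consists of the neighbourhoods of a
  point or of all nonempty opens. In the second case \<open>N_Int\<close> is irreducibility.\<close>

locale germs = ringed Z for Z :: "('x, 's, 'z) ringed_space_scheme" +
  fixes N :: "'x set set"
  assumes N_open: "U \<in> N \<Longrightarrow> open_in Z U" and N_Int: "U \<in> N \<Longrightarrow> V \<in> N \<Longrightarrow> U \<inter> V \<in> N"
    and N_points: "points Z \<in> N"
begin

abbreviation "GR \<equiv> germ_ring Z N"

lemma germ_rel_iff: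
  "((U, a), (V, b)) \<in> germ_rel Z N \<longleftrightarrow>
     U \<in> N \<and> V \<in> N \<and> a \<in> carrier (sections Z U) \<and> b \<in> carrier (sections Z V) \<and>
     (\<exists>W\<in>N. W \<subseteq> U \<and> W \<subseteq> V \<and> restr Z U W a = restr Z V W b)"
  by (auto simp: germ_rel_def)

lemma germ_rel_refl:
  assumes "U \<in> N" "a \<in> carrier (sections Z U)" shows "((U, a), (U, a)) \<in> germ_rel Z N"
  unfolding germ_rel_iff using assms by blast

lemma germ_rel_sym:
  assumes "((U, a), (V, b)) \<in> germ_rel Z N" shows "((V, b), (U, a)) \<in> germ_rel Z N"
proof -
  obtain W where "W \<in> N" "W \<subseteq> U" "W \<subseteq> V" "restr Z U W a = restr Z V W b"
    using assms unfolding germ_rel_iff by blast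
  then have "\<exists>W\<in>N. W \<subseteq> V \<and> W \<subseteq> U \<and> restr Z V W b = restr Z U W a"
    by (intro bexI[of _ W]) simp_all
  then show ?thesis using assms unfolding germ_rel_iff by blast
qed

lemma germ_rel_trans:
  assumes "((U, a), (V, b)) \<in> germ_rel Z N" "((V, b), (W, c)) \<in> germ_rel Z N"
  shows "((U, a), (W, c)) \<in> germ_rel Z N"
proof -
  obtain T Y where XY: "T \<in> N" "Y \<in> N" "T \<subseteq> U" "T \<subseteq> V" "Y \<subseteq> V" "Y \<subseteq> W"
    "restr Z U T a = restr Z V T b" "restr Z V Y b = restr Z W Y c"
    and N: "U \<in> N" "V \<in> N" "W \<in> N" and ab: "a \<in> carrier (sections Z U)" "b \<in> carrier (sections Z V)" "c \<in> carrier (sections Z W)"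
    using assms by (auto simp: germ_rel_iff)
  note o = N_open[OF XY(1)] N_open[OF XY(2)] N_open[OF N(1)] N_open[OF N(2)] N_open[OF N(3)] N_open[OF N_Int[OF XY(1,2)]]
  have "restr Z U (T \<inter> Y) a = restr Z T (T \<inter> Y) (restr Z U T a)"
    using o XY ab by (intro restr_restr[symmetric]) auto
  also have "\<dots> = restr Z V (T \<inter> Y) b" unfolding XY(7) using o XY ab by (intro restr_restr) auto
  also have "\<dots> = restr Z Y (T \<inter> Y) (restr Z V Y b)"
    using o XY ab by (intro restr_restr[symmetric]) auto
  also have "\<dots> = restr Z W (T \<inter> Y) c" unfolding XY(8) using o XY ab by (intro restr_restr) auto
  finally show ?thesis using N ab XY N_Int[OF XY(1,2)] by (auto simp: germ_rel_iff intro!: bexI[of _ "T \<inter> Y"])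
qed

lemma germ_eq_rel:
  assumes "U \<in> N" "a \<in> carrier (sections Z U)"
  shows "germ Z N U a = germ Z N V b \<longleftrightarrow> ((U, a), (V, b)) \<in> germ_rel Z N"
proof
  assume "germ Z N U a = germ Z N V b"
  moreover have "(U, a) \<in> germ Z N U a" using germ_rel_refl[OF assms] by (simp add: germ_def)
  ultimately show "((U, a), (V, b)) \<in> germ_rel Z N" using germ_rel_sym by (auto simp: germ_def)
next
  assume *: "((U, a), (V, b)) \<in> germ_rel Z N"
  show "germ Z N U a = germ Z N V b"
    using germ_rel_trans[OF *] germ_rel_trans[OF germ_rel_sym[OF *]] by (auto simp: germ_def)
qed

lemma germ_eq_iff:
  assumes "U \<in> N" "V \<in> N" "a \<in> carrier (sections Z U)" "b \<in> carrier (sections Z V)"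
  shows "germ Z N U a = germ Z N V b \<longleftrightarrow>
           (\<exists>W\<in>N. W \<subseteq> U \<and> W \<subseteq> V \<and> restr Z U W a = restr Z V W b)"
  using assms by (simp only: germ_eq_rel[OF assms(1,3)] germ_rel_iff) simp

lemma mem_germ_iff:
  assumes "U \<in> N" "a \<in> carrier (sections Z U)"
  shows "(V, b) \<in> germ Z N U a \<longleftrightarrow> V \<in> N \<and> b \<in> carrier (sections Z V) \<and> germ Z N V b = germ Z N U a"
proof -
  have "(V, b) \<in> germ Z N U a \<longleftrightarrow> ((U, a), (V, b)) \<in> germ_rel Z N"
    by (simp add: germ_def)
  moreover have "((U, a), (V, b)) \<in> germ_rel Z N \<Longrightarrow> V \<in> N \<and> b \<in> carrier (sections Z V)"
    by (simp add: germ_rel_iff)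
  ultimately show ?thesis unfolding germ_eq_rel[OF assms, symmetric] by metis
qed

lemma germ_restr:
  assumes "U \<in> N" "V \<in> N" "V \<subseteq> U" "a \<in> carrier (sections Z U)"
  shows "germ Z N V (restr Z U V a) = germ Z N U a"
proof -
  note o = N_open[OF assms(1)] N_open[OF assms(2)]
  have "restr Z V V (restr Z U V a) = restr Z U V a"
    by (rule restr_id[OF o(2) restr_closed[OF o assms(3,4)]])
  then show ?thesis
    unfolding germ_eq_iff[OF assms(2,1) restr_closed[OF o assms(3,4)] assms(4)]
    using assms by blast
qed

lemma germ_closed: "U \<in> N \<Longrightarrow> a \<in> carrier (sections Z U) \<Longrightarrow> germ Z N U a \<in> carrier GR"
  by (auto simp: germ_ring_def)

lemma germ_cases:
  assumes "A \<in> carrier GR"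
  obtains U a where "U \<in> N" "a \<in> carrier (sections Z U)" "A = germ Z N U a"
  using assms unfolding germ_ring_def by auto

lemma UN_germ:
  assumes "U \<in> N" "a \<in> carrier (sections Z U)"
    and "\<And>V b. V \<in> N \<Longrightarrow> b \<in> carrier (sections Z V) \<Longrightarrow> germ Z N V b = germ Z N U a \<Longrightarrow> g V b = g U a"
  shows "(\<Union>(V, b)\<in>germ Z N U a. g V b) = g U a"
proof (rule UN_constant)
  show "germ Z N U a \<noteq> {}" using mem_germ_iff[OF assms(1,2)] assms(1,2) by blast
  show "(case x of (V, b) \<Rightarrow> g V b) = g U a" if "x \<in> germ Z N U a" for x
  proof -
    obtain V b where x: "x = (V, b)" by (cases x)
    then show ?thesis using that assms(3)[of V b] mem_germ_iff[OF assms(1,2), of V b] by simp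
  qed
qed

text \<open>Independence of representatives, once for addition and multiplication: \<open>f\<close>
  is any operation that commutes with restriction. The result may be computed on any smaller member
  of N, so two pairs of representatives are compared on a common one.\<close>

lemma germ_op:
  assumes op_closed: "\<And>U a b. open_in Z U \<Longrightarrow> a \<in> carrier (sections Z U) \<Longrightarrow> b \<in> carrier (sections Z U) \<Longrightarrow>
      f U a b \<in> carrier (sections Z U)"
    and op_restr: "\<And>U V a b. open_in Z U \<Longrightarrow> open_in Z V \<Longrightarrow> V \<subseteq> U \<Longrightarrow> a \<in> carrier (sections Z U) \<Longrightarrow>
      b \<in> carrier (sections Z U) \<Longrightarrow> restr Z U V (f U a b) = f V (restr Z U V a) (restr Z U V b)"
    and U: "U \<in> N" "a \<in> carrier (sections Z U)" and V: "V \<in> N" "b \<in> carrier (sections Z V)"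
  shows "(\<Union>(U, a)\<in>germ Z N U a. \<Union>(V, b)\<in>germ Z N V b.
            germ Z N (U \<inter> V) (f (U \<inter> V) (restr Z U (U \<inter> V) a) (restr Z V (U \<inter> V) b)))
         = germ Z N (U \<inter> V) (f (U \<inter> V) (restr Z U (U \<inter> V) a) (restr Z V (U \<inter> V) b))"
proof -
  let ?g = "\<lambda>U a V b. germ Z N (U \<inter> V) (f (U \<inter> V) (restr Z U (U \<inter> V) a) (restr Z V (U \<inter> V) b))"
  have shrink: "?g U a V b = germ Z N W (f W (restr Z U W a) (restr Z V W b))"
    if "U \<in> N" "a \<in> carrier (sections Z U)" "V \<in> N" "b \<in> carrier (sections Z V)" "W \<in> N" "W \<subseteq> U \<inter> V"
    for U a V b W
  proof -
    note UV = N_Int[OF that(1,3)]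
    note o = N_open[OF that(1)] N_open[OF that(3)] N_open[OF that(5)] N_open[OF UV]
    have sub: "U \<inter> V \<subseteq> U" "U \<inter> V \<subseteq> V" by auto
    note a = restr_closed[OF o(1,4) sub(1) that(2)] and b = restr_closed[OF o(2,4) sub(2) that(4)]
    have "germ Z N W (restr Z (U \<inter> V) W (f (U \<inter> V) (restr Z U (U \<inter> V) a) (restr Z V (U \<inter> V) b))) = ?g U a V b"
      by (rule germ_restr[OF UV that(5,6) op_closed[OF o(4) a b]])
    moreover have "restr Z (U \<inter> V) W (f (U \<inter> V) (restr Z U (U \<inter> V) a) (restr Z V (U \<inter> V) b)) =
        f W (restr Z U W a) (restr Z V W b)"
      unfolding op_restr[OF o(4,3) that(6) a b] restr_restr[OF o(1,4,3) that(6) sub(1) that(2)]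
        restr_restr[OF o(2,4,3) that(6) sub(2) that(4)] ..
    ultimately show ?thesis by simp
  qed
  have cong: "?g U a V b = ?g U' a' V' b'"
    if U: "U \<in> N" "a \<in> carrier (sections Z U)" and V: "V \<in> N" "b \<in> carrier (sections Z V)"
      and U': "U' \<in> N" "a' \<in> carrier (sections Z U')" and V': "V' \<in> N" "b' \<in> carrier (sections Z V')"
      and eq: "germ Z N U a = germ Z N U' a'" "germ Z N V b = germ Z N V' b'"
    for U a V b U' a' V' b'
  proof -
    obtain W where W: "W \<in> N" "W \<subseteq> U" "W \<subseteq> U'" "restr Z U W a = restr Z U' W a'"
      using eq(1) germ_eq_iff[OF U(1) U'(1) U(2) U'(2)] by auto
    obtain T where T: "T \<in> N" "T \<subseteq> V" "T \<subseteq> V'" "restr Z V T b = restr Z V' T b'"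
      using eq(2) germ_eq_iff[OF V(1) V'(1) V(2) V'(2)] by auto
    note o = N_open[OF W(1)] N_open[OF T(1)] N_open[OF U(1)] N_open[OF V(1)] N_open[OF U'(1)] N_open[OF V'(1)]
      N_open[OF N_Int[OF W(1) T(1)]]
    have "restr Z U (W \<inter> T) a = restr Z U' (W \<inter> T) a'"
      using restr_restr[OF o(3,1,7) _ W(2) U(2)] restr_restr[OF o(5,1,7) _ W(3) U'(2)] W(4) by simp
    moreover have "restr Z V (W \<inter> T) b = restr Z V' (W \<inter> T) b'"
      using restr_restr[OF o(4,2,7) _ T(2) V(2)] restr_restr[OF o(6,2,7) _ T(3) V'(2)] T(4) by simp
    ultimately show ?thesis
      using shrink[OF U V N_Int[OF W(1) T(1)]] shrink[OF U' V' N_Int[OF W(1) T(1)]] W(2,3) T(2,3)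
      by (metis Int_mono)
  qed
  have inner: "(\<Union>(V, b)\<in>germ Z N V b. ?g U' a' V b) = ?g U a V b"
    if "U' \<in> N" "a' \<in> carrier (sections Z U')" "germ Z N U' a' = germ Z N U a" for U' a'
  proof -
    have "(\<Union>(V, b)\<in>germ Z N V b. ?g U' a' V b) = ?g U' a' V b"
      by (rule UN_germ[OF V, of "\<lambda>V b. ?g U' a' V b"])
        (rule cong[OF that(1,2) _ _ that(1,2) V refl]; assumption)
    also have "\<dots> = ?g U a V b" by (rule cong[OF that(1,2) V U V that(3) refl])
    finally show ?thesis .
  qed
  have "(\<Union>(U, a)\<in>germ Z N U a. \<Union>(V, b)\<in>germ Z N V b. ?g U a V b) =
      (\<Union>(V, b)\<in>germ Z N V b. ?g U a V b)"
    by (rule UN_germ[OF U, of "\<lambda>U a. \<Union>(V, b)\<in>germ Z N V b. ?g U a V b"])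
      (rule trans[OF inner inner[OF U refl, symmetric]]; assumption)
  also have "\<dots> = ?g U a V b" by (rule inner[OF U refl])
  finally show ?thesis .
qed

lemma germ_mult:
  assumes "U \<in> N" "a \<in> carrier (sections Z U)" "V \<in> N" "b \<in> carrier (sections Z V)"
  shows "germ Z N U a \<otimes>\<^bsub>GR\<^esub> germ Z N V b =
     germ Z N (U \<inter> V) (restr Z U (U \<inter> V) a \<otimes>\<^bsub>sections Z (U \<inter> V)\<^esub> restr Z V (U \<inter> V) b)"
proof -
  have "germ Z N U a \<otimes>\<^bsub>GR\<^esub> germ Z N V b = (\<Union>(U, a)\<in>germ Z N U a. \<Union>(V, b)\<in>germ Z N V b.
      germ Z N (U \<inter> V) (restr Z U (U \<inter> V) a \<otimes>\<^bsub>sections Z (U \<inter> V)\<^esub> restr Z V (U \<inter> V) b))"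
    by (simp add: germ_ring_def)
  also have "\<dots> = germ Z N (U \<inter> V) (restr Z U (U \<inter> V) a \<otimes>\<^bsub>sections Z (U \<inter> V)\<^esub> restr Z V (U \<inter> V) b)"
    by (rule germ_op[of "\<lambda>U. monoid.mult (sections Z U)", OF _ _ assms])
      (auto intro: cring.cring_simprules(5) sections_cring ring_hom_mult[OF restr_hom])
  finally show ?thesis .
qed

lemma germ_add:
  assumes "U \<in> N" "a \<in> carrier (sections Z U)" "V \<in> N" "b \<in> carrier (sections Z V)"
  shows "germ Z N U a \<oplus>\<^bsub>GR\<^esub> germ Z N V b =
     germ Z N (U \<inter> V) (restr Z U (U \<inter> V) a \<oplus>\<^bsub>sections Z (U \<inter> V)\<^esub> restr Z V (U \<inter> V) b)"
proof -
  have "germ Z N U a \<oplus>\<^bsub>GR\<^esub> germ Z N V b = (\<Union>(U, a)\<in>germ Z N U a. \<Union>(V, b)\<in>germ Z N V b.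
      germ Z N (U \<inter> V) (restr Z U (U \<inter> V) a \<oplus>\<^bsub>sections Z (U \<inter> V)\<^esub> restr Z V (U \<inter> V) b))"
    by (simp add: germ_ring_def)
  also have "\<dots> = germ Z N (U \<inter> V) (restr Z U (U \<inter> V) a \<oplus>\<^bsub>sections Z (U \<inter> V)\<^esub> restr Z V (U \<inter> V) b)"
    by (rule germ_op[of "\<lambda>U. ring.add (sections Z U)", OF _ _ assms])
      (auto intro: cring.cring_simprules(1) sections_cring ring_hom_add[OF restr_hom])
  finally show ?thesis .
qed

lemma germ_one:
  assumes "U \<in> N" shows "\<one>\<^bsub>GR\<^esub> = germ Z N U \<one>\<^bsub>sections Z U\<^esub>"
proof -
  note o = N_open[OF N_points] N_open[OF assms] open_subset[OF N_open[OF assms]]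
  have "\<one>\<^bsub>GR\<^esub> = germ Z N (points Z) \<one>\<^bsub>sections Z (points Z)\<^esub>"
    by (simp add: germ_ring_def)
  also have "\<dots> = germ Z N U (restr Z (points Z) U \<one>\<^bsub>sections Z (points Z)\<^esub>)"
    by (rule germ_restr[OF N_points assms o(3) cring.cring_simprules(6)[OF sections_cring[OF o(1)]], symmetric])
  also have "restr Z (points Z) U \<one>\<^bsub>sections Z (points Z)\<^esub> = \<one>\<^bsub>sections Z U\<^esub>"
    by (rule ring_hom_one[OF restr_hom[OF o]])
  finally show ?thesis .
qed

lemma germ_zero:
  assumes "U \<in> N" shows "\<zero>\<^bsub>GR\<^esub> = germ Z N U \<zero>\<^bsub>sections Z U\<^esub>"
proof -
  note o = N_open[OF N_points] N_open[OF assms] open_subset[OF N_open[OF assms]]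
  have "\<zero>\<^bsub>GR\<^esub> = germ Z N (points Z) \<zero>\<^bsub>sections Z (points Z)\<^esub>"
    by (simp add: germ_ring_def)
  also have "\<dots> = germ Z N U (restr Z (points Z) U \<zero>\<^bsub>sections Z (points Z)\<^esub>)"
    by (rule germ_restr[OF N_points assms o(3) cring.cring_simprules(2)[OF sections_cring[OF o(1)]], symmetric])
  also have "restr Z (points Z) U \<zero>\<^bsub>sections Z (points Z)\<^esub> = \<zero>\<^bsub>sections Z U\<^esub>"
    by (rule restr_zero[OF o])
  finally show ?thesis .
qed

lemma germ_hom:
  assumes "U \<in> N" shows "germ Z N U \<in> ring_hom (sections Z U) GR"
proof (rule ring_hom_memI)
  fix a b assume ab: "a \<in> carrier (sections Z U)" "b \<in> carrier (sections Z U)"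
  show "germ Z N U (a \<otimes>\<^bsub>sections Z U\<^esub> b) = germ Z N U a \<otimes>\<^bsub>GR\<^esub> germ Z N U b"
    using germ_mult[OF assms ab(1) assms ab(2)] ab assms by (simp add: restr_id N_open)
  show "germ Z N U (a \<oplus>\<^bsub>sections Z U\<^esub> b) = germ Z N U a \<oplus>\<^bsub>GR\<^esub> germ Z N U b"
    using germ_add[OF assms ab(1) assms ab(2)] ab assms by (simp add: restr_id N_open)
qed (use assms germ_closed germ_one in auto)

end

lemma (in ringed) germs_nbhds: "x \<in> points Z \<Longrightarrow> germs Z (nbhds Z x)"
  by (rule germs.intro[OF ringed_axioms], rule germs_axioms.intro) (auto simp: nbhds_def)

text \<open>Covers both pullback of germs along a morphism, where \<open>u\<close> takes preimages,
  and the passage from the stalk to the function field, where \<open>u\<close> and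
  \<open>\<Phi>\<close> are identities but the index family grows.\<close>

locale germs_map = dom: germs Z N + cod: germs Y N'
  for Z :: "('x, 's, 'z) ringed_space_scheme" and N and Y :: "('y, 'r, 'w) ringed_space_scheme" and N' +
  fixes u :: "'x set \<Rightarrow> 'y set" and \<Phi> :: "'x set \<Rightarrow> 's \<Rightarrow> 'r"
  assumes u_N: "U \<in> N \<Longrightarrow> u U \<in> N'" and u_Int: "U \<in> N \<Longrightarrow> V \<in> N \<Longrightarrow> u (U \<inter> V) = u U \<inter> u V"
    and \<Phi>_hom: "U \<in> N \<Longrightarrow> \<Phi> U \<in> ring_hom (sections Z U) (sections Y (u U))"
    and \<Phi>_restr: "U \<in> N \<Longrightarrow> V \<in> N \<Longrightarrow> V \<subseteq> U \<Longrightarrow> a \<in> carrier (sections Z U) \<Longrightarrow>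
       \<Phi> V (restr Z U V a) = restr Y (u U) (u V) (\<Phi> U a)"
begin

definition induced where
  "induced A = (\<Union>(U, a)\<in>A. germ Y N' (u U) (\<Phi> U a))"

lemma \<Phi>_closed: "U \<in> N \<Longrightarrow> a \<in> carrier (sections Z U) \<Longrightarrow> \<Phi> U a \<in> carrier (sections Y (u U))"
  using ring_hom_closed[OF \<Phi>_hom] .

lemma u_mono: "U \<in> N \<Longrightarrow> V \<in> N \<Longrightarrow> V \<subseteq> U \<Longrightarrow> u V \<subseteq> u U"
  using u_Int[of U V] by (simp add: Int_absorb1) blast

lemma \<Phi>_shrink:
  assumes "U \<in> N" "W \<in> N" "W \<subseteq> U" "a \<in> carrier (sections Z U)"
  shows "germ Y N' (u W) (\<Phi> W (restr Z U W a)) = germ Y N' (u U) (\<Phi> U a)"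
  unfolding \<Phi>_restr[OF assms]
  by (rule cod.germ_restr[OF u_N[OF assms(1)] u_N[OF assms(2)] u_mono[OF assms(1-3)] \<Phi>_closed[OF assms(1,4)]])

lemma induced_germ:
  assumes "U \<in> N" "a \<in> carrier (sections Z U)"
  shows "induced (germ Z N U a) = germ Y N' (u U) (\<Phi> U a)"
  unfolding induced_def
proof (rule dom.UN_germ[OF assms])
  fix V b assume V: "V \<in> N" "b \<in> carrier (sections Z V)" "germ Z N V b = germ Z N U a"
  then obtain W where W: "W \<in> N" "W \<subseteq> V" "W \<subseteq> U" "restr Z V W b = restr Z U W a"
    using assms by (auto simp: dom.germ_eq_iff)
  then show "germ Y N' (u V) (\<Phi> V b) = germ Y N' (u U) (\<Phi> U a)"
    using \<Phi>_shrink[OF V(1) W(1,2) V(2)] \<Phi>_shrink[OF assms(1) W(1,3) assms(2)] by simp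
qed

lemma induced_hom: "induced \<in> ring_hom (germ_ring Z N) (germ_ring Y N')"
proof (rule ring_hom_memI)
  fix A assume "A \<in> carrier (germ_ring Z N)"
  then obtain U a where Ua: "U \<in> N" "a \<in> carrier (sections Z U)" "A = germ Z N U a" by (rule dom.germ_cases)
  then show "induced A \<in> carrier (germ_ring Y N')"
    by (simp add: induced_germ cod.germ_closed u_N \<Phi>_closed)
  fix B assume "B \<in> carrier (germ_ring Z N)"
  then obtain V b where Vb: "V \<in> N" "b \<in> carrier (sections Z V)" "B = germ Z N V b" by (rule dom.germ_cases)
  note o = Ua Vb dom.N_Int[OF Ua(1) Vb(1)] dom.N_open[OF Ua(1)] dom.N_open[OF Vb(1)]
    dom.N_open[OF dom.N_Int[OF Ua(1) Vb(1)]]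
  have ra: "restr Z U (U \<inter> V) a \<in> carrier (sections Z (U \<inter> V))"
    and rb: "restr Z V (U \<inter> V) b \<in> carrier (sections Z (U \<inter> V))"
    using o by (auto intro: dom.restr_closed)
  note cr = dom.sections_cring[OF o(10)]
  show "induced (A \<otimes>\<^bsub>germ_ring Z N\<^esub> B) = induced A \<otimes>\<^bsub>germ_ring Y N'\<^esub> induced B"
    using o ra rb
    by (simp add: dom.germ_mult induced_germ cod.germ_mult u_N \<Phi>_closed u_Int[symmetric]
        cring.cring_simprules(5)[OF cr] ring_hom_mult[OF \<Phi>_hom] \<Phi>_restr)
  show "induced (A \<oplus>\<^bsub>germ_ring Z N\<^esub> B) = induced A \<oplus>\<^bsub>germ_ring Y N'\<^esub> induced B"
    using o ra rb
    by (simp add: dom.germ_add induced_germ cod.germ_add u_N \<Phi>_closed u_Int[symmetric]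
        cring.cring_simprules(1)[OF cr] ring_hom_add[OF \<Phi>_hom] \<Phi>_restr)
next
  show "induced \<one>\<^bsub>germ_ring Z N\<^esub> = \<one>\<^bsub>germ_ring Y N'\<^esub>"
    using dom.N_points dom.germ_one[OF dom.N_points] cod.germ_one[OF u_N[OF dom.N_points]]
      cring.cring_simprules(6)[OF dom.sections_cring[OF dom.N_open[OF dom.N_points]]]
    by (simp add: induced_germ ring_hom_one[OF \<Phi>_hom])
qed

end


section \<open>Basic opens, local fractions and injectivity of restriction\<close>

section \<open>Affine opens and integral schemes\<close>

lemma (in cring) primeideal_mult_notin:
  assumes "primeideal P R" "a \<in> carrier R" "b \<in> carrier R"
  shows "a \<otimes> b \<notin> P \<longleftrightarrow> a \<notin> P \<and> b \<notin> P"
proof -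
  interpret P: primeideal P R by fact
  show ?thesis using assms P.I_prime P.I_l_closed P.I_r_closed by blast
qed

lemma (in cring) topspace_zariski: "topspace (zariski_topology R) = prime_spectrum R"
proof -
  have "\<one> \<notin> P" if "primeideal P R" for P
    using that ideal.one_imp_carrier[of P R] primeideal.I_notcarr[OF that] primeideal.axioms(1) by blast
  then show ?thesis
    unfolding zariski_topology_def topology_generated_by_topspace by (auto simp: prime_spectrum_def)
qed

text \<open>The sets D(g), given as a subbasis, already form a basis: D(g) and D(h) meet in D(gh),
  because the ideals are prime.\<close>

lemma (in cring) openin_zariskiE:
  assumes "openin (zariski_topology R) T" "P \<in> T"
  shows "\<exists>g\<in>carrier R. g \<notin> P \<and> {Q \<in> prime_spectrum R. g \<notin> Q} \<subseteq> T"
proof -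
  let ?D = "\<lambda>a. {P \<in> prime_spectrum R. a \<notin> P}"
  have "generate_topology_on (?D ` carrier R) T"
    using assms(1) by (simp add: zariski_topology_def openin_topology_generated_by_iff)
  then show ?thesis using assms(2)
  proof (induction arbitrary: P rule: generate_topology_on.induct)
    case (Int A B)
    then have PAB: "P \<in> A" "P \<in> B" by auto
    obtain g where g: "g \<in> carrier R" "g \<notin> P" "?D g \<subseteq> A" using Int.IH(1)[OF PAB(1)] by blast
    obtain h where h: "h \<in> carrier R" "h \<notin> P" "?D h \<subseteq> B" using Int.IH(2)[OF PAB(2)] by blast
    note gh = g h
    have "openin (zariski_topology R) A"
      using Int.hyps(1) by (simp add: zariski_topology_def openin_topology_generated_by_iff)
    then have "P \<in> prime_spectrum R"
      using PAB(1) openin_subset topspace_zariski by blast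
    then have "g \<otimes> h \<notin> P" using gh primeideal_mult_notin by (auto simp: prime_spectrum_def)
    moreover have "?D (g \<otimes> h) \<subseteq> A \<inter> B"
      using gh primeideal_mult_notin by (auto simp: prime_spectrum_def)
    ultimately show ?case using gh by (intro bexI[of _ "g \<otimes> h"]) auto
  next
    case (UN K)
    then obtain A where "A \<in> K" "P \<in> A" by blast
    then show ?case using UN.IH[of A P] by blast
  qed auto
qed

locale is_scheme =
  fixes Z :: "('x, 's, 'z) ringed_space_scheme"
  assumes scheme: "scheme Z"

sublocale is_scheme \<subseteq> ringed
  using scheme by unfold_locales (simp add: scheme_def locally_ringed_space_def)

context is_scheme
begin

lemma stalk_local: "x \<in> points Z \<Longrightarrow> local_ring (stalk Z x)"
  using scheme by (simp add: scheme_def locally_ringed_space_def)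

lemma stalk_cring: "x \<in> points Z \<Longrightarrow> cring (stalk Z x)"
  using stalk_local by (simp add: local_ring_def)

lemma exists_affine: "x \<in> points Z \<Longrightarrow> \<exists>U. x \<in> U \<and> affine_open Z U"
  using scheme by (simp add: scheme_def)

lemma affine_is_open: "affine_open Z U \<Longrightarrow> open_in Z U"
  by (simp add: affine_open_def)

lemma stalk_germ_hom: "open_in Z U \<Longrightarrow> x \<in> U \<Longrightarrow> germ Z (nbhds Z x) U \<in> ring_hom (sections Z U) (stalk Z x)"
  using germs.germ_hom[OF germs_nbhds, of x U] open_subset[of U] by (auto simp: nbhds_def)

lemma vanishing_iff:
  assumes "open_in Z U" "x \<in> U" "a \<in> carrier (sections Z U)"
  shows "a \<in> vanishing_prime Z U x \<longleftrightarrow> germ Z (nbhds Z x) U a \<notin> Units (stalk Z x)"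
  using assms ring_hom_closed[OF stalk_germ_hom[OF assms(1,2)] assms(3)]
  by (simp add: vanishing_prime_def max_ideal_def)

lemma locus_iff:
  assumes "open_in Z U" "a \<in> carrier (sections Z U)"
  shows "x \<in> nonvanishing_locus Z U a \<longleftrightarrow> x \<in> U \<and> germ Z (nbhds Z x) U a \<in> Units (stalk Z x)"
  using vanishing_iff[OF assms(1) _ assms(2)] by (auto simp: nonvanishing_locus_def)

lemma locus_subset: "nonvanishing_locus Z U a \<subseteq> U"
  by (auto simp: nonvanishing_locus_def)

lemma affine_bij:
  assumes "affine_open Z U"
  shows "bij_betw (vanishing_prime Z U) U (prime_spectrum (sections Z U))"
proof -
  have hom: "homeomorphic_map (subtopology (space_top Z) U) (zariski_topology (sections Z U)) (vanishing_prime Z U)"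
    using assms by (simp add: affine_open_def)
  have "U \<subseteq> points Z" using open_subset[OF affine_is_open[OF assms]] .
  then have "topspace (subtopology (space_top Z) U) = U" by auto
  then show ?thesis
    using homeomorphic_imp_injective_map[OF hom] homeomorphic_imp_surjective_map[OF hom]
      cring.topspace_zariski[OF sections_cring[OF affine_is_open[OF assms]]]
    by (simp add: bij_betw_def)
qed

lemma vanishing_prime_is_prime:
  assumes "affine_open Z U" "x \<in> U" shows "primeideal (vanishing_prime Z U x) (sections Z U)"
  using affine_bij[OF assms(1)] assms(2) by (auto simp: bij_betw_def prime_spectrum_def)

text \<open>The basis D(g) of the spectrum, carried over to U by the homeomorphism
  \<open>vanishing_prime Z U\<close>.\<close>

lemma affine_basis:
  assumes U: "affine_open Z U" and W: "open_in Z W" and x: "x \<in> W" "x \<in> U"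
  shows "\<exists>g\<in>carrier (sections Z U). x \<in> nonvanishing_locus Z U g \<and> nonvanishing_locus Z U g \<subseteq> W"
proof -
  let ?v = "vanishing_prime Z U"
  have hom: "homeomorphic_map (subtopology (space_top Z) U) (zariski_topology (sections Z U)) ?v"
    using U by (simp add: affine_open_def)
  have "openin (subtopology (space_top Z) U) (U \<inter> W)"
    using W by (simp add: openin_subtopology_Int2)
  then have "openin (zariski_topology (sections Z U)) (?v ` (U \<inter> W))"
    using homeomorphic_imp_open_map[OF hom] by (simp add: open_map_def)
  moreover have "?v x \<in> ?v ` (U \<inter> W)" using x by blast
  ultimately obtain g where g: "g \<in> carrier (sections Z U)" "g \<notin> ?v x"
    "{Q \<in> prime_spectrum (sections Z U). g \<notin> Q} \<subseteq> ?v ` (U \<inter> W)"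
    using cring.openin_zariskiE[OF sections_cring[OF affine_is_open[OF U]]] by blast
  have "z \<in> W" if "z \<in> U" "g \<notin> ?v z" for z
  proof -
    have "?v z \<in> ?v ` (U \<inter> W)" using g(3) that affine_bij[OF U] by (auto simp: bij_betw_def)
    then show ?thesis using affine_bij[OF U] that by (auto simp: bij_betw_def inj_on_def)
  qed
  then show ?thesis using g x by (intro bexI[of _ g]) (auto simp: nonvanishing_locus_def)
qed

lemma locus_open:
  assumes U: "affine_open Z U" and g: "g \<in> carrier (sections Z U)"
  shows "open_in Z (nonvanishing_locus Z U g)"
proof -
  let ?v = "vanishing_prime Z U" and ?R = "sections Z U"
  have hom: "homeomorphic_map (subtopology (space_top Z) U) (zariski_topology ?R) ?v"
    using U by (simp add: affine_open_def)
  have "openin (zariski_topology ?R) {P \<in> prime_spectrum ?R. g \<notin> P}"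
    unfolding zariski_topology_def using g by (intro topology_generated_by_Basis) auto
  then have "openin (subtopology (space_top Z) U)
      {x \<in> topspace (subtopology (space_top Z) U). ?v x \<in> {P \<in> prime_spectrum ?R. g \<notin> P}}"
    by (rule openin_continuous_map_preimage[OF homeomorphic_imp_continuous_map[OF hom]])
  moreover have "{x \<in> topspace (subtopology (space_top Z) U). ?v x \<in> {P \<in> prime_spectrum ?R. g \<notin> P}}
      = nonvanishing_locus Z U g"
    using open_subset[OF affine_is_open[OF U]] affine_bij[OF U]
    by (auto simp: nonvanishing_locus_def bij_betw_def)
  ultimately show ?thesis using affine_is_open[OF U] openin_open_subtopology by metis
qed

lemma locus_localization:
  assumes "affine_open Z U" "g \<in> carrier (sections Z U)"
  shows "is_localization_at (sections Z U) g (sections Z (nonvanishing_locus Z U g))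
           (restr Z U (nonvanishing_locus Z U g))"
  using assms by (simp add: affine_open_def)

text \<open>On D(g) the section \<open>s\<close> becomes a fraction with numerator \<open>r\<close>
  over U and denominator a power of \<open>g\<close>. Stated for any family N, it serves both the
  stalk and the function field.\<close>

lemma germ_fraction:
  assumes N: "germs Z N" and U: "affine_open Z U" "U \<in> N" and g: "g \<in> carrier (sections Z U)"
    and D: "nonvanishing_locus Z U g \<in> N" "nonvanishing_locus Z U g \<subseteq> W"
    and W: "W \<in> N" "s \<in> carrier (sections Z W)"
  shows "\<exists>r\<in>carrier (sections Z U). \<exists>m::nat.
           germ Z N W s \<otimes>\<^bsub>germ_ring Z N\<^esub> germ Z N U (g [^]\<^bsub>sections Z U\<^esub> m) = germ Z N U r"
proof -
  interpret germs Z N by fact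
  let ?D = "nonvanishing_locus Z U g" and ?R = "sections Z U"
  let ?h = "restr Z U ?D"
  note o = N_open[OF U(2)] N_open[OF D(1)] N_open[OF W(1)]
  interpret R: cring ?R by (rule sections_cring[OF o(1)])
  interpret S: cring "sections Z ?D" by (rule sections_cring[OF o(2)])
  interpret h: ring_hom_cring ?R "sections Z ?D" ?h
    by (rule ring_hom_cringI[OF R.cring_axioms S.cring_axioms restr_hom[OF o(1,2) locus_subset]])
  have b: "restr Z W ?D s \<in> carrier (sections Z ?D)" by (rule restr_closed[OF o(3,2) D(2) W(2)])
  then obtain r m where r: "r \<in> carrier ?R"
    "restr Z W ?D s \<otimes>\<^bsub>sections Z ?D\<^esub> (?h g [^]\<^bsub>sections Z ?D\<^esub> (m::nat)) = ?h r"
    using locus_localization[OF U(1) g] unfolding is_localization_at_def by blast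
  have gm: "g [^]\<^bsub>?R\<^esub> m \<in> carrier ?R" using g by simp
  have "germ Z N U r = germ Z N ?D (?h r)"
    by (rule germ_restr[OF U(2) D(1) locus_subset r(1), symmetric])
  also have "?h r = restr Z W ?D s \<otimes>\<^bsub>sections Z ?D\<^esub> ?h (g [^]\<^bsub>?R\<^esub> m)"
    unfolding h.hom_pow[OF g] r(2) ..
  also have "germ Z N ?D \<dots> = germ Z N ?D (restr Z W ?D s) \<otimes>\<^bsub>GR\<^esub> germ Z N ?D (?h (g [^]\<^bsub>?R\<^esub> m))"
    by (rule ring_hom_mult[OF germ_hom[OF D(1)] b h.hom_closed[OF gm]])
  also have "\<dots> = germ Z N W s \<otimes>\<^bsub>GR\<^esub> germ Z N U (g [^]\<^bsub>?R\<^esub> m)"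
    unfolding germ_restr[OF W(1) D(1,2) W(2)] germ_restr[OF U(2) D(1) locus_subset gm] ..
  finally show ?thesis using r(1) by metis
qed

end

locale is_integral_scheme =
  fixes Z :: "('x, 's, 'z) ringed_space_scheme"
  assumes integral_scheme: "integral_scheme Z"

sublocale is_integral_scheme \<subseteq> is_scheme
  using integral_scheme by unfold_locales (simp add: integral_scheme_def)

context is_integral_scheme
begin

lemma sections_domain: "open_in Z U \<Longrightarrow> U \<noteq> {} \<Longrightarrow> domain (sections Z U)"
  using integral_scheme by (simp add: integral_scheme_def nonempty_opens_def)

text \<open>Over a union of two disjoint opens the sections are pairs, and (1,0) and (0,1) would be
  nonzero with product zero in a domain.\<close>

lemma irreducible:
  assumes U: "open_in Z U" "U \<noteq> {}" and V: "open_in Z V" "V \<noteq> {}"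
  shows "U \<inter> V \<noteq> {}"
proof
  assume disj: "U \<inter> V = {}"
  have UV: "open_in Z (U \<union> V)" "U \<union> V \<noteq> {}" "U \<subseteq> U \<union> V" "V \<subseteq> U \<union> V" using U V by auto
  interpret W: domain "sections Z (U \<union> V)" by (rule sections_domain[OF UV(1,2)])
  interpret U: domain "sections Z U" by (rule sections_domain[OF U])
  interpret V: domain "sections Z V" by (rule sections_domain[OF V])
  have e: "open_in Z {}" by simp
  \<comment> \<open>The empty cover of the empty set makes all sections there equal, so the overlap
    condition for gluing is automatic.\<close>
  have zero_ring: "a = b" if "a \<in> carrier (sections Z {})" "b \<in> carrier (sections Z {})" for a b
    using sections_eqI[of "{}" a b] that by simp
  have glue: "\<exists>c\<in>carrier (sections Z (U \<union> V)). restr Z (U \<union> V) U c = a \<and> restr Z (U \<union> V) V c = b"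
    if a: "a \<in> carrier (sections Z U)" and b: "b \<in> carrier (sections Z V)" for a b
  proof -
    have ne: "U \<noteq> V" using disj U by auto
    have "\<exists>c\<in>carrier (sections Z (\<Union>{U, V})). \<forall>W\<in>{U, V}. restr Z (\<Union>{U, V}) W c = (if W = U then a else b)"
    proof (rule sections_glue)
      fix A B assume AB: "A \<in> {U, V}" "B \<in> {U, V}"
      let ?c = "\<lambda>W. if W = U then a else b"
      show "restr Z A (A \<inter> B) (?c A) = restr Z B (A \<inter> B) (?c B)"
      proof (cases "A = B")
        case False
        then have AB0: "A \<inter> B = {}" using AB disj by auto
        have "open_in Z A" "open_in Z B" "?c A \<in> carrier (sections Z A)" "?c B \<in> carrier (sections Z B)"
          using AB U V a b ne by auto
        then show ?thesis unfolding AB0 by (intro zero_ring restr_closed e) auto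
      qed simp
    qed (use U V a b ne in auto)
    then show ?thesis using ne by auto
  qed
  obtain c where c: "c \<in> carrier (sections Z (U \<union> V))" "restr Z (U \<union> V) U c = \<one>\<^bsub>sections Z U\<^esub>"
    "restr Z (U \<union> V) V c = \<zero>\<^bsub>sections Z V\<^esub>" using glue[of "\<one>\<^bsub>sections Z U\<^esub>" "\<zero>\<^bsub>sections Z V\<^esub>"] by auto
  obtain d where d: "d \<in> carrier (sections Z (U \<union> V))" "restr Z (U \<union> V) U d = \<zero>\<^bsub>sections Z U\<^esub>"
    "restr Z (U \<union> V) V d = \<one>\<^bsub>sections Z V\<^esub>" using glue[of "\<zero>\<^bsub>sections Z U\<^esub>" "\<one>\<^bsub>sections Z V\<^esub>"] by auto
  note hU = restr_hom[OF UV(1) U(1) UV(3)] and hV = restr_hom[OF UV(1) V(1) UV(4)]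
  have "c \<otimes>\<^bsub>sections Z (U \<union> V)\<^esub> d = \<zero>\<^bsub>sections Z (U \<union> V)\<^esub>"
  proof (rule sections_eqI[of "{U, V}", simplified])
    show "c \<otimes>\<^bsub>sections Z (U \<union> V)\<^esub> d \<in> carrier (sections Z (U \<union> V))" using c d by simp
    show "\<zero>\<^bsub>sections Z (U \<union> V)\<^esub> \<in> carrier (sections Z (U \<union> V))" by simp
    show "open_in Z A" if "A = U \<or> A = V" for A using that U V by auto
    show "restr Z (U \<union> V) A (c \<otimes>\<^bsub>sections Z (U \<union> V)\<^esub> d) = restr Z (U \<union> V) A \<zero>\<^bsub>sections Z (U \<union> V)\<^esub>"
      if "A = U \<or> A = V" for A
      using that c d ring_hom_mult[OF hU c(1) d(1)] ring_hom_mult[OF hV c(1) d(1)]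
        restr_zero[OF UV(1) U(1) UV(3)] restr_zero[OF UV(1) V(1) UV(4)] by auto
  qed
  then have "c = \<zero>\<^bsub>sections Z (U \<union> V)\<^esub> \<or> d = \<zero>\<^bsub>sections Z (U \<union> V)\<^esub>"
    using W.integral c(1) d(1) by blast
  then show False
    using c d restr_zero[OF UV(1) U(1) UV(3)] restr_zero[OF UV(1) V(1) UV(4)] by auto
qed

lemma germs_nonempty: "germs Z (nonempty_opens Z)"
proof (rule germs.intro[OF ringed_axioms], rule germs_axioms.intro)
  show "points Z \<in> nonempty_opens Z"
    using integral_scheme by (simp add: integral_scheme_def nonempty_opens_def)
qed (use irreducible in \<open>auto simp: nonempty_opens_def\<close>)

lemma locus_empty:
  assumes "affine_open Z U" shows "nonvanishing_locus Z U \<zero>\<^bsub>sections Z U\<^esub> = {}"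
  using vanishing_prime_is_prime[OF assms] additive_subgroup.zero_closed
    ideal.axioms(1) primeideal.axioms(1) by (fastforce simp: nonvanishing_locus_def)

text \<open>It suffices that \<open>a\<close> vanishes near every point \<open>x\<close> of U. On
  some D(g) around \<open>x\<close> inside U it is a fraction with numerator \<open>r\<close>, and
  vanishing of \<open>a\<close> on V forces \<open>r = 0\<close> because the ring is a
  domain.\<close>

lemma restr_injective:
  assumes U: "open_in Z U" and V: "open_in Z V" "V \<noteq> {}" "V \<subseteq> U"
    and a: "a \<in> carrier (sections Z U)" "restr Z U V a = \<zero>\<^bsub>sections Z V\<^esub>"
  shows "a = \<zero>\<^bsub>sections Z U\<^esub>"
proof -
  define \<W> where "\<W> = {W. open_in Z W \<and> W \<subseteq> U \<and> restr Z U W a = \<zero>\<^bsub>sections Z W\<^esub>}"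
  have "\<exists>W\<in>\<W>. x \<in> W" if x: "x \<in> U" for x
  proof -
    obtain A where A: "x \<in> A" "affine_open Z A" using exists_affine x open_subset[OF U] by blast
    let ?R = "sections Z A"
    note Ao = affine_is_open[OF A(2)]
    interpret R: domain ?R using sections_domain[OF Ao] A by auto
    obtain g where g: "g \<in> carrier ?R" "x \<in> nonvanishing_locus Z A g" "nonvanishing_locus Z A g \<subseteq> U"
      using affine_basis[OF A(2) U x A(1)] by blast
    let ?D = "nonvanishing_locus Z A g"
    have Do: "open_in Z ?D" "?D \<noteq> {}" using locus_open[OF A(2) g(1)] g(2) by auto
    interpret S: domain "sections Z ?D" by (rule sections_domain[OF Do])
    let ?b = "restr Z U ?D a" and ?h = "restr Z A ?D"
    interpret h: ring_hom_cring ?R "sections Z ?D" ?h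
      by (rule ring_hom_cringI[OF R.cring_axioms S.cring_axioms restr_hom[OF Ao Do(1) locus_subset]])
    have b: "?b \<in> carrier (sections Z ?D)" by (rule restr_closed[OF U Do(1) g(3) a(1)])
    have loc: "is_localization_at ?R g (sections Z ?D) ?h" by (rule locus_localization[OF A(2) g(1)])
    obtain r m where r: "r \<in> carrier ?R" "?b \<otimes>\<^bsub>sections Z ?D\<^esub> (?h g [^]\<^bsub>sections Z ?D\<^esub> (m::nat)) = ?h r"
      using loc b unfolding is_localization_at_def by blast
    have DV: "open_in Z (?D \<inter> V)" using Do V by auto
    \<comment> \<open>V need not contain \<open>x\<close>, but by irreducibility it meets D(g); a
      second basic open D(g') is placed in the overlap.\<close>
    obtain z where z: "z \<in> ?D \<inter> V" using irreducible[OF Do V(1,2)] by blast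
    then have zA: "z \<in> A" using locus_subset by auto
    obtain g' where g': "g' \<in> carrier ?R" "z \<in> nonvanishing_locus Z A g'" "nonvanishing_locus Z A g' \<subseteq> ?D \<inter> V"
      using affine_basis[OF A(2) DV z zA] by blast
    let ?E = "nonvanishing_locus Z A g'"
    have Eo: "open_in Z ?E" "?E \<noteq> {}" "?E \<subseteq> ?D" "?E \<subseteq> V" using locus_open[OF A(2) g'(1)] g' by auto
    have "restr Z ?D ?E ?b = restr Z U ?E a" by (rule restr_restr[OF U Do(1) Eo(1,3) g(3) a(1)])
    also have "\<dots> = restr Z V ?E (restr Z U V a)" by (rule restr_restr[OF U V(1) Eo(1,4) V(3) a(1), symmetric])
    also have "\<dots> = \<zero>\<^bsub>sections Z ?E\<^esub>" unfolding a(2) by (rule restr_zero[OF V(1) Eo(1,4)])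
    finally have bE: "restr Z ?D ?E ?b = \<zero>\<^bsub>sections Z ?E\<^esub>" .
    interpret E: domain "sections Z ?E" by (rule sections_domain[OF Eo(1,2)])
    note hE = restr_hom[OF Do(1) Eo(1,3)]
    have pw: "?h g [^]\<^bsub>sections Z ?D\<^esub> m \<in> carrier (sections Z ?D)" using g(1) by simp
    have "restr Z A ?E r = restr Z ?D ?E (?h r)"
      by (rule restr_restr[OF Ao Do(1) Eo(1,3) locus_subset r(1), symmetric])
    also have "\<dots> = restr Z ?D ?E ?b \<otimes>\<^bsub>sections Z ?E\<^esub> restr Z ?D ?E (?h g [^]\<^bsub>sections Z ?D\<^esub> m)"
      unfolding r(2)[symmetric] by (rule ring_hom_mult[OF hE b pw])
    also have "\<dots> = \<zero>\<^bsub>sections Z ?E\<^esub>" unfolding bE using ring_hom_closed[OF hE pw] by simp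
    finally have "restr Z A ?E r = \<zero>\<^bsub>sections Z ?E\<^esub>" .
    \<comment> \<open>Vanishing on D(g') means being killed by a power of \<open>g'\<close>, and
      \<open>g'\<close> is nonzero as D(g') is nonempty.\<close>
    then obtain l where l: "(g' [^]\<^bsub>?R\<^esub> (l::nat)) \<otimes>\<^bsub>?R\<^esub> r = \<zero>\<^bsub>?R\<^esub>"
      using locus_localization[OF A(2) g'(1)] r(1) unfolding is_localization_at_def by blast
    have "g' \<noteq> \<zero>\<^bsub>?R\<^esub>" using locus_empty[OF A(2)] Eo(2) by auto
    then have "g' [^]\<^bsub>?R\<^esub> l \<noteq> \<zero>\<^bsub>?R\<^esub>" using g'(1) by (induction l) (auto simp: R.integral_iff)
    then have "r = \<zero>\<^bsub>?R\<^esub>" using l r(1) g'(1) by (auto simp: R.integral_iff)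
    then have "?b \<otimes>\<^bsub>sections Z ?D\<^esub> (?h g [^]\<^bsub>sections Z ?D\<^esub> m) = \<zero>\<^bsub>sections Z ?D\<^esub>" using r(2) by simp
    moreover have "?h g [^]\<^bsub>sections Z ?D\<^esub> m \<in> Units (sections Z ?D)"
      using loc by (intro S.Units_pow_closed) (auto simp: is_localization_at_def)
    then have "?h g [^]\<^bsub>sections Z ?D\<^esub> m \<noteq> \<zero>\<^bsub>sections Z ?D\<^esub>"
      by (metis S.Units_r_inv_ex S.l_null S.one_not_zero)
    ultimately have "?b = \<zero>\<^bsub>sections Z ?D\<^esub>" using b pw by (auto simp: S.integral_iff)
    then have "?D \<in> \<W>" using Do g(3) by (simp add: \<W>_def)
    then show ?thesis using g(2) by blast
  qed
  then have cover: "\<Union>\<W> = U" by (auto simp: \<W>_def)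
  show ?thesis
  proof (rule sections_eqI[of \<W>, unfolded cover])
    show "a \<in> carrier (sections Z U)" by fact
    show "\<zero>\<^bsub>sections Z U\<^esub> \<in> carrier (sections Z U)" using cring.cring_simprules(2)[OF sections_cring[OF U]] .
    show "open_in Z W" if "W \<in> \<W>" for W using that by (simp add: \<W>_def)
    show "restr Z U W a = restr Z U W \<zero>\<^bsub>sections Z U\<^esub>" if "W \<in> \<W>" for W
      using that restr_zero[OF U] by (simp add: \<W>_def)
  qed
qed

lemma restr_inj:
  assumes U: "open_in Z U" and V: "open_in Z V" "V \<noteq> {}" "V \<subseteq> U"
    and a: "a \<in> carrier (sections Z U)" and b: "b \<in> carrier (sections Z U)" and eq: "restr Z U V a = restr Z U V b"
  shows "a = b"
proof -
  interpret R: cring "sections Z U" by (rule sections_cring[OF U])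
  interpret S: cring "sections Z V" by (rule sections_cring[OF V(1)])
  interpret h: ring_hom_cring "sections Z U" "sections Z V" "restr Z U V"
    by (rule ring_hom_cringI[OF R.cring_axioms S.cring_axioms restr_hom[OF U V(1,3)]])
  have "restr Z U V (a \<ominus>\<^bsub>sections Z U\<^esub> b) = \<zero>\<^bsub>sections Z V\<^esub>"
    using a b eq by (simp add: a_minus_def S.r_neg)
  then have "a \<ominus>\<^bsub>sections Z U\<^esub> b = \<zero>\<^bsub>sections Z U\<^esub>"
    using restr_injective[OF U V] a b by simp
  then show ?thesis using a b by (simp add: R.r_right_minus_eq)
qed

end


section \<open>Points over primes, Krull intersection and closures of points\<close>

lemma (in ring_hom_ring) generate_ring_image:
  assumes "H \<subseteq> carrier R"
  shows "h ` generate_ring R H \<subseteq> generate_ring S (h ` H)"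
proof safe
  fix x assume "x \<in> generate_ring R H"
  then show "h x \<in> generate_ring S (h ` H)"
  proof induction
    case (a_inv x)
    then have "x \<in> carrier R" using R.generate_ring_in_carrier[OF assms] by blast
    then show ?case using a_inv by (simp add: generate_ring.a_inv)
  next
    case (eng_add x y)
    then have "x \<in> carrier R" "y \<in> carrier R" using R.generate_ring_in_carrier[OF assms] by auto
    then show ?case using eng_add by (simp add: generate_ring.eng_add)
  next
    case (eng_mult x y)
    then have "x \<in> carrier R" "y \<in> carrier R" using R.generate_ring_in_carrier[OF assms] by auto
    then show ?case using eng_mult by (simp add: generate_ring.eng_mult)
  qed (auto intro: generate_ring.intros)
qed

text \<open>The weak Nullstellensatz for the domain R/p, applied to the element 1 and composed with
  the projection.\<close>

lemma (in algebraically_closed) exists_point_over_prime: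
  assumes R: "cring R" and \<gamma>: "\<gamma> \<in> ring_hom L R" and S: "finite S" "S \<subseteq> carrier R"
    and gen: "generate_ring R (\<gamma> ` carrier L \<union> S) = carrier R" and p: "primeideal p R"
  shows "\<exists>\<psi>\<in>ring_hom R L. (\<forall>c\<in>carrier L. \<psi> (\<gamma> c) = c) \<and> (\<forall>r\<in>p. \<psi> r = \<zero>)"
proof -
  interpret R: cring R by fact
  interpret p: primeideal p R by fact
  let ?B = "R Quot p" and ?\<pi> = "(+>\<^bsub>R\<^esub>) p"
  interpret \<pi>: ring_hom_ring R ?B ?\<pi> by (rule p.rcos_ring_hom_ring)
  interpret B: domain ?B by (rule p.quotient_is_domain)
  let ?\<iota> = "?\<pi> \<circ> \<gamma>"
  have \<gamma>_closed: "\<gamma> c \<in> carrier R" if "c \<in> carrier L" for c using \<gamma> that by (rule ring_hom_closed)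
  have \<iota>: "?\<iota> \<in> ring_hom L ?B" using ring_hom_trans[OF \<gamma> p.rcos_ring_hom] .
  have H: "\<gamma> ` carrier L \<union> S \<subseteq> carrier R" using \<gamma>_closed S(2) by auto
  have "?\<pi> ` carrier R \<subseteq> generate_ring ?B (?\<pi> ` (\<gamma> ` carrier L \<union> S))"
    using \<pi>.generate_ring_image[OF H] gen by simp
  then have gen': "?\<pi> ` carrier R \<subseteq> generate_ring ?B (?\<iota> ` carrier L \<union> ?\<pi> ` S)"
    by (simp add: image_Un image_comp)
  have one: "\<one>\<^bsub>?B\<^esub> \<in> generate_ring ?B (?\<iota> ` carrier L \<union> ?\<pi> ` S)" by (rule generate_ring.one)
  have fS: "finite (?\<pi> ` S)" "?\<pi> ` S \<subseteq> carrier ?B" using S \<pi>.hom_closed by auto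
  obtain \<phi> where \<phi>: "\<phi> \<in> ring_hom (?B\<lparr>carrier := generate_ring ?B (?\<iota> ` carrier L \<union> ?\<pi> ` S)\<rparr>) L"
    "\<forall>c\<in>carrier L. \<phi> (?\<iota> c) = c"
    using hom_from_finitely_generated_domain[OF B.domain_axioms \<iota> fS one B.one_not_zero] by blast
  have \<phi>': "\<phi> \<in> ring_hom (?B\<lparr>carrier := ?\<pi> ` carrier R\<rparr>) L" by (rule ring_hom_mono_carrier[OF gen' \<phi>(1)])
  have "?\<pi> \<in> ring_hom R (?B\<lparr>carrier := ?\<pi> ` carrier R\<rparr>)"
    using p.rcos_ring_hom by (simp add: ring_hom_def Pi_def)
  then have \<psi>: "\<phi> \<circ> ?\<pi> \<in> ring_hom R L" using ring_hom_trans \<phi>' by blast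
  moreover have "(\<phi> \<circ> ?\<pi>) r = \<zero>" if "r \<in> p" for r
  proof -
    have "p +>\<^bsub>R\<^esub> r = p +>\<^bsub>R\<^esub> \<zero>\<^bsub>R\<^esub>"
      using that p.a_rcos_const p.additive_subgroup_axioms additive_subgroup.zero_closed by metis
    then have "(\<phi> \<circ> ?\<pi>) r = (\<phi> \<circ> ?\<pi>) \<zero>\<^bsub>R\<^esub>" by simp
    also have "\<dots> = \<zero>" by (rule ring_hom_zero[OF \<psi> R.ring_axioms ring_axioms])
    finally show ?thesis .
  qed
  ultimately show ?thesis using \<phi>(2) by (intro bexI[of _ "\<phi> \<circ> ?\<pi>"]) auto
qed

text \<open>Write \<open>a\<close> as \<open>f i\<close> times the i-th power of \<open>t\<close>.
  Cancelling powers gives \<open>f i = t f (i+1)\<close>, an ascending chain of principal ideals.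
  Where it stops, \<open>f (i+1) = u f i = u t f (i+1)\<close>, so \<open>t\<close> would be a
  unit.\<close>

lemma (in noetherian_domain) Krull_principal:
  assumes t: "t \<in> carrier R" "t \<notin> Units R" and a: "a \<in> carrier R"
    and b: "\<And>i::nat. \<exists>b\<in>carrier R. a = b \<otimes> t [^] i"
  shows "a = \<zero>"
proof (rule ccontr)
  assume a0: "a \<noteq> \<zero>"
  obtain f where f: "\<And>i. f i \<in> carrier R" "\<And>i. a = f i \<otimes> t [^] (i::nat)" using b by metis
  have t0: "t \<noteq> \<zero>" using f(2)[of 1] f(1) t a0 by auto
  have tp: "t [^] (i::nat) \<noteq> \<zero>" for i using t(1) t0 by (rule nonzero_power)
  have step: "f i = t \<otimes> f (Suc i)" for i
  proof -
    have "f i \<otimes> t [^] i = (t \<otimes> f (Suc i)) \<otimes> t [^] i"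
      using f(2)[of i] f(2)[of "Suc i"] f(1) t(1) by (simp add: m_ac)
    then show ?thesis using m_rcancel[OF tp[of i], of "f i" "t \<otimes> f (Suc i)"] f(1) t(1) by simp
  qed
  have sub: "PIdl (f i) \<subseteq> PIdl (f (Suc i))" for i
  proof (rule cgenideal_minimal[OF cgenideal_ideal[OF f(1)]])
    show "f i \<in> PIdl (f (Suc i))" using step[of i] t(1) by (auto simp: cgenideal_def)
  qed
  have "subset.chain {I. ideal I R} (range (\<lambda>i. PIdl (f i)))"
  proof -
    have "PIdl (f i) \<subseteq> PIdl (f j)" if "i \<le> j" for i j
      using that by (rule lift_Suc_mono_le[of "\<lambda>i. PIdl (f i)", OF sub])
    then have "PIdl (f i) \<subseteq> PIdl (f j) \<or> PIdl (f j) \<subseteq> PIdl (f i)" for i j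
      by (meson nat_le_linear)
    then show ?thesis using cgenideal_ideal f(1) unfolding subset_chain_def by blast
  qed
  then have "\<Union>(range (\<lambda>i. PIdl (f i))) \<in> range (\<lambda>i. PIdl (f i))"
    by (intro ideal_chain_is_trivial) auto
  then obtain i where i: "\<Union>(range (\<lambda>i. PIdl (f i))) = PIdl (f i)" by blast
  have "PIdl (f (Suc i)) \<subseteq> PIdl (f i)" unfolding i[symmetric] by blast
  then have "f (Suc i) \<in> PIdl (f i)" using cgenideal_self[OF f(1)] by blast
  then obtain u where u: "u \<in> carrier R" "f (Suc i) = u \<otimes> f i" by (auto simp: cgenideal_def)
  have "\<one> \<otimes> f (Suc i) = (u \<otimes> t) \<otimes> f (Suc i)"
    using u(2) step[of i] f(1) u(1) t(1) by (metis l_one m_assoc)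
  moreover have "f (Suc i) \<noteq> \<zero>" using f(2)[of "Suc i"] a0 t(1) by auto
  ultimately have "u \<otimes> t = \<one>" using m_rcancel[of "f (Suc i)" \<one> "u \<otimes> t"] f(1) u(1) t(1) by simp
  then show False using t u(1) m_comm[of u t] by (auto simp: Units_def)
qed

context is_integral_scheme
begin

text \<open>Inclusion of primes is specialisation: a \<open>g\<close> that is nonzero at
  \<open>z\<close> is nonzero at \<open>x\<close>, so every neighbourhood of \<open>z\<close>
  contains \<open>x\<close>. The order is reversed for closures.\<close>

lemma closure_of_point_strict:
  assumes U: "affine_open Z U" and x: "x \<in> U" and z: "z \<in> U"
    and lt: "vanishing_prime Z U x \<subset> vanishing_prime Z U z"
  shows "space_top Z closure_of {z} \<subset> space_top Z closure_of {x}"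
proof -
  have pts: "x \<in> points Z" "z \<in> points Z" using x z open_subset[OF affine_is_open[OF U]] by auto
  have "z \<in> space_top Z closure_of {x}"
  proof -
    have "x \<in> W" if W: "z \<in> W" "open_in Z W" for W
    proof -
      obtain g where g: "g \<in> carrier (sections Z U)" "z \<in> nonvanishing_locus Z U g" "nonvanishing_locus Z U g \<subseteq> W"
        using affine_basis[OF U W(2,1) z] by blast
      then have "x \<in> nonvanishing_locus Z U g" using lt x by (auto simp: nonvanishing_locus_def)
      then show ?thesis using g(3) by blast
    qed
    then show ?thesis using pts by (auto simp: in_closure_of)
  qed
  then have "space_top Z closure_of {z} \<subseteq> space_top Z closure_of {x}"
    by (intro closure_of_minimal) auto
  moreover have "x \<notin> space_top Z closure_of {z}"
  proof -
    obtain r where r: "r \<in> vanishing_prime Z U z" "r \<notin> vanishing_prime Z U x" using lt by blast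
    then have rR: "r \<in> carrier (sections Z U)" by (simp add: vanishing_prime_def)
    have "x \<in> nonvanishing_locus Z U r" "z \<notin> nonvanishing_locus Z U r"
      using r x by (auto simp: nonvanishing_locus_def)
    then show ?thesis using locus_open[OF U rR] by (auto simp: in_closure_of)
  qed
  moreover have "x \<in> space_top Z closure_of {x}"
    using pts closure_of_subset[of "{x}" "space_top Z"] by auto
  ultimately show ?thesis by blast
qed

lemma closure_of_point_irreducible:
  assumes "x \<in> points Z"
  shows "space_top Z closure_of {x} \<in> irreducible_closed_sets (space_top Z)"
proof -
  have x: "x \<in> space_top Z closure_of {x}"
    using assms closure_of_subset[of "{x}" "space_top Z"] by auto
  moreover have "space_top Z closure_of {x} \<subseteq> A" if "closedin (space_top Z) A" "x \<in> A" for A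
    using that by (intro closure_of_minimal) auto
  ultimately show ?thesis by (auto simp: irreducible_closed_sets_def)
qed

end


section \<open>The stalk at \<open>y\<close> as a discrete valuation ring with residue field
  \<open>k\<close>\<close>

section \<open>The local ring at a closed point of a curve\<close>

text \<open>In the theorem \<open>field_K\<close> is supplied by
  \<open>finite_galois_extension\<close>, which includes that the upper ring is a field.\<close>

locale pointed_curve = k: algebraically_closed k for k :: "'k ring" +
  fixes Y :: "('k, 'y, 's) space_over" and y :: 'y
  assumes smooth: "smooth_curve k Y" and y: "y \<in> points Y" and closed_y: "closedin (space_top Y) {y}"
    and field_K: "field (function_field Y)"

sublocale pointed_curve \<subseteq> Y: is_integral_scheme Y
  using smooth by unfold_locales (simp add: smooth_curve_def integral_curve_def)

context pointed_curve
begin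

abbreviation "S \<equiv> stalk Y y"
abbreviation "K \<equiv> function_field Y"
abbreviation "jj \<equiv> germ_incl Y"
abbreviation "germS \<equiv> germ Y (nbhds Y y)"
abbreviation "germK \<equiv> germ Y (nonempty_opens Y)"
abbreviation "\<kappa> c \<equiv> germS (points Y) (scalar Y c)"

sublocale SG: germs Y "nbhds Y y" by (rule Y.germs_nbhds[OF y])
sublocale KG: germs Y "nonempty_opens Y" by (rule Y.germs_nonempty)
sublocale K: field K by (rule field_K)
sublocale S: cring S by (rule Y.stalk_cring[OF y])

lemma nbhds_nonempty: "U \<in> nbhds Y y \<Longrightarrow> U \<in> nonempty_opens Y"
  by (auto simp: nbhds_def nonempty_opens_def)

interpretation JJ: germs_map Y "nbhds Y y" Y "nonempty_opens Y" "\<lambda>U. U" "\<lambda>U a. a"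
  by (rule germs_map.intro[OF SG.germs_axioms KG.germs_axioms], rule germs_map_axioms.intro)
    (auto simp: nbhds_nonempty ring_hom_def)

lemma jj_induced: "jj = JJ.induced"
  by (simp add: fun_eq_iff germ_incl_def JJ.induced_def)

lemma jj_germ: "U \<in> nbhds Y y \<Longrightarrow> a \<in> carrier (sections Y U) \<Longrightarrow>
    jj (germS U a) = germK U a"
  unfolding jj_induced by (rule JJ.induced_germ)

sublocale jj: ring_hom_cring S K jj
  using JJ.induced_hom S.cring_axioms K.cring_axioms unfolding jj_induced[symmetric]
  by (intro ring_hom_cringI)

text \<open>Equality in the function field is equality on some nonempty W that may miss
  \<open>y\<close>. Injectivity of restriction lifts it to the intersection of the two domains, a
  neighbourhood of \<open>y\<close>.\<close>

lemma jj_inj: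
  assumes "A \<in> carrier S" "B \<in> carrier S" "jj A = jj B" shows "A = B"
proof -
  obtain U a where U: "U \<in> nbhds Y y" "a \<in> carrier (sections Y U)" "A = germS U a"
    using assms(1) by (rule SG.germ_cases)
  obtain V b where V: "V \<in> nbhds Y y" "b \<in> carrier (sections Y V)" "B = germS V b"
    using assms(2) by (rule SG.germ_cases)
  have "germK U a = germK V b"
    using assms(3) U V by (simp add: jj_germ)
  then obtain W where W: "W \<in> nonempty_opens Y" "W \<subseteq> U" "W \<subseteq> V" "restr Y U W a = restr Y V W b"
    unfolding KG.germ_eq_iff[OF nbhds_nonempty[OF U(1)] nbhds_nonempty[OF V(1)] U(2) V(2)] by blast
  note UV = SG.N_Int[OF U(1) V(1)]
  note o = SG.N_open[OF U(1)] SG.N_open[OF V(1)] SG.N_open[OF UV] KG.N_open[OF W(1)]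
  have sub: "U \<inter> V \<subseteq> U" "U \<inter> V \<subseteq> V" "W \<subseteq> U \<inter> V" "W \<noteq> {}"
    using W by (auto simp: nonempty_opens_def)
  have "restr Y U (U \<inter> V) a = restr Y V (U \<inter> V) b"
  proof (rule Y.restr_inj[OF o(3,4) sub(4,3)])
    show "restr Y U (U \<inter> V) a \<in> carrier (sections Y (U \<inter> V))" by (rule Y.restr_closed[OF o(1,3) sub(1) U(2)])
    show "restr Y V (U \<inter> V) b \<in> carrier (sections Y (U \<inter> V))" by (rule Y.restr_closed[OF o(2,3) sub(2) V(2)])
    show "restr Y (U \<inter> V) W (restr Y U (U \<inter> V) a) = restr Y (U \<inter> V) W (restr Y V (U \<inter> V) b)"
      unfolding Y.restr_restr[OF o(1,3,4) sub(3,1) U(2)] Y.restr_restr[OF o(2,3,4) sub(3,2) V(2)] by (rule W(4))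
  qed
  then show ?thesis
    unfolding U(3) V(3) SG.germ_eq_iff[OF U(1) V(1) U(2) V(2)] using UV sub by blast
qed

lemma jj_zero_iff: "A \<in> carrier S \<Longrightarrow> jj A = \<zero>\<^bsub>K\<^esub> \<longleftrightarrow> A = \<zero>\<^bsub>S\<^esub>"
  using jj_inj[of A "\<zero>\<^bsub>S\<^esub>"] by auto

sublocale S: domain S
proof
  show "\<one>\<^bsub>S\<^esub> \<noteq> \<zero>\<^bsub>S\<^esub>" using jj.hom_one jj.hom_zero K.one_not_zero by metis
  fix a b assume "a \<otimes>\<^bsub>S\<^esub> b = \<zero>\<^bsub>S\<^esub>" "a \<in> carrier S" "b \<in> carrier S"
  then have "jj a \<otimes>\<^bsub>K\<^esub> jj b = \<zero>\<^bsub>K\<^esub>" using jj.hom_mult jj.hom_zero by metis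
  then show "a = \<zero>\<^bsub>S\<^esub> \<or> b = \<zero>\<^bsub>S\<^esub>" 
    using K.integral[of "jj a" "jj b"] jj_zero_iff[OF \<open>a \<in> carrier S\<close>] jj_zero_iff[OF \<open>b \<in> carrier S\<close>]
      jj.hom_closed[OF \<open>a \<in> carrier S\<close>] jj.hom_closed[OF \<open>b \<in> carrier S\<close>] by simp
qed

lemma max_ideal_maximal: "maximalideal (max_ideal S) S"
  using Y.stalk_local[OF y] by (simp add: local_ring_def)

sublocale \<mm>: maximalideal "max_ideal S" S by (rule max_ideal_maximal)

lemma max_ideal_iff: "a \<in> max_ideal S \<longleftrightarrow> a \<in> carrier S \<and> a \<notin> Units S"
  by (simp add: max_ideal_def)

lemma scalar_hom: "scalar Y \<in> ring_hom k (sections Y (points Y))"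
  using smooth by (simp add: smooth_curve_def integral_curve_def scheme_over_def)

lemma kappa_hom: "\<kappa> \<in> ring_hom k S"
  using ring_hom_trans[OF scalar_hom SG.germ_hom[OF SG.N_points]] by (simp add: comp_def)

sublocale \<kappa>: ring_hom_ring k S \<kappa>
  by (intro ring_hom_ringI2 k.ring_axioms S.ring_axioms kappa_hom)

text \<open>The fraction is formed at a point \<open>z\<close> of W inside an affine neighbourhood U
  of \<open>y\<close>, and \<open>z\<close> may differ from \<open>y\<close>. Numerator and
  denominator are nevertheless sections over all of U, hence have germs at \<open>y\<close>.\<close>

lemma fractions:
  assumes "x \<in> carrier K"
  shows "\<exists>a\<in>carrier S. \<exists>b\<in>carrier S. jj b \<noteq> \<zero>\<^bsub>K\<^esub> \<and> x \<otimes>\<^bsub>K\<^esub> jj b = jj a"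
proof -
  obtain W s where W: "W \<in> nonempty_opens Y" "s \<in> carrier (sections Y W)" "x = germK W s"
    using assms by (rule KG.germ_cases)
  obtain U where U: "y \<in> U" "affine_open Y U" using Y.exists_affine[OF y] by blast
  note Uo = Y.affine_is_open[OF U(2)]
  have UN: "U \<in> nbhds Y y" "U \<in> nonempty_opens Y" using U(1) Uo by (auto simp: nbhds_def nonempty_opens_def)
  obtain z where z: "z \<in> W" "z \<in> U"
    using KG.N_Int[OF W(1) UN(2)] by (auto simp: nonempty_opens_def)
  obtain g where g: "g \<in> carrier (sections Y U)" "z \<in> nonvanishing_locus Y U g" "nonvanishing_locus Y U g \<subseteq> W"
    using Y.affine_basis[OF U(2) KG.N_open[OF W(1)] z] by blast
  have D: "nonvanishing_locus Y U g \<in> nonempty_opens Y"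
    using Y.locus_open[OF U(2) g(1)] g(2) by (auto simp: nonempty_opens_def)
  obtain r m where r: "r \<in> carrier (sections Y U)"
    "germK W s \<otimes>\<^bsub>K\<^esub> germK U (g [^]\<^bsub>sections Y U\<^esub> (m::nat)) =
     germK U r"
    using Y.germ_fraction[OF KG.germs_axioms U(2) UN(2) g(1) D g(3) W(1,2)] by blast
  interpret R: domain "sections Y U" using Y.sections_domain[OF Uo] U(1) by auto
  have g0: "g \<noteq> \<zero>\<^bsub>sections Y U\<^esub>" using Y.locus_empty[OF U(2)] g(2) by auto
  have gm: "g [^]\<^bsub>sections Y U\<^esub> m \<in> carrier (sections Y U)" "g [^]\<^bsub>sections Y U\<^esub> m \<noteq> \<zero>\<^bsub>sections Y U\<^esub>"
    using g(1) R.nonzero_power[OF g(1) g0] by auto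
  have "germK U (g [^]\<^bsub>sections Y U\<^esub> m) \<noteq> \<zero>\<^bsub>K\<^esub>"
  proof
    assume "germK U (g [^]\<^bsub>sections Y U\<^esub> m) = \<zero>\<^bsub>K\<^esub>"
    then have "germK U (g [^]\<^bsub>sections Y U\<^esub> m) = germK U \<zero>\<^bsub>sections Y U\<^esub>"
      using KG.germ_zero[OF UN(2)] by simp
    then obtain V where V: "V \<in> nonempty_opens Y" "V \<subseteq> U"
      "restr Y U V (g [^]\<^bsub>sections Y U\<^esub> m) = restr Y U V \<zero>\<^bsub>sections Y U\<^esub>"
      unfolding KG.germ_eq_iff[OF UN(2,2) gm(1) R.zero_closed] by blast
    have "V \<noteq> {}" using V(1) by (simp add: nonempty_opens_def)
    then show False
      using Y.restr_inj[OF Uo KG.N_open[OF V(1)] _ V(2) gm(1) R.zero_closed V(3)] gm(2) by blast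
  qed
  then show ?thesis
    using r gm(1) UN(1) W(3) SG.germ_closed[OF UN(1)]
    by (intro bexI[of _ "germS U r"] bexI[of _ "germS U (g [^]\<^bsub>sections Y U\<^esub> m)"])
      (simp_all add: jj_germ)
qed

text \<open>Here the basic open D(g) contains \<open>y\<close>, so the denominator, a power of
  \<open>g\<close>, is a unit of the stalk.\<close>

lemma stalk_fraction:
  assumes U: "affine_open Y U" "y \<in> U" and a: "a \<in> carrier S"
  shows "\<exists>r\<in>carrier (sections Y U). \<exists>u\<in>carrier (sections Y U).
     germS U u \<in> Units S \<and> a \<otimes>\<^bsub>S\<^esub> germS U u = germS U r"
proof -
  obtain W s where W: "W \<in> nbhds Y y" "s \<in> carrier (sections Y W)" "a = germS W s"
    using a by (rule SG.germ_cases)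
  note Uo = Y.affine_is_open[OF U(1)]
  have UN: "U \<in> nbhds Y y" using U(2) Uo by (simp add: nbhds_def)
  have yW: "y \<in> W" using W(1) by (simp add: nbhds_def)
  obtain g where g: "g \<in> carrier (sections Y U)" "y \<in> nonvanishing_locus Y U g" "nonvanishing_locus Y U g \<subseteq> W"
    using Y.affine_basis[OF U(1) SG.N_open[OF W(1)] yW U(2)] by blast
  have D: "nonvanishing_locus Y U g \<in> nbhds Y y"
    using Y.locus_open[OF U(1) g(1)] g(2) by (simp add: nbhds_def)
  obtain r m where r: "r \<in> carrier (sections Y U)"
    "a \<otimes>\<^bsub>S\<^esub> germS U (g [^]\<^bsub>sections Y U\<^esub> (m::nat)) = germS U r"
    using Y.germ_fraction[OF SG.germs_axioms U(1) UN g(1) D g(3) W(1,2)] W(3) by blast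
  interpret R: cring "sections Y U" by (rule Y.sections_cring[OF Uo])
  interpret h: ring_hom_cring "sections Y U" S "germS U"
    by (rule ring_hom_cringI[OF R.cring_axioms S.cring_axioms SG.germ_hom[OF UN]])
  have "germS U g \<in> Units S" using g(2) Y.locus_iff[OF Uo g(1)] by blast
  then have "germS U (g [^]\<^bsub>sections Y U\<^esub> m) \<in> Units S"
    using g(1) by (simp add: S.Units_pow_closed)
  then show ?thesis using r g(1) by blast
qed

lemma affine_finite_type_nbhd:
  "\<exists>U T. affine_open Y U \<and> y \<in> U \<and> finite T \<and> T \<subseteq> carrier (sections Y U) \<and>
     generate_ring (sections Y U) ((\<lambda>c. restr Y (points Y) U (scalar Y c)) ` carrier k \<union> T) = carrier (sections Y U)"
proof -
  have "finite_type_over k Y" using smooth by (simp add: smooth_curve_def integral_curve_def)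
  then obtain \<U> where \<U>: "\<Union>\<U> = points Y"
    "\<forall>U\<in>\<U>. affine_open Y U \<and>
           (\<exists>S. finite S \<and> S \<subseteq> carrier (sections Y U) \<and>
              generate_ring (sections Y U)
                ((\<lambda>c. restr Y (points Y) U (scalar Y c)) ` carrier k \<union> S)
              = carrier (sections Y U))"
    unfolding finite_type_over_def by blast
  then show ?thesis using y by blast
qed

text \<open>As \<open>{y}\<close> is closed, the only prime containing that of \<open>y\<close> is that of \<open>y\<close> itself, so the
  point over \<open>k\<close> supplied by the Nullstellensatz is \<open>y\<close>.\<close>

lemma section_residue:
  "\<exists>U. affine_open Y U \<and> y \<in> U \<and> (\<forall>r\<in>carrier (sections Y U). \<exists>c\<in>carrier k.
      germS U r \<ominus>\<^bsub>S\<^esub> \<kappa> c \<in> max_ideal S)"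
proof -
  obtain U T where U: "affine_open Y U" "y \<in> U" and T: "finite T" "T \<subseteq> carrier (sections Y U)"
    "generate_ring (sections Y U) ((\<lambda>c. restr Y (points Y) U (scalar Y c)) ` carrier k \<union> T) = carrier (sections Y U)"
    using affine_finite_type_nbhd by blast
  let ?R = "sections Y U" and ?s = "\<lambda>c. restr Y (points Y) U (scalar Y c)" and ?p = "vanishing_prime Y U y"
  note Uo = Y.affine_is_open[OF U(1)]
  have UN: "U \<in> nbhds Y y" using U(2) Uo by (simp add: nbhds_def)
  interpret R: cring ?R by (rule Y.sections_cring[OF Uo])
  have po: "open_in Y (points Y)" by simp
  have s: "?s \<in> ring_hom k ?R"
    using ring_hom_trans[OF scalar_hom Y.restr_hom[OF po Uo Y.open_subset[OF Uo]]] by (simp add: comp_def)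
  obtain \<psi> where \<psi>: "\<psi> \<in> ring_hom ?R k" "\<forall>c\<in>carrier k. \<psi> (?s c) = c" "\<forall>r\<in>?p. \<psi> r = \<zero>\<^bsub>k\<^esub>"
    using k.exists_point_over_prime[OF R.cring_axioms s T(1,2,3) Y.vanishing_prime_is_prime[OF U]] by blast
  interpret \<psi>: ring_hom_ring ?R k \<psi> by (intro ring_hom_ringI2 R.ring_axioms k.ring_axioms \<psi>(1))
  define q where "q = {r \<in> carrier ?R. \<psi> r \<in> {\<zero>\<^bsub>k\<^esub>}}"
  have "primeideal q ?R"
    unfolding q_def by (rule \<psi>.primeideal_vimage[OF R.cring_axioms k.zeroprimeideal])
  then obtain z where z: "z \<in> U" "q = vanishing_prime Y U z"
    using Y.affine_bij[OF U(1)] by (auto simp: bij_betw_def prime_spectrum_def)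
  have "z = y"
  proof (rule ccontr)
    assume "z \<noteq> y"
    have W: "open_in Y (points Y - {y})" using closed_y by (simp add: openin_diff)
    have zW: "z \<in> points Y - {y}" using z(1) \<open>z \<noteq> y\<close> Y.open_subset[OF Uo] by auto
    obtain g where g: "g \<in> carrier ?R" "z \<in> nonvanishing_locus Y U g" "nonvanishing_locus Y U g \<subseteq> points Y - {y}"
      using Y.affine_basis[OF U(1) W zW z(1)] by blast
    then have "g \<in> ?p" using U(2) by (auto simp: nonvanishing_locus_def)
    then have "g \<in> q" using g(1) \<psi>(3) by (simp add: q_def)
    then show False using g(2) z(2) by (simp add: nonvanishing_locus_def)
  qed
  have "germS U r \<ominus>\<^bsub>S\<^esub> \<kappa> (\<psi> r) \<in> max_ideal S" if r: "r \<in> carrier ?R" for r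
  proof -
    interpret h: ring_hom_cring ?R S "germS U"
      by (rule ring_hom_cringI[OF R.cring_axioms S.cring_axioms SG.germ_hom[OF UN]])
    \<comment> \<open>The element \<open>r\<close> minus the constant \<psi>(r) is in the kernel of
      \<psi>, which is now known to be the prime of \<open>y\<close>.\<close>
    have sc: "?s (\<psi> r) \<in> carrier ?R" using ring_hom_closed[OF s] r by simp
    have "\<psi> (r \<ominus>\<^bsub>?R\<^esub> ?s (\<psi> r)) = \<zero>\<^bsub>k\<^esub>" using r sc \<psi>(2) by (simp add: a_minus_def k.r_neg)
    then have "r \<ominus>\<^bsub>?R\<^esub> ?s (\<psi> r) \<in> ?p" using r sc z(2) \<open>z = y\<close> by (auto simp: q_def)
    then have "germS U (r \<ominus>\<^bsub>?R\<^esub> ?s (\<psi> r)) \<in> max_ideal S" by (simp add: vanishing_prime_def)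
    moreover have "germS U (?s (\<psi> r)) = \<kappa> (\<psi> r)"
      by (rule SG.germ_restr[OF SG.N_points UN Y.open_subset[OF Uo]])
        (use ring_hom_closed[OF scalar_hom] r in simp)
    ultimately show ?thesis using r sc by (simp add: a_minus_def)
  qed
  then show ?thesis using U by (metis \<psi>.hom_closed)
qed

text \<open>Passage from sections to the stalk: an element is a fraction r/u, and if
  \<open>r\<close> and the unit \<open>u\<close> have residues \<open>c\<close> and
  \<open>d\<close>, then \<open>d\<close> is nonzero and the residue is c/d.\<close>

lemma residue:
  assumes a: "a \<in> carrier S" shows "\<exists>c\<in>carrier k. a \<ominus>\<^bsub>S\<^esub> \<kappa> c \<in> max_ideal S"
proof -
  obtain U where U: "affine_open Y U" "y \<in> U" and res: "\<And>r. r \<in> carrier (sections Y U) \<Longrightarrow> \<exists>c\<in>carrier k.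
      germS U r \<ominus>\<^bsub>S\<^esub> \<kappa> c \<in> max_ideal S"
    using section_residue by blast
  obtain r u where ru: "r \<in> carrier (sections Y U)" "u \<in> carrier (sections Y U)"
    "germS U u \<in> Units S" "a \<otimes>\<^bsub>S\<^esub> germS U u = germS U r"
    using stalk_fraction[OF U a] by blast
  define r' u' where "r' = germS U r" and "u' = germS U u"
  have UN: "U \<in> nbhds Y y" using U(2) Y.affine_is_open[OF U(1)] by (simp add: nbhds_def)
  have ru': "r' \<in> carrier S" "u' \<in> carrier S" "u' \<in> Units S" "a \<otimes>\<^bsub>S\<^esub> u' = r'"
    using ru SG.germ_closed[OF UN] by (auto simp: r'_def u'_def)
  obtain c where c: "c \<in> carrier k" "r' \<ominus>\<^bsub>S\<^esub> \<kappa> c \<in> max_ideal S" using res[OF ru(1)] by (auto simp: r'_def)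
  obtain d where d: "d \<in> carrier k" "u' \<ominus>\<^bsub>S\<^esub> \<kappa> d \<in> max_ideal S" using res[OF ru(2)] by (auto simp: u'_def)
  have \<kappa>: "\<kappa> e \<in> carrier S" if "e \<in> carrier k" for e using that by (rule \<kappa>.hom_closed)
  have "d \<noteq> \<zero>\<^bsub>k\<^esub>"
  proof
    assume "d = \<zero>\<^bsub>k\<^esub>"
    then have "u' \<in> max_ideal S" using d(2) ru'(2) \<kappa>.hom_zero by (simp add: a_minus_def)
    then show False using ru'(3) by (simp add: max_ideal_def)
  qed
  then have dU: "d \<in> Units k" using d(1) by (simp add: k.field_Units)
  define e where "e = inv\<^bsub>k\<^esub> d"
  have e: "e \<in> carrier k" "d \<otimes>\<^bsub>k\<^esub> e = \<one>\<^bsub>k\<^esub>" using dU by (auto simp: e_def)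
  have kde: "\<kappa> d \<otimes>\<^bsub>S\<^esub> \<kappa> e = \<one>\<^bsub>S\<^esub>" using e d(1) by (metis \<kappa>.hom_mult \<kappa>.hom_one)
  have kce: "\<kappa> (c \<otimes>\<^bsub>k\<^esub> e) = \<kappa> c \<otimes>\<^bsub>S\<^esub> \<kappa> e" using c(1) e(1) by (rule \<kappa>.hom_mult)
  have m_minus: "x \<ominus>\<^bsub>S\<^esub> z \<in> max_ideal S" if "x \<in> max_ideal S" "z \<in> max_ideal S" for x z
    unfolding a_minus_def using that by (intro \<mm>.a_closed \<mm>.a_inv_closed)
  \<comment> \<open>Since \<open>a u' = r'\<close>, the bracket equals \<open>a d - c\<close>;
    multiplying by \<open>e\<close>, the inverse of \<open>d\<close>, isolates
    \<open>a\<close>.\<close>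
  have "((r' \<ominus>\<^bsub>S\<^esub> \<kappa> c) \<ominus>\<^bsub>S\<^esub> a \<otimes>\<^bsub>S\<^esub> (u' \<ominus>\<^bsub>S\<^esub> \<kappa> d)) \<otimes>\<^bsub>S\<^esub> \<kappa> e \<in> max_ideal S"
    by (rule \<mm>.I_r_closed[OF m_minus[OF c(2) \<mm>.I_l_closed[OF d(2) a]] \<kappa>[OF e(1)]])
  moreover have "((r' \<ominus>\<^bsub>S\<^esub> \<kappa> c) \<ominus>\<^bsub>S\<^esub> a \<otimes>\<^bsub>S\<^esub> (u' \<ominus>\<^bsub>S\<^esub> \<kappa> d)) = a \<otimes>\<^bsub>S\<^esub> \<kappa> d \<ominus>\<^bsub>S\<^esub> \<kappa> c"
    unfolding ru'(4)[symmetric] using a ru'(2) \<kappa>[OF c(1)] \<kappa>[OF d(1)]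
    by (simp add: a_minus_def S.r_distr S.r_minus S.minus_add S.a_ac S.r_neg1 S.r_neg2)
  moreover have "(a \<otimes>\<^bsub>S\<^esub> \<kappa> d \<ominus>\<^bsub>S\<^esub> \<kappa> c) \<otimes>\<^bsub>S\<^esub> \<kappa> e = a \<ominus>\<^bsub>S\<^esub> \<kappa> (c \<otimes>\<^bsub>k\<^esub> e)"
    unfolding kce using a \<kappa>[OF c(1)] \<kappa>[OF d(1)] \<kappa>[OF e(1)] kde
    by (simp add: a_minus_def S.l_distr S.l_minus S.m_assoc)
  ultimately show ?thesis using c(1) e(1) by (metis k.m_closed)
qed

text \<open>Otherwise the prime of \<open>y\<close> in an affine neighbourhood is zero, so
  \<open>y\<close> lies in every nonempty basic open. As {y} is closed, \<open>y\<close> would be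
  the only point, against dimension one.\<close>

lemma max_ideal_nonzero: "max_ideal S \<noteq> {\<zero>\<^bsub>S\<^esub>}"
proof
  assume zero: "max_ideal S = {\<zero>\<^bsub>S\<^esub>}"
  obtain U where U: "y \<in> U" "affine_open Y U" using Y.exists_affine[OF y] by blast
  note Uo = Y.affine_is_open[OF U(2)]
  have UN: "U \<in> nbhds Y y" using U(1) Uo by (simp add: nbhds_def)
  interpret R: cring "sections Y U" by (rule Y.sections_cring[OF Uo])
  have p0: "g = \<zero>\<^bsub>sections Y U\<^esub>" if g: "g \<in> vanishing_prime Y U y" for g
  proof -
    have gR: "g \<in> carrier (sections Y U)" using g by (simp add: vanishing_prime_def)
    have "germS U g = germS U \<zero>\<^bsub>sections Y U\<^esub>"
      using g zero SG.germ_zero[OF UN] by (simp add: vanishing_prime_def)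
    then obtain V where V: "V \<in> nbhds Y y" "V \<subseteq> U" "restr Y U V g = restr Y U V \<zero>\<^bsub>sections Y U\<^esub>"
      unfolding SG.germ_eq_iff[OF UN UN gR R.zero_closed] by blast
    have "V \<noteq> {}" using V(1) by (auto simp: nbhds_def)
    then show ?thesis
      using Y.restr_inj[OF Uo SG.N_open[OF V(1)] _ V(2) gR R.zero_closed V(3)] by blast
  qed
  have "points Y = {y}"
  proof (rule ccontr)
    assume "points Y \<noteq> {y}"
    then have W: "open_in Y (points Y - {y})" "points Y - {y} \<noteq> {}" using closed_y y by (auto simp: openin_diff)
    then obtain z where z: "z \<in> points Y - {y}" "z \<in> U" using Y.irreducible[OF W Uo] U(1) by blast
    obtain g where g: "g \<in> carrier (sections Y U)" "z \<in> nonvanishing_locus Y U g"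
      "nonvanishing_locus Y U g \<subseteq> points Y - {y}"
      using Y.affine_basis[OF U(2) W(1) z] by blast
    then have "g \<in> vanishing_prime Y U y" using U(1) by (auto simp: nonvanishing_locus_def)
    then show False using p0 Y.locus_empty[OF U(2)] g(2) by auto
  qed
  moreover have "chain_dim (irreducible_closed_sets (space_top Y)) 1"
    using smooth by (simp add: smooth_curve_def integral_curve_def)
  then obtain C where "strict_chain (irreducible_closed_sets (space_top Y)) 1 C"
    by (auto simp: chain_dim_def)
  then have "C 0 \<in> irreducible_closed_sets (space_top Y)" "C 1 \<in> irreducible_closed_sets (space_top Y)" "C 0 \<subset> C 1"
    by (auto simp: strict_chain_def)
  then have C: "C 0 \<noteq> {}" "C 0 \<subset> C 1" "C 1 \<subseteq> points Y"
    by (auto simp: irreducible_closed_sets_def dest: closedin_subset)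
  ultimately have "C 0 \<subset> {y}" by simp
  then have "C 0 = {}" by auto
  then show False using C(1) by simp
qed

text \<open>Three nested primes of the stalk contract to primes of an affine neighbourhood, that is,
  to points whose closures form a chain of length 2 in a space of dimension one.\<close>

lemma no_long_chain: "\<not> strict_chain (prime_spectrum S) 2 Q"
proof
  assume Q: "strict_chain (prime_spectrum S) 2 Q"
  obtain U where U: "y \<in> U" "affine_open Y U" using Y.exists_affine[OF y] by blast
  note Uo = Y.affine_is_open[OF U(2)]
  have UN: "U \<in> nbhds Y y" using U(1) Uo by (simp add: nbhds_def)
  interpret R: cring "sections Y U" by (rule Y.sections_cring[OF Uo])
  let ?g = "germS U"
  interpret h: ring_hom_ring "sections Y U" S ?g
    by (intro ring_hom_ringI2 R.ring_axioms S.ring_axioms SG.germ_hom[OF UN])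
  define q where "q i = {r \<in> carrier (sections Y U). ?g r \<in> Q i}" for i
  have Qp: "primeideal (Q i) S" if "i \<le> 2" for i
    using Q that by (simp add: strict_chain_def prime_spectrum_def)
  have "\<exists>x\<in>U. vanishing_prime Y U x = q i" if "i \<le> 2" for i
  proof -
    have "primeideal (q i) (sections Y U)"
      unfolding q_def by (rule h.primeideal_vimage[OF R.cring_axioms Qp[OF that]])
    then have "q i \<in> vanishing_prime Y U ` U"
      using Y.affine_bij[OF U(2)] by (simp add: bij_betw_def prime_spectrum_def)
    then show ?thesis by (metis imageE)
  qed
  then obtain x where x: "\<And>i. i \<le> 2 \<Longrightarrow> x i \<in> U" "\<And>i. i \<le> (2::nat) \<Longrightarrow> vanishing_prime Y U (x i) = q i"
    by metis
  \<comment> \<open>Contraction keeps inclusions strict: an element of the larger prime only is, up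
    to a unit of the stalk, the germ of a section over U.\<close>
  have q_less: "q i \<subset> q (Suc i)" if i: "i < 2" for i
  proof -
    have lt: "Q i \<subset> Q (Suc i)" using Q i by (simp add: strict_chain_def)
    then obtain a where a: "a \<in> Q (Suc i)" "a \<notin> Q i" by blast
    interpret P: primeideal "Q i" S using Qp i by simp
    interpret P': primeideal "Q (Suc i)" S using Qp i by simp
    have aS: "a \<in> carrier S" using a(1) P'.a_subset by auto
    obtain r u where ru: "r \<in> carrier (sections Y U)" "u \<in> carrier (sections Y U)" "?g u \<in> Units S"
      "a \<otimes>\<^bsub>S\<^esub> ?g u = ?g r" using stalk_fraction[OF U(2,1) aS] by blast
    have gu: "?g u \<in> carrier S" using ru(2) by simp
    have "?g r \<in> Q (Suc i)" unfolding ru(4)[symmetric] using a(1) gu by (rule P'.I_r_closed)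
    moreover have "?g r \<notin> Q i"
    proof
      assume "?g r \<in> Q i"
      then have "a \<otimes>\<^bsub>S\<^esub> ?g u \<otimes>\<^bsub>S\<^esub> inv\<^bsub>S\<^esub> ?g u \<in> Q i"
        unfolding ru(4) using ru(3) by (intro P.I_r_closed) auto
      then show False using a(2) aS gu ru(3) by (simp add: S.m_assoc)
    qed
    ultimately have "r \<in> q (Suc i)" "r \<notin> q i" using ru(1) by (auto simp: q_def)
    then show ?thesis using lt by (auto simp: q_def)
  qed
  \<comment> \<open>The index is reversed because a larger prime has a smaller closure.\<close>
  let ?C = "\<lambda>i. space_top Y closure_of {x (2 - i)}"
  have "strict_chain (irreducible_closed_sets (space_top Y)) 2 ?C"
    unfolding strict_chain_def
  proof (intro conjI allI impI)
    show "?C i \<in> irreducible_closed_sets (space_top Y)" for i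
      using x(1)[of "2 - i"] Y.open_subset[OF Uo] by (intro Y.closure_of_point_irreducible) auto
    fix i :: nat assume "i < 2"
    then have i: "2 - i = Suc (2 - Suc i)" "2 - Suc i < 2" by auto
    show "?C i \<subset> ?C (Suc i)"
      using x[of "2 - Suc i"] x[of "2 - i"] q_less[OF i(2)] unfolding i(1)
      by (intro Y.closure_of_point_strict[OF U(2)]) auto
  qed
  moreover have "chain_dim (irreducible_closed_sets (space_top Y)) 1"
    using smooth by (simp add: smooth_curve_def integral_curve_def)
  ultimately show False by (auto simp: chain_dim_def numeral_2_eq_2)
qed

lemma regular: "regular_local_ring S"
  using smooth y by (simp add: smooth_curve_def)

text \<open>Regularity generates the maximal ideal by as many elements as the dimension of the
  stalk. That number is below 2 by \<open>no_long_chain\<close>, and it is not 0 because the empty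
  set generates only the zero ideal.\<close>

lemma uniformiser: "\<exists>t\<in>carrier S. t \<noteq> \<zero>\<^bsub>S\<^esub> \<and> max_ideal S = {a \<otimes>\<^bsub>S\<^esub> t | a. a \<in> carrier S}"
proof -
  obtain d T where d: "chain_dim (prime_spectrum S) d" "T \<subseteq> carrier S" "finite T" "card T = d"
    "genideal S T = max_ideal S" using regular by (auto simp: regular_local_ring_def)
  obtain Q where Q: "strict_chain (prime_spectrum S) d Q" using d(1) by (auto simp: chain_dim_def)
  have "\<not> 2 \<le> d"
  proof
    assume "2 \<le> d"
    then have "strict_chain (prime_spectrum S) 2 Q" using Q by (simp add: strict_chain_def)
    then show False using no_long_chain by blast
  qed
  moreover have "d \<noteq> 0"
  proof
    assume "d = 0"
    then have "T = {}" using d(3,4) by simp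
    then have "max_ideal S \<subseteq> {\<zero>\<^bsub>S\<^esub>}" using S.genideal_minimal[OF S.zeroideal, of "{}"] d(5) by simp
    then show False using max_ideal_nonzero \<mm>.zero_closed by blast
  qed
  ultimately have "card T = 1" using d(4) by linarith
  then obtain t where T: "T = {t}" by (auto simp: card_1_singleton_iff)
  have t: "t \<in> carrier S" using d(2) T by simp
  have m: "max_ideal S = PIdl\<^bsub>S\<^esub> t" using d(5) T S.cgenideal_eq_genideal[OF t] by simp
  have t0: "t \<noteq> \<zero>\<^bsub>S\<^esub>"
  proof
    assume "t = \<zero>\<^bsub>S\<^esub>"
    then have "max_ideal S = {\<zero>\<^bsub>S\<^esub>}" using m S.genideal_zero S.cgenideal_eq_genideal[OF t] by simp
    then show False using max_ideal_nonzero by blast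
  qed
  have "max_ideal S = {a \<otimes>\<^bsub>S\<^esub> t | a. a \<in> carrier S}"
    unfolding m cgenideal_def by (rule refl)
  then show ?thesis using t t0 by blast
qed

lemma stalk_Krull:
  assumes "t \<in> max_ideal S" "a \<in> carrier S" "\<And>i::nat. \<exists>b\<in>carrier S. a = b \<otimes>\<^bsub>S\<^esub> t [^]\<^bsub>S\<^esub> i"
  shows "a = \<zero>\<^bsub>S\<^esub>"
proof -
  interpret noetherian_ring S using regular by (simp add: regular_local_ring_def)
  interpret noetherian_domain S ..
  show ?thesis using Krull_principal[of t a] assms by (simp add: max_ideal_iff)
qed

end


section \<open>Automorphisms fixing \<open>y\<close> and their action on the stalk\<close>

section \<open>The inertia group of a cover\<close>

lemma preim_mono: "V \<subseteq> U \<Longrightarrow> preim Y f V \<subseteq> preim Y f U"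
  and preim_Int: "preim Y f (U \<inter> V) = preim Y f U \<inter> preim Y f V"
  by (auto simp: preim_def)

lemma scheme_morphismD:
  assumes "scheme_morphism Y Z f F"
  shows "continuous_map (space_top Y) (space_top Z) f"
    and "open_in Z U \<Longrightarrow> F U \<in> ring_hom (sections Z U) (sections Y (preim Y f U))"
    and "open_in Z U \<Longrightarrow> open_in Z V \<Longrightarrow> V \<subseteq> U \<Longrightarrow> a \<in> carrier (sections Z U) \<Longrightarrow>
           F V (restr Z U V a) = restr Y (preim Y f U) (preim Y f V) (F U a)"
    and "open_in Z U \<Longrightarrow> a \<in> carrier (sections Z U) \<Longrightarrow> x \<in> preim Y f U \<Longrightarrow>
           a \<in> vanishing_prime Z U (f x) \<Longrightarrow> F U a \<in> vanishing_prime Y (preim Y f U) x"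
proof -
  note d = assms[unfolded scheme_morphism_def]
  show "continuous_map (space_top Y) (space_top Z) f" by (rule d[THEN conjunct1])
  show "open_in Z U \<Longrightarrow> F U \<in> ring_hom (sections Z U) (sections Y (preim Y f U))"
    by (rule d[THEN conjunct2, THEN conjunct1, rule_format])
  show "open_in Z U \<Longrightarrow> open_in Z V \<Longrightarrow> V \<subseteq> U \<Longrightarrow> a \<in> carrier (sections Z U) \<Longrightarrow>
      F V (restr Z U V a) = restr Y (preim Y f U) (preim Y f V) (F U a)"
    by (rule d[THEN conjunct2, THEN conjunct2, THEN conjunct1, rule_format])
  show "open_in Z U \<Longrightarrow> a \<in> carrier (sections Z U) \<Longrightarrow> x \<in> preim Y f U \<Longrightarrow>
      a \<in> vanishing_prime Z U (f x) \<Longrightarrow> F U a \<in> vanishing_prime Y (preim Y f U) x"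
    by (rule d[THEN conjunct2, THEN conjunct2, THEN conjunct2, rule_format])
qed

lemma automorphism_overD:
  assumes "automorphism_over Y Z f F h H"
  shows "scheme_morphism Y Y h H" "homeomorphic_map (space_top Y) (space_top Y) h"
    and "open_in Y V \<Longrightarrow> H V \<in> ring_iso (sections Y V) (sections Y (preim Y h V))"
    and "x \<in> points Y \<Longrightarrow> f (h x) = f x"
    and "open_in Z U \<Longrightarrow> a \<in> carrier (sections Z U) \<Longrightarrow> H (preim Y f U) (F U a) = F U a"
proof -
  note d = assms[unfolded automorphism_over_def]
  show "scheme_morphism Y Y h H" by (rule d[THEN conjunct1])
  show "homeomorphic_map (space_top Y) (space_top Y) h" by (rule d[THEN conjunct2, THEN conjunct1])
  show "open_in Y V \<Longrightarrow> H V \<in> ring_iso (sections Y V) (sections Y (preim Y h V))"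
    by (rule d[THEN conjunct2, THEN conjunct2, THEN conjunct1, rule_format])
  show "x \<in> points Y \<Longrightarrow> f (h x) = f x"
    by (rule d[THEN conjunct2, THEN conjunct2, THEN conjunct2, THEN conjunct1, rule_format])
  show "open_in Z U \<Longrightarrow> a \<in> carrier (sections Z U) \<Longrightarrow> H (preim Y f U) (F U a) = F U a"
    by (rule d[THEN conjunct2, THEN conjunct2, THEN conjunct2, THEN conjunct2, rule_format])
qed

lemma preim_open:
  assumes "scheme_morphism Y Z f F" "open_in Z U" shows "open_in Y (preim Y f U)"
  using openin_continuous_map_preimage[OF scheme_morphismD(1)[OF assms(1)] assms(2)]
  by (simp add: preim_def)

lemma preim_points:
  assumes "scheme_morphism Y Z f F" shows "preim Y f (points Z) = points Y"
  using continuous_map_image_subset_topspace[OF scheme_morphismD(1)[OF assms]] by (auto simp: preim_def)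

lemma germs_map_pullback:
  assumes mor: "scheme_morphism Y Z f F" and N: "germs Z N" and N': "germs Y N'"
    and preim: "\<And>U. U \<in> N \<Longrightarrow> preim Y f U \<in> N'"
  shows "germs_map Z N Y N' (preim Y f) F" and "germs_map.induced Y N' (preim Y f) F = germ_pullback Y N' f F"
proof -
  interpret N: germs Z N by fact
  show *: "germs_map Z N Y N' (preim Y f) F"
  proof (rule germs_map.intro[OF N N'], rule germs_map_axioms.intro)
    show "preim Y f U \<in> N'" if "U \<in> N" for U using that by (rule preim)
    show "preim Y f (U \<inter> V) = preim Y f U \<inter> preim Y f V" for U V by (rule preim_Int)
    show "F U \<in> ring_hom (sections Z U) (sections Y (preim Y f U))" if "U \<in> N" for U
      by (rule scheme_morphismD(2)[OF mor N.N_open[OF that]])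
    show "F V (restr Z U V a) = restr Y (preim Y f U) (preim Y f V) (F U a)"
      if "U \<in> N" "V \<in> N" "V \<subseteq> U" "a \<in> carrier (sections Z U)" for U V a
      by (rule scheme_morphismD(3)[OF mor N.N_open[OF that(1)] N.N_open[OF that(2)] that(3,4)])
  qed
  show "germs_map.induced Y N' (preim Y f) F = germ_pullback Y N' f F"
    unfolding germs_map.induced_def[OF *] germ_pullback_def by (rule refl)
qed

lemma pullback_germ:
  assumes "scheme_morphism Y Z f F" "germs Z N" "germs Y N'" "\<And>U. U \<in> N \<Longrightarrow> preim Y f U \<in> N'"
    and "U \<in> N" "a \<in> carrier (sections Z U)"
  shows "germ_pullback Y N' f F (germ Z N U a) = germ Y N' (preim Y f U) (F U a)"
proof -
  have 1: "germs_map Z N Y N' (preim Y f) F"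
    by (rule germs_map_pullback(1)[OF assms(1-3)]) (rule assms(4))
  have 2: "germs_map.induced Y N' (preim Y f) F = germ_pullback Y N' f F"
    by (rule germs_map_pullback(2)[OF assms(1-3)]) (rule assms(4))
  show ?thesis using germs_map.induced_germ[OF 1 assms(5,6)] unfolding 2 .
qed

lemma automorphism_over_id:
  assumes "ringed_space Y"
  shows "automorphism_over Y Z f F (\<lambda>x. x) (\<lambda>U a. a)"
proof -
  have p: "preim Y (\<lambda>x. x) U = U" if "open_in Y U" for U
    using openin_subset[OF that] by (auto simp: preim_def)
  show ?thesis
    unfolding automorphism_over_def scheme_morphism_def
    by (intro conjI allI impI ballI homeomorphic_map_id[unfolded id_def])
      (simp_all add: p ring_hom_def ring_iso_def bij_betw_def inj_on_def homeomorphic_map_id[unfolded id_def])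
qed

lemma automorphism_over_comp:
  assumes Y: "ringed_space Y" and f: "scheme_morphism Y Z f F"
    and 1: "automorphism_over Y Z f F h1 H1" and 2: "automorphism_over Y Z f F h2 H2"
  shows "automorphism_over Y Z f F (\<lambda>x. h1 (h2 x)) (\<lambda>U a. H2 (preim Y h1 U) (H1 U a))"
proof -
  note m1 = automorphism_overD(1)[OF 1] and m2 = automorphism_overD(1)[OF 2]
    and hom1 = automorphism_overD(2)[OF 1] and hom2 = automorphism_overD(2)[OF 2]
    and i1 = automorphism_overD(3)[OF 1] and i2 = automorphism_overD(3)[OF 2]
    and f1 = automorphism_overD(4)[OF 1] and f2 = automorphism_overD(4)[OF 2]
    and F1 = automorphism_overD(5)[OF 1] and F2 = automorphism_overD(5)[OF 2]
  have pts: "h2 x \<in> points Y" if "x \<in> points Y" for x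
    using continuous_map_image_subset_topspace[OF scheme_morphismD(1)[OF m2]] that by auto
  have pts1: "h1 x \<in> points Y" if "x \<in> points Y" for x
    using continuous_map_image_subset_topspace[OF scheme_morphismD(1)[OF m1]] that by auto
  have p: "preim Y (\<lambda>x. h1 (h2 x)) U = preim Y h2 (preim Y h1 U)" for U
    using pts by (auto simp: preim_def)
  \<comment> \<open>Since \<open>h1\<close> lies over Z, preimages under \<open>f\<close> are stable
    under it.\<close>
  have pf: "preim Y h1 (preim Y f U) = preim Y f U" for U
    using pts1 f1 by (auto simp: preim_def)
  have o1: "open_in Y (preim Y h1 U)" if "open_in Y U" for U using preim_open[OF m1 that] .
  have cl: "H1 U a \<in> carrier (sections Y (preim Y h1 U))" if "open_in Y U" "a \<in> carrier (sections Y U)" for U a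
    using ring_hom_closed[OF scheme_morphismD(2)[OF m1 that(1)] that(2)] .
  have mor: "scheme_morphism Y Y (\<lambda>x. h1 (h2 x)) (\<lambda>U a. H2 (preim Y h1 U) (H1 U a))"
    unfolding scheme_morphism_def p
  proof (intro conjI allI impI ballI)
    show "continuous_map (space_top Y) (space_top Y) (\<lambda>x. h1 (h2 x))"
      using continuous_map_compose[OF scheme_morphismD(1)[OF m2] scheme_morphismD(1)[OF m1]] by (simp add: comp_def)
    fix U assume U: "open_in Y U"
    show "(\<lambda>a. H2 (preim Y h1 U) (H1 U a)) \<in> ring_hom (sections Y U) (sections Y (preim Y h2 (preim Y h1 U)))"
      using ring_hom_trans[OF scheme_morphismD(2)[OF m1 U] scheme_morphismD(2)[OF m2 o1[OF U]]] by (simp add: comp_def)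
    fix a assume a: "a \<in> carrier (sections Y U)"
    {
      fix V assume V: "open_in Y V" "V \<subseteq> U"
      show "H2 (preim Y h1 V) (H1 V (restr Y U V a)) =
          restr Y (preim Y h2 (preim Y h1 U)) (preim Y h2 (preim Y h1 V)) (H2 (preim Y h1 U) (H1 U a))"
        unfolding scheme_morphismD(3)[OF m1 U V a]
        by (rule scheme_morphismD(3)[OF m2 o1[OF U] o1[OF V(1)] preim_mono[OF V(2)] cl[OF U a]])
    next
      fix x assume x: "x \<in> preim Y h2 (preim Y h1 U)" and van: "a \<in> vanishing_prime Y U (h1 (h2 x))"
      have "h2 x \<in> preim Y h1 U" using x by (simp add: preim_def)
      then have "H1 U a \<in> vanishing_prime Y (preim Y h1 U) (h2 x)"
        using van by (rule scheme_morphismD(4)[OF m1 U a])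
      then show "H2 (preim Y h1 U) (H1 U a) \<in> vanishing_prime Y (preim Y h2 (preim Y h1 U)) x"
        by (rule scheme_morphismD(4)[OF m2 o1[OF U] cl[OF U a] x])
    }
  qed
  show ?thesis
    unfolding automorphism_over_def
  proof (intro conjI allI impI ballI mor)
    show "homeomorphic_map (space_top Y) (space_top Y) (\<lambda>x. h1 (h2 x))"
      using homeomorphic_map_compose[OF hom2 hom1] by (simp add: comp_def)
    show "f (h1 (h2 x)) = f x" if "x \<in> points Y" for x using f1[OF pts[OF that]] f2[OF that] by simp
    show "(\<lambda>a. H2 (preim Y h1 V) (H1 V a)) \<in> ring_iso (sections Y V) (sections Y (preim Y (\<lambda>x. h1 (h2 x)) V))"
      if "open_in Y V" for V
      unfolding p using ring_iso_set_trans[OF i1[OF that] i2[OF o1[OF that]]] by (simp add: comp_def)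
    show "H2 (preim Y h1 (preim Y f U)) (H1 (preim Y f U) (F U a)) = F U a"
      if "open_in Z U" "a \<in> carrier (sections Z U)" for U a
      unfolding pf F1[OF that] by (rule F2[OF that])
  qed
qed

text \<open>\<open>group_G\<close> is supplied in the theorem by \<open>group_module\<close>, which
  includes that the acting object is a group.\<close>

locale pointed_cover = pointed_curve k Y y for k :: "'k ring" and Y :: "('k, 'y, 's) space_over" and y +
  fixes Z :: "('k, 'x, 'r) space_over" and f :: "'y \<Rightarrow> 'x" and F :: "'x set \<Rightarrow> 'r \<Rightarrow> 's"
  assumes smooth_Z: "smooth_curve k Z" and mor_over: "morphism_over k Y Z f F"
    and galois: "generically_galois Y Z f F" and group_G: "group (cover_group Y Z f F)"

sublocale pointed_cover \<subseteq> Z: is_integral_scheme Z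
  using smooth_Z by unfold_locales (simp add: smooth_curve_def integral_curve_def)

context pointed_cover
begin

abbreviation "G \<equiv> cover_group Y Z f F"
abbreviation "I \<equiv> inertia_group Y Z f F y"
abbreviation "E \<equiv> base_function_field Y Z f F"
abbreviation "pullbackK \<equiv> germ_pullback Y (nonempty_opens Y)"
abbreviation "\<iota> c \<equiv> jj (\<kappa> c)"

sublocale G: group G by (rule group_G)

lemma mor: "scheme_morphism Y Z f F" using mor_over by (simp add: morphism_over_def)

lemma G_def: "G = galois_group K E" by (simp add: cover_group_def)

lemma finite_G: "finite (carrier G)"
  using galois finite_galois_group unfolding generically_galois_def G_def by blast

lemma iota_hom: "\<iota> \<in> ring_hom k K"
  using ring_hom_trans[OF kappa_hom jj.homh] by (simp add: comp_def)

lemma scalar_germ_closed: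
  assumes "c \<in> carrier k"
  shows "scalar Y c \<in> carrier (sections Y (points Y))" "scalar Z c \<in> carrier (sections Z (points Z))"
proof -
  have "scalar Z \<in> ring_hom k (sections Z (points Z))"
    using smooth_Z by (simp add: smooth_curve_def integral_curve_def scheme_over_def)
  then show "scalar Z c \<in> carrier (sections Z (points Z))" using assms by (rule ring_hom_closed)
  show "scalar Y c \<in> carrier (sections Y (points Y))" using scalar_hom assms by (rule ring_hom_closed)
qed

text \<open>As the morphism is over \<open>k\<close>, a constant of Y is the pullback of the same
  constant of Z; dominance keeps preimages of nonempty opens nonempty.\<close>

lemma iota_E:
  assumes c: "c \<in> carrier k" shows "\<iota> c \<in> E"
proof -
  note gZ = Z.germs_nonempty
  have ne: "preim Y f U \<in> nonempty_opens Y" if "U \<in> nonempty_opens Z" for U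
    using that galois preim_open[OF mor] by (auto simp: generically_galois_def dominant_def nonempty_opens_def)
  have pZ: "points Z \<in> nonempty_opens Z" using germs.N_points[OF gZ] .
  let ?A = "germ Z (nonempty_opens Z) (points Z) (scalar Z c)"
  have "pullbackK f F ?A =
      germK (preim Y f (points Z)) (F (points Z) (scalar Z c))"
    by (rule pullback_germ[OF mor gZ Y.germs_nonempty _ pZ scalar_germ_closed(2)[OF c]]) (rule ne)
  also have "\<dots> = germK (points Y) (scalar Y c)"
    using mor_over c unfolding preim_points[OF mor] morphism_over_def by simp
  also have "\<dots> = \<iota> c" by (rule jj_germ[OF SG.N_points scalar_germ_closed(1)[OF c], symmetric])
  finally have "\<iota> c = pullbackK f F ?A" by simp
  moreover have "?A \<in> carrier (function_field Z)"
    by (rule germs.germ_closed[OF gZ pZ scalar_germ_closed(2)[OF c]])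
  ultimately show ?thesis unfolding base_function_field_def by (rule image_eqI)
qed

definition represents where
  "represents h H \<sigma> \<longleftrightarrow> automorphism_over Y Z f F h H \<and>
     (\<forall>A\<in>carrier K. pullbackK h H A = (inv\<^bsub>G\<^esub> \<sigma>) A) \<and> h y = y"

lemma I_iff: "\<sigma> \<in> I \<longleftrightarrow> \<sigma> \<in> carrier G \<and> (\<exists>h H. represents h H \<sigma>)"
  by (simp add: inertia_group_def represents_def)

context
  fixes h H assumes aut: "automorphism_over Y Z f F h H"
begin

lemma aut_mor: "scheme_morphism Y Y h H"
  by (rule automorphism_overD(1)[OF aut])

lemma aut_preim_nonempty: "U \<in> nonempty_opens Y \<Longrightarrow> preim Y h U \<in> nonempty_opens Y"
proof -
  assume U: "U \<in> nonempty_opens Y"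
  then obtain x where x: "x \<in> U" "x \<in> points Y" using Y.open_subset by (auto simp: nonempty_opens_def)
  have "h ` points Y = points Y"
    by (rule homeomorphic_imp_surjective_map[OF automorphism_overD(2)[OF aut]])
  then obtain z where "z \<in> points Y" "h z = x" using x(2) by (metis imageE)
  then have "z \<in> preim Y h U" using x by (simp add: preim_def)
  then show "preim Y h U \<in> nonempty_opens Y"
    using U preim_open[OF aut_mor] by (auto simp: nonempty_opens_def)
qed

lemma aut_pullback_K:
  assumes "U \<in> nonempty_opens Y" "a \<in> carrier (sections Y U)"
  shows "pullbackK h H (germK U a) =
           germK (preim Y h U) (H U a)"
  by (rule pullback_germ[OF aut_mor Y.germs_nonempty Y.germs_nonempty _ assms]) (rule aut_preim_nonempty)

lemma aut_preim_nbhds: "h y = y \<Longrightarrow> U \<in> nbhds Y y \<Longrightarrow> preim Y h U \<in> nbhds Y y"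
  using y preim_open[OF aut_mor] by (simp add: nbhds_def preim_def)

text \<open>Pullback preserves neighbourhoods of the fixed point \<open>y\<close>, and the last
  clause of \<open>scheme_morphism\<close> makes it local there.\<close>

lemma aut_pullback_jj:
  assumes hy: "h y = y" and a: "a \<in> carrier S"
  shows "\<exists>b\<in>carrier S. pullbackK h H (jj a) = jj b \<and>
           (a \<in> max_ideal S \<longrightarrow> b \<in> max_ideal S)"
proof -
  obtain U s where U: "U \<in> nbhds Y y" "s \<in> carrier (sections Y U)" "a = germS U s"
    using a by (rule SG.germ_cases)
  note o = SG.N_open[OF U(1)]
  have pU: "preim Y h U \<in> nbhds Y y" by (rule aut_preim_nbhds[OF hy U(1)])
  have yp: "y \<in> preim Y h U" using pU by (simp add: nbhds_def)
  have Hs: "H U s \<in> carrier (sections Y (preim Y h U))"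
    by (rule ring_hom_closed[OF scheme_morphismD(2)[OF aut_mor o] U(2)])
  let ?b = "germS (preim Y h U) (H U s)"
  have "pullbackK h H (jj a) = jj ?b"
    unfolding U(3) jj_germ[OF U(1,2)] jj_germ[OF pU Hs] by (rule aut_pullback_K[OF nbhds_nonempty[OF U(1)] U(2)])
  moreover have "?b \<in> max_ideal S" if "a \<in> max_ideal S"
  proof -
    have "s \<in> vanishing_prime Y U (h y)" using that U hy by (simp add: vanishing_prime_def)
    then have "H U s \<in> vanishing_prime Y (preim Y h U) y"
      by (rule scheme_morphismD(4)[OF aut_mor o U(2) yp])
    then show ?thesis by (simp add: vanishing_prime_def)
  qed
  ultimately show ?thesis using SG.germ_closed[OF pU Hs] by blast
qed

end

lemma I_one: "\<one>\<^bsub>G\<^esub> \<in> I"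
proof -
  note aut = automorphism_over_id[OF Y.ringed, of Z f F]
  have "pullbackK (\<lambda>x. x) (\<lambda>U a. a) A = (inv\<^bsub>G\<^esub> \<one>\<^bsub>G\<^esub>) A" if A: "A \<in> carrier K" for A
  proof -
    obtain U a where U: "U \<in> nonempty_opens Y" "a \<in> carrier (sections Y U)" "A = germK U a"
      using A by (rule KG.germ_cases)
    have "preim Y (\<lambda>x. x) U = U" using Y.open_subset[OF KG.N_open[OF U(1)]] by (auto simp: preim_def)
    then have "pullbackK (\<lambda>x. x) (\<lambda>U a. a) A = A"
      unfolding U(3) aut_pullback_K[OF aut U(1,2)] by simp
    moreover have "(inv\<^bsub>G\<^esub> \<one>\<^bsub>G\<^esub>) A = A" 
      unfolding G.inv_one unfolding G_def galois_group_one using A by simp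
    ultimately show ?thesis by simp
  qed
  then have "represents (\<lambda>x. x) (\<lambda>U a. a) \<one>\<^bsub>G\<^esub>" using aut by (simp add: represents_def)
  then show ?thesis using I_iff G.one_closed by blast
qed

lemma G_closed: "\<sigma> \<in> carrier G \<Longrightarrow> A \<in> carrier K \<Longrightarrow> \<sigma> A \<in> carrier K"
  using ring_hom_closed[OF galois_groupD(1)] unfolding G_def .

lemma G_mult_apply:
  assumes "\<sigma> \<in> carrier G" "\<tau> \<in> carrier G" "A \<in> carrier K"
  shows "(\<sigma> \<otimes>\<^bsub>G\<^esub> \<tau>) A = \<sigma> (\<tau> A)"
proof -
  have "\<sigma> \<otimes>\<^bsub>G\<^esub> \<tau> = compose (carrier K) \<sigma> \<tau>"
    unfolding G_def by (rule galois_group_mult) (use assms in \<open>simp_all add: G_def\<close>)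
  then show ?thesis using assms(3) by (simp add: compose_def)
qed

text \<open>Pullback along a composite reverses the order of the factors, and so does inversion in
  the group; the two reversals match.\<close>

lemma I_mult:
  assumes \<sigma>: "\<sigma> \<in> I" and \<tau>: "\<tau> \<in> I" shows "\<sigma> \<otimes>\<^bsub>G\<^esub> \<tau> \<in> I"
proof -
  obtain h1 H1 where 1: "represents h1 H1 \<sigma>" using \<sigma> I_iff by blast
  obtain h2 H2 where 2: "represents h2 H2 \<tau>" using \<tau> I_iff by blast
  have G: "\<sigma> \<in> carrier G" "\<tau> \<in> carrier G" using \<sigma> \<tau> I_iff by auto
  note a1 = 1[unfolded represents_def, THEN conjunct1] and a2 = 2[unfolded represents_def, THEN conjunct1]
  have r1: "pullbackK h1 H1 A = (inv\<^bsub>G\<^esub> \<sigma>) A" if "A \<in> carrier K" for A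
    using 1 that by (simp add: represents_def)
  have r2: "pullbackK h2 H2 A = (inv\<^bsub>G\<^esub> \<tau>) A" if "A \<in> carrier K" for A
    using 2 that by (simp add: represents_def)
  let ?h = "\<lambda>x. h1 (h2 x)" and ?H = "\<lambda>U a. H2 (preim Y h1 U) (H1 U a)"
  note aut = automorphism_over_comp[OF Y.ringed mor a1 a2]
  have "pullbackK ?h ?H A = (inv\<^bsub>G\<^esub> (\<sigma> \<otimes>\<^bsub>G\<^esub> \<tau>)) A" if A: "A \<in> carrier K" for A
  proof -
    obtain U a where U: "U \<in> nonempty_opens Y" "a \<in> carrier (sections Y U)" "A = germK U a"
      using A by (rule KG.germ_cases)
    have pU: "preim Y h1 U \<in> nonempty_opens Y" by (rule aut_preim_nonempty[OF a1 U(1)])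
    have Ha: "H1 U a \<in> carrier (sections Y (preim Y h1 U))"
      by (rule ring_hom_closed[OF scheme_morphismD(2)[OF aut_mor[OF a1] KG.N_open[OF U(1)]] U(2)])
    have "h2 x \<in> points Y" if "x \<in> points Y" for x
      using continuous_map_image_subset_topspace[OF scheme_morphismD(1)[OF aut_mor[OF a2]]] that by auto
    then have p: "preim Y ?h U = preim Y h2 (preim Y h1 U)" by (auto simp: preim_def)
    have "pullbackK ?h ?H A =
        pullbackK h2 H2 (pullbackK h1 H1 A)"
      unfolding U(3) aut_pullback_K[OF aut U(1,2)] aut_pullback_K[OF a1 U(1,2)] aut_pullback_K[OF a2 pU Ha] p
      by (rule refl)
    also have "\<dots> = (inv\<^bsub>G\<^esub> \<tau>) ((inv\<^bsub>G\<^esub> \<sigma>) A)"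
      unfolding r1[OF A] by (rule r2[OF G_closed[OF G.inv_closed[OF G(1)] A]])
    also have "\<dots> = (inv\<^bsub>G\<^esub> \<tau> \<otimes>\<^bsub>G\<^esub> inv\<^bsub>G\<^esub> \<sigma>) A"
      by (rule G_mult_apply[OF G.inv_closed[OF G(2)] G.inv_closed[OF G(1)] A, symmetric])
    also have "\<dots> = (inv\<^bsub>G\<^esub> (\<sigma> \<otimes>\<^bsub>G\<^esub> \<tau>)) A" unfolding G.inv_mult_group[OF G] by (rule refl)
    finally show ?thesis .
  qed
  moreover have "?h y = y" using 1 2 by (simp add: represents_def)
  ultimately have "represents ?h ?H (\<sigma> \<otimes>\<^bsub>G\<^esub> \<tau>)" using aut unfolding represents_def by blast
  then show ?thesis using I_iff G.m_closed[OF G] by blast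
qed

lemma I_subset: "I \<subseteq> carrier G" using I_iff by blast

lemma I_subgroup: "subgroup I G"
  using G.finite_submonoid_is_subgroup[OF finite_subset[OF I_subset finite_G] I_subset I_one I_mult] .

text \<open>An automorphism representing the inverse of \<sigma> pulls functions back by \<sigma>
  itself.\<close>

lemma I_jj:
  assumes \<sigma>: "\<sigma> \<in> I" and a: "a \<in> carrier S"
  shows "\<exists>b\<in>carrier S. \<sigma> (jj a) = jj b \<and> (a \<in> max_ideal S \<longrightarrow> b \<in> max_ideal S)"
proof -
  have "inv\<^bsub>G\<^esub> \<sigma> \<in> I" using I_subgroup \<sigma> by (rule subgroup.m_inv_closed)
  then obtain h H where r: "represents h H (inv\<^bsub>G\<^esub> \<sigma>)" using I_iff by blast
  have "inv\<^bsub>G\<^esub> (inv\<^bsub>G\<^esub> \<sigma>) = \<sigma>" using \<sigma> I_subset by auto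
  then have *: "pullbackK h H (jj a) = \<sigma> (jj a)"
    using r jj.hom_closed[OF a] by (simp add: represents_def)
  have aut: "automorphism_over Y Z f F h H" "h y = y" using r by (simp_all add: represents_def)
  show ?thesis using aut_pullback_jj[OF aut a] unfolding * .
qed

context
  fixes t assumes t: "t \<in> carrier S" "t \<noteq> \<zero>\<^bsub>S\<^esub>" "max_ideal S = {a \<otimes>\<^bsub>S\<^esub> t | a. a \<in> carrier S}"
begin

lemma t_max: "t \<in> max_ideal S"
  unfolding t(3) using t(1) S.l_one[OF t(1)] S.one_closed by (metis (mono_tags, lifting) mem_Collect_eq)

lemma max_idealE:
  assumes "a \<in> max_ideal S" obtains b where "b \<in> carrier S" "a = b \<otimes>\<^bsub>S\<^esub> t"
  using assms unfolding t(3) by blast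

lemma inertia_action: "inertia_action K k \<iota> (jj ` carrier S) (jj t) E I"
proof (rule inertia_action.intro[OF K.field_axioms k.field_axioms], rule inertia_action_axioms.intro)
  show "group (galois_group K E)" "finite (carrier (galois_group K E))" "I \<subseteq> carrier (galois_group K E)"
    "\<one>\<^bsub>galois_group K E\<^esub> \<in> I"
    using group_G finite_G I_subset I_one unfolding G_def by blast+
  show "\<sigma> \<otimes>\<^bsub>galois_group K E\<^esub> \<tau> \<in> I" if "\<sigma> \<in> I" "\<tau> \<in> I" for \<sigma> \<tau>
    using I_mult[OF that] unfolding G_def .
  show "\<iota> \<in> ring_hom k K" by (rule iota_hom)
  show "\<iota> c \<in> jj ` carrier S" if "c \<in> carrier k" for c using \<kappa>.hom_closed[OF that] by (rule imageI)
  show "\<iota> c \<in> E" if "c \<in> carrier k" for c using that by (rule iota_E)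
  show "subring (jj ` carrier S) K"
    by (rule ring_hom_ring.img_is_subring[OF ring_hom_ringI2[OF S.ring_axioms K.ring_axioms jj.homh] S.carrier_is_subring])
  show "jj t \<in> jj ` carrier S" using t(1) by (rule imageI)
  show "jj t \<noteq> \<zero>\<^bsub>K\<^esub>" using jj_zero_iff[OF t(1)] t(2) by simp
  show "a \<otimes>\<^bsub>K\<^esub> jj t \<noteq> \<one>\<^bsub>K\<^esub>" if aj: "a \<in> jj ` carrier S" for a
  proof
    assume eq: "a \<otimes>\<^bsub>K\<^esub> jj t = \<one>\<^bsub>K\<^esub>"
    obtain b where b: "b \<in> carrier S" "a = jj b" using aj by blast
    have "jj (b \<otimes>\<^bsub>S\<^esub> t) = jj \<one>\<^bsub>S\<^esub>"
      using eq unfolding b(2) jj.hom_mult[OF b(1) t(1)] jj.hom_one .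
    then have "b \<otimes>\<^bsub>S\<^esub> t = \<one>\<^bsub>S\<^esub>"
      by (rule jj_inj[OF S.m_closed[OF b(1) t(1)] S.one_closed])
    then have "\<one>\<^bsub>S\<^esub> \<in> max_ideal S" using \<mm>.I_l_closed[OF t_max b(1)] by simp
    then show False using S.Units_one_closed by (simp add: max_ideal_def)
  qed
  show "\<exists>c\<in>carrier k. \<exists>b\<in>jj ` carrier S. a = \<iota> c \<oplus>\<^bsub>K\<^esub> b \<otimes>\<^bsub>K\<^esub> jj t" if a: "a \<in> jj ` carrier S" for a
  proof -
    obtain a' where a': "a' \<in> carrier S" "a = jj a'" using a by blast
    obtain c where c: "c \<in> carrier k" "a' \<ominus>\<^bsub>S\<^esub> \<kappa> c \<in> max_ideal S" using residue[OF a'(1)] by blast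
    obtain b where b: "b \<in> carrier S" "a' \<ominus>\<^bsub>S\<^esub> \<kappa> c = b \<otimes>\<^bsub>S\<^esub> t" using c(2) by (rule max_idealE)
    have kc: "\<kappa> c \<in> carrier S" using c(1) by (rule \<kappa>.hom_closed)
    have "a' = \<kappa> c \<oplus>\<^bsub>S\<^esub> (a' \<ominus>\<^bsub>S\<^esub> \<kappa> c)" by (rule S.add_minus_cancel(2)[OF kc a'(1), symmetric])
    then have "a' = \<kappa> c \<oplus>\<^bsub>S\<^esub> b \<otimes>\<^bsub>S\<^esub> t" unfolding b(2) .
    then have "a = jj (\<kappa> c \<oplus>\<^bsub>S\<^esub> b \<otimes>\<^bsub>S\<^esub> t)" using a'(2) by (rule back_subst[of "\<lambda>x. a = jj x", rotated])
    then have "a = \<iota> c \<oplus>\<^bsub>K\<^esub> jj b \<otimes>\<^bsub>K\<^esub> jj t"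
      unfolding jj.hom_add[OF kc S.m_closed[OF b(1) t(1)]] jj.hom_mult[OF b(1) t(1)] .
    then show ?thesis using c(1) imageI[OF b(1), of jj] by blast
  qed
  show "a = \<zero>\<^bsub>K\<^esub>" if *: "\<And>i::nat. \<exists>b\<in>jj ` carrier S. a = b \<otimes>\<^bsub>K\<^esub> jj t [^]\<^bsub>K\<^esub> i" for a
  proof -
    have jjp: "jj b \<otimes>\<^bsub>K\<^esub> jj t [^]\<^bsub>K\<^esub> i = jj (b \<otimes>\<^bsub>S\<^esub> t [^]\<^bsub>S\<^esub> i)" if "b \<in> carrier S" for b and i :: nat
      unfolding jj.hom_mult[OF that S.nat_pow_closed[OF t(1)]] jj.hom_pow[OF t(1)] by (rule refl)
    have pull: "\<exists>b\<in>carrier S. a = jj (b \<otimes>\<^bsub>S\<^esub> t [^]\<^bsub>S\<^esub> i)" for i :: nat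
    proof -
      obtain x where x: "x \<in> jj ` carrier S" "a = x \<otimes>\<^bsub>K\<^esub> jj t [^]\<^bsub>K\<^esub> i" using *[of i] by blast
      obtain b where b: "b \<in> carrier S" "x = jj b" using x(1) by blast
      have "a = jj (b \<otimes>\<^bsub>S\<^esub> t [^]\<^bsub>S\<^esub> i)" using x(2) unfolding b(2) jjp[OF b(1)] .
      then show ?thesis using b(1) by blast
    qed
    \<comment> \<open>The exponent 0 shows that \<open>a\<close> comes from the stalk; injectivity
      of \<open>jj\<close> then moves all the divisibilities there, where the Krull intersection
      applies.\<close>
    obtain b0 where b0: "b0 \<in> carrier S" "a = jj (b0 \<otimes>\<^bsub>S\<^esub> t [^]\<^bsub>S\<^esub> (0::nat))" using pull by blast
    define a0 where "a0 = b0 \<otimes>\<^bsub>S\<^esub> t [^]\<^bsub>S\<^esub> (0::nat)"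
    have a0: "a0 \<in> carrier S" "a = jj a0"
      unfolding a0_def by (rule S.m_closed[OF b0(1) S.nat_pow_closed[OF t(1)]], rule b0(2))
    have "\<exists>b\<in>carrier S. a0 = b \<otimes>\<^bsub>S\<^esub> t [^]\<^bsub>S\<^esub> i" for i :: nat
    proof -
      obtain b where b: "b \<in> carrier S" "a = jj (b \<otimes>\<^bsub>S\<^esub> t [^]\<^bsub>S\<^esub> i)" using pull by blast
      have "jj a0 = jj (b \<otimes>\<^bsub>S\<^esub> t [^]\<^bsub>S\<^esub> i)" by (rule trans[OF a0(2)[symmetric] b(2)])
      then have "a0 = b \<otimes>\<^bsub>S\<^esub> t [^]\<^bsub>S\<^esub> i"
        by (rule jj_inj[OF a0(1) S.m_closed[OF b(1) S.nat_pow_closed[OF t(1)]]])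
      then show ?thesis using b(1) by blast
    qed
    then have "a0 = \<zero>\<^bsub>S\<^esub>" by (rule stalk_Krull[OF t_max a0(1)])
    then show ?thesis using a0(2) jj.hom_zero by simp
  qed
  show "\<exists>a\<in>jj ` carrier S. \<exists>b\<in>jj ` carrier S. b \<noteq> \<zero>\<^bsub>K\<^esub> \<and> x \<otimes>\<^bsub>K\<^esub> b = a" if "x \<in> carrier K" for x
    using fractions[OF that] by blast
  show "\<sigma> a \<in> jj ` carrier S" if "\<sigma> \<in> I" "a \<in> jj ` carrier S" for \<sigma> a
    using I_jj[OF that(1)] that(2) by blast
  show "\<exists>v\<in>jj ` carrier S. \<sigma> (jj t) = v \<otimes>\<^bsub>K\<^esub> jj t" if \<sigma>: "\<sigma> \<in> I" for \<sigma>
  proof -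
    obtain b where b: "b \<in> max_ideal S" "\<sigma> (jj t) = jj b" using I_jj[OF \<sigma> t(1)] t_max by blast
    obtain v where v: "v \<in> carrier S" "b = v \<otimes>\<^bsub>S\<^esub> t" using b(1) by (rule max_idealE)
    show ?thesis using b(2) v(1) unfolding v(2) jj.hom_mult[OF v(1) t(1)] by blast
  qed
qed

interpretation A: inertia_action K k \<iota> "jj ` carrier S" "jj t" E I by (rule inertia_action)

lemma jj_PIdl: "s \<in> carrier S \<Longrightarrow> {a \<otimes>\<^bsub>K\<^esub> jj s | a. a \<in> jj ` carrier S} = jj ` (PIdl\<^bsub>S\<^esub> s)"
  unfolding cgenideal_def using jj.hom_mult by (auto simp del: jj.hom_mult)

lemma A_mm_1: "A.\<mm> (Suc 0) = jj ` max_ideal S"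
  unfolding A.mm_1_eq[symmetric] jj_PIdl[OF t(1)] t(3) cgenideal_def by (rule refl)

lemma inj_on_jj: "inj_on jj (carrier S)"
  using jj_inj by (rule inj_onI)

lemma jj_image_mem_iff: "a \<in> carrier S \<Longrightarrow> B \<subseteq> carrier S \<Longrightarrow> jj a \<in> jj ` B \<longleftrightarrow> a \<in> B"
  by (rule inj_on_image_mem_iff[OF inj_on_jj])

lemma max_ideal_carrier: "max_ideal S \<subseteq> carrier S" by (simp add: max_ideal_def)

text \<open>Injectivity of \<open>jj\<close> turns equality of ideals and membership in the function
  field into statements in the stalk. The result is literally the body of
  \<open>tame_character\<close>.\<close>

lemma is_character_iff:
  "A.is_character \<sigma> c \<longleftrightarrow> c \<in> carrier k \<and>
     (\<forall>s\<in>carrier S. cgenideal S s = max_ideal S \<longrightarrow>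
        (\<exists>v\<in>carrier S. \<sigma> (jj s) = jj v \<otimes>\<^bsub>K\<^esub> jj s \<and> v \<ominus>\<^bsub>S\<^esub> \<kappa> c \<in> max_ideal S))"
proof (cases "c \<in> carrier k")
  case c: True
  have kc: "\<kappa> c \<in> carrier S" using c by (rule \<kappa>.hom_closed)
  have 1: "{a \<otimes>\<^bsub>K\<^esub> jj s | a. a \<in> jj ` carrier S} = A.\<mm> (Suc 0) \<longleftrightarrow> cgenideal S s = max_ideal S"
    if s: "s \<in> carrier S" for s
  proof -
    have "PIdl\<^bsub>S\<^esub> s \<subseteq> carrier S"
      using ideal.axioms(1)[OF S.cgenideal_ideal[OF s]] additive_subgroup.a_subset by blast
    then show ?thesis
      unfolding jj_PIdl[OF s] A_mm_1 using max_ideal_carrier by (rule inj_on_image_eq_iff[OF inj_on_jj])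
  qed
  have 2: "jj v \<ominus>\<^bsub>K\<^esub> \<iota> c \<in> A.\<mm> (Suc 0) \<longleftrightarrow> v \<ominus>\<^bsub>S\<^esub> \<kappa> c \<in> max_ideal S" if v: "v \<in> carrier S" for v
  proof -
    have "jj v \<ominus>\<^bsub>K\<^esub> \<iota> c = jj (v \<ominus>\<^bsub>S\<^esub> \<kappa> c)"
      using v kc by (simp add: a_minus_def)
    then show ?thesis unfolding A_mm_1 using jj_image_mem_iff[OF S.minus_closed[OF v kc] max_ideal_carrier] by simp
  qed
  show ?thesis unfolding A.is_character_def using c by (simp add: 1 2)
qed (simp add: A.is_character_def)

lemma tame_character_eq: "tame_character k Y y \<sigma> = (THE c. A.is_character \<sigma> c)"
  unfolding tame_character_def is_character_iff by (rule refl)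

text \<open>For inertia elements the character exists uniquely, so the description in
  \<open>tame_character\<close> equals 1 exactly when 1 satisfies it; the unit of the group of roots
  of unity is that of \<open>k\<close>.\<close>

lemma wild_eq: "wild_inertia_group k Y Z f F y = A.wild"
proof -
  have "tame_character k Y y \<sigma> = \<one>\<^bsub>k\<^esub> \<longleftrightarrow> A.is_character \<sigma> \<one>\<^bsub>k\<^esub>" if "\<sigma> \<in> I" for \<sigma>
    unfolding tame_character_eq
    using A.ex1_character[OF that] theI'[OF A.ex1_character[OF that]] the1_equality[OF A.ex1_character[OF that]] by metis
  then show ?thesis
    unfolding wild_inertia_group_def A.wild_def kernel_def by (auto simp: roots_of_unity_def)
qed

lemma wild_inertia_normal_uniformiser: "wild_inertia_group k Y Z f F y \<lhd> G\<lparr>carrier := I\<rparr>"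
  using A.wild_normal unfolding wild_eq G_def .

lemma card_wild_inertia_coprime_uniformiser:
  "add_pow k n \<one>\<^bsub>k\<^esub> \<in> Units k \<Longrightarrow> coprime (card (wild_inertia_group k Y Z f F y)) n"
  unfolding wild_eq by (rule A.card_wild_coprime)

end

lemma wild_inertia_normal: "wild_inertia_group k Y Z f F y \<lhd> G\<lparr>carrier := I\<rparr>"
  using uniformiser wild_inertia_normal_uniformiser by blast

lemma card_wild_inertia_coprime:
  "add_pow k n \<one>\<^bsub>k\<^esub> \<in> Units k \<Longrightarrow> coprime (card (wild_inertia_group k Y Z f F y)) n"
  using uniformiser card_wild_inertia_coprime_uniformiser by blast

lemma finite_wild_inertia: "finite (wild_inertia_group k Y Z f F y)"
  using finite_subset[OF I_subset finite_G]
  by (rule rev_finite_subset) (auto simp: wild_inertia_group_def kernel_def)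

end

lemma (in module) smult_add_pow_one:
  "m \<in> carrier M \<Longrightarrow> add_pow M (j::nat) m = add_pow R j \<one> \<odot>\<^bsub>M\<^esub> m"
  by (induction j) (simp_all add: smult_l_distr smult_l_null)

text \<open>Multiples of 1 in the quotient are the classes of natural numbers, and \<open>n\<close>
  lies in the ideal that it generates.\<close>

lemma add_pow_ZFact: "add_pow (ZFact (int n)) n \<one>\<^bsub>ZFact (int n)\<^esub> = \<zero>\<^bsub>ZFact (int n)\<^esub>"
proof -
  let ?I = "Idl\<^bsub>\<Z>\<^esub> {int n}"
  have ideal: "ideal ?I \<Z>" by (rule int.genideal_ideal) simp
  have Z: "ZFact (int n) = \<Z> Quot ?I" by (simp add: ZFact_def)
  interpret h: ring_hom_ring \<Z> "\<Z> Quot ?I" "(+>\<^bsub>\<Z>\<^esub>) ?I"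
    by (rule ideal.rcos_ring_hom_ring[OF ideal])
  have "add_pow (\<Z> Quot ?I) j \<one>\<^bsub>\<Z> Quot ?I\<^esub> = ?I +>\<^bsub>\<Z>\<^esub> int j" for j :: nat
  proof (induction j)
    case 0
    show ?case using h.hom_zero by simp
  next
    case (Suc j)
    have "?I +>\<^bsub>\<Z>\<^esub> (int j \<oplus>\<^bsub>\<Z>\<^esub> \<one>\<^bsub>\<Z>\<^esub>) = (?I +>\<^bsub>\<Z>\<^esub> int j) \<oplus>\<^bsub>\<Z> Quot ?I\<^esub> \<one>\<^bsub>\<Z> Quot ?I\<^esub>"
      using h.hom_add[of "int j" "1"] h.hom_one by simp
    then show ?case using Suc by (simp add: add.commute)
  qed
  moreover have "?I +>\<^bsub>\<Z>\<^esub> int n = \<zero>\<^bsub>\<Z> Quot ?I\<^esub>"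
  proof -
    have "int n \<in> ?I" by (rule int.genideal_self') simp
    then show ?thesis using int.a_rcos_zero[OF ideal] by (simp only: FactRing_def ring.simps)
  qed
  ultimately show ?thesis unfolding Z by simp
qed


section \<open>The theorem\<close>

theorem mainTheorem10:
  fixes k :: "'k ring" and n :: nat
    and Y :: "('k, 'y, 's) space_over" and Z :: "('k, 'x, 'r) space_over"
    and f :: "'y \<Rightarrow> 'x" and F :: "'x set \<Rightarrow> 'r \<Rightarrow> 's" and y :: 'y
    and M :: "(int set, 'm) module"
    and act :: "(('y, 's) germ \<Rightarrow> ('y, 's) germ) \<Rightarrow> 'm \<Rightarrow> 'm"
  defines "G \<equiv> cover_group Y Z f F"
    and "I \<equiv> (cover_group Y Z f F)\<lparr>carrier := inertia_group Y Z f F y\<rparr>"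
    and "P \<equiv> wild_inertia_group k Y Z f F y"
  assumes "algebraically_closed k"
    and "n \<ge> 1" and "add_pow k n \<one>\<^bsub>k\<^esub> \<in> Units k"
    and "smooth_curve k Y" and "smooth_curve k Z"
    and "morphism_over k Y Z f F"
    and "finite_morphism Y Z f F" and "generically_galois Y Z f F"
    and "y \<in> points Y" and "closedin (space_top Y) {y}"
    and "n dvd ramification_index Y Z f F y"
    and "group_module (ZFact (int n)) G M act"
  shows "inflation I P \<in> hom (crossed_homs (I Mod P) (invariant_module P M act) (coset_action act))
                             (crossed_homs I M act) \<and>
         (\<exists>r \<in> hom (crossed_homs I M act)
                    (crossed_homs (I Mod P) (invariant_module P M act) (coset_action act)).
            \<forall>c \<in> carrier (crossed_homs (I Mod P) (invariant_module P M act) (coset_action act)).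
              r (inflation I P c) = c)"
proof -
  have mod: "module (ZFact (int n)) M" and group_G: "group G"
    and act: "\<And>g m. g \<in> carrier G \<Longrightarrow> m \<in> carrier M \<Longrightarrow> act g m \<in> carrier M"
      "\<And>g m m'. g \<in> carrier G \<Longrightarrow> m \<in> carrier M \<Longrightarrow> m' \<in> carrier M \<Longrightarrow>
         act g (m \<oplus>\<^bsub>M\<^esub> m') = act g m \<oplus>\<^bsub>M\<^esub> act g m'"
      "\<And>m. m \<in> carrier M \<Longrightarrow> act \<one>\<^bsub>G\<^esub> m = m"
      "\<And>g h m. g \<in> carrier G \<Longrightarrow> h \<in> carrier G \<Longrightarrow> m \<in> carrier M \<Longrightarrow>
         act (g \<otimes>\<^bsub>G\<^esub> h) m = act g (act h m)"
    using \<open>group_module (ZFact (int n)) G M act\<close> by (simp_all add: group_module_def)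
  interpret module "ZFact (int n)" M by (rule mod)
  have "field (function_field Y)"
    using \<open>generically_galois Y Z f F\<close> by (simp add: generically_galois_def finite_galois_extension_def)
  then interpret C: pointed_cover k Y y Z f F
    using assms(4) \<open>smooth_curve k Y\<close> \<open>smooth_curve k Z\<close> \<open>morphism_over k Y Z f F\<close> \<open>generically_galois Y Z f F\<close>
      \<open>y \<in> points Y\<close> \<open>closedin (space_top Y) {y}\<close> group_G
    unfolding G_def
    by (intro pointed_cover.intro pointed_curve.intro pointed_curve_axioms.intro pointed_cover_axioms.intro)
  have I_G: "g \<in> carrier G" if "g \<in> carrier I" for g
    using that C.I_subset by (auto simp: I_def G_def)
  \<comment> \<open>What remains of the Z/n-linear structure in the averaging argument: scaling by
    \<open>n\<close> times 1 is scaling by zero.\<close>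
  have annihilated: "add_pow M n m = \<zero>\<^bsub>M\<^esub>" if "m \<in> carrier M" for m
    unfolding smult_add_pow_one[OF that] add_pow_ZFact using that by simp
  have "crossed_hom_averaging P I M act n"
  proof (rule crossed_hom_averaging.intro)
    show "normal P I" using C.wild_inertia_normal by (simp add: P_def I_def)
    show "abelian_group M" by (rule abelian_group_axioms)
    show "crossed_hom_averaging_axioms P I M act n"
    proof
      show "finite P" using C.finite_wild_inertia by (simp add: P_def)
      show "coprime (card P) n"
        using C.card_wild_inertia_coprime \<open>add_pow k n \<one>\<^bsub>k\<^esub> \<in> Units k\<close> by (simp add: P_def)
    qed (use I_G act annihilated in \<open>auto simp: I_def G_def\<close>)
  qed
  then interpret A: crossed_hom_averaging P I M act n .
  show ?thesis using A.inflation_hom A.deflation_hom A.deflation_inflation by blast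
qed

end
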